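(* The parallel spinor flow preserves the vacuum Hamiltonian and momentum constraints. That is, let $\{\beta_t,\mathfrak{e}^t\}_{t\in\mathcal{I}}$ be a parallel spinor flow on $\Sigma$, with $0\in\mathcal{I}$. If $$\mathrm{R}_{h_t}=|\Theta_t|^2_{h_t}-\mathrm{Tr}_{h_t}(\Theta_t)^2\qquad\text{and}\qquad\mathrm{d}\,\mathrm{Tr}_{h_t}(\Theta_t)=\mathrm{div}_{h_t}(\Theta_t)$$ hold at $t=0$, then they hold for every $t\in\mathcal{I}$, where $h_t=h_{\mathfrak{e}^t}$ and $\mathrm{R}_{h_t}$ is its scalar curvature.
   Context: All objects are smooth; $\Sigma$ is a connected oriented three-manifold and $\mathcal{I}$ an open interval. A parallel spinor flow on $\Sigma$ is a family $\{\beta_t,\mathfrak{e}^t\}_{t\in\mathcal{I}}$ of strictly positive functions $\beta_t$ and global coframes $\mathfrak{e}^t=(e^t_u,e^t_l,e^t_n)$ on $\Sigma$ such that, with $$h_{\mathfrak{e}^t}=e^t_u\otimes e^t_u+e^t_l\otimes e^t_l+e^t_n\otimes e^t_n,\qquad\Theta_t=-\frac{1}{2\beta_t}\partial_th_{\mathfrak{e}^t},$$ the following holds for $a=u,l,n$ and all $t\in\mathcal{I}$: $$\partial_te^t_a+\mathrm{d}\beta_t(e^t_a)\,e^t_u+\beta_t\Theta_t(e^t_a)=\delta_{au}\,\mathrm{d}\beta_t,\qquad \mathrm{d}e^t_a=\Theta_t(e^t_a)\wedge e^t_u,$$ $$\partial_t(\Theta_t(e^t_u))+\mathrm{d}(\mathrm{d}\beta_t(e^t_u))=0,\qquad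 \Theta_t(e^t_u)\ \text{is exact on }\Sigma.$$ Here $\Theta_t(\alpha):=\Theta_t(\alpha^\sharp,\cdot)$ and $\mathrm{d}\beta_t(\alpha):=\mathrm{d}\beta_t(\alpha^\sharp)$, with $\sharp$ the $h_{\mathfrak{e}^t}$-metric dual of the one-form $\alpha$ on $\Sigma$. Standing assumption: the Lorentzian metric $g=-\beta_t^2\,\mathrm{d}t\otimes\mathrm{d}t+h_{\mathfrak{e}^t}$ on $M=\mathcal{I}\times\Sigma$ is globally hyperbolic with the slices $\{t\}\times\Sigma$ as Cauchy hypersurfaces. *)

theory Defs
  imports "HOL-Analysis.Analysis"
begin

section \<open>Smooth maps between open subsets of normed spaces\<close>

text \<open>Both notions are meant for open sets: the derivatives are full derivatives at the points
  of the set, and only the values of the map near the set matter.\<close>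

primrec C_k_on :: "nat \<Rightarrow> 'v::real_normed_vector set \<Rightarrow> ('v \<Rightarrow> 'w::real_normed_vector) \<Rightarrow> bool" where
  "C_k_on 0 S f \<longleftrightarrow> continuous_on S f"
| "C_k_on (Suc k) S f \<longleftrightarrow>
     (\<forall>x\<in>S. f differentiable (at x)) \<and>
     (\<forall>v. C_k_on k S (\<lambda>x. frechet_derivative f (at x) v))"

definition smooth_on :: "'v::real_normed_vector set \<Rightarrow> ('v \<Rightarrow> 'w::real_normed_vector) \<Rightarrow> bool" where
  "smooth_on S f \<longleftrightarrow> (\<forall>k. C_k_on k S f)"

definition partial :: "'n::finite \<Rightarrow> (real^'n \<Rightarrow> real) \<Rightarrow> real^'n \<Rightarrow> real" where
  "partial i f x = frechet_derivative f (at x) (axis i 1)"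


section \<open>Smooth three-manifolds\<close>

text \<open>The manifold is a whole type, Hausdorff and second countable by its sort. A chart consists
  of its domain and its coordinate map; the values of the latter outside the domain are
  irrelevant.\<close>

type_synonym 'a chart = "'a set \<times> ('a \<Rightarrow> real^3)"

definition chart_image :: "'a chart \<Rightarrow> (real^3) set" where
  "chart_image \<kappa> = snd \<kappa> ` fst \<kappa>"

definition chart_inv :: "'a chart \<Rightarrow> real^3 \<Rightarrow> 'a" where
  "chart_inv \<kappa> = inv_into (fst \<kappa>) (snd \<kappa>)"

definition transition :: "'a chart \<Rightarrow> 'a chart \<Rightarrow> real^3 \<Rightarrow> real^3" where
  "transition \<kappa> \<kappa>' = snd \<kappa>' \<circ> chart_inv \<kappa>"

definition is_chart :: "'a::topological_space chart \<Rightarrow> bool" where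
  "is_chart \<kappa> \<longleftrightarrow> open (fst \<kappa>) \<and> open (chart_image \<kappa>) \<and>
     homeomorphism (fst \<kappa>) (chart_image \<kappa>) (snd \<kappa>) (chart_inv \<kappa>)"

definition smooth_atlas :: "'a::{t2_space,second_countable_topology} chart set \<Rightarrow> bool" where
  "smooth_atlas A \<longleftrightarrow>
     (\<forall>\<kappa>\<in>A. is_chart \<kappa>) \<and> (\<Union>\<kappa>\<in>A. fst \<kappa>) = UNIV \<and>
     (\<forall>\<kappa>\<in>A. \<forall>\<kappa>'\<in>A. smooth_on (snd \<kappa> ` (fst \<kappa> \<inter> fst \<kappa>')) (transition \<kappa> \<kappa>'))"

definition oriented_atlas :: "'a chart set \<Rightarrow> bool" where
  "oriented_atlas A \<longleftrightarrow>
     (\<forall>\<kappa>\<in>A. \<forall>\<kappa>'\<in>A. \<forall>x\<in>snd \<kappa> ` (fst \<kappa> \<inter> fst \<kappa>').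
        det (matrix (frechet_derivative (transition \<kappa> \<kappa>') (at x))) > 0)"

definition connected_oriented_3manifold ::
    "'a::{t2_space,second_countable_topology} chart set \<Rightarrow> bool" where
  "connected_oriented_3manifold A \<longleftrightarrow>
     connected (UNIV :: 'a set) \<and> smooth_atlas A \<and> oriented_atlas A"

definition smooth_function :: "'a chart set \<Rightarrow> ('a \<Rightarrow> real) \<Rightarrow> bool" where
  "smooth_function A f \<longleftrightarrow> (\<forall>\<kappa>\<in>A. smooth_on (chart_image \<kappa>) (f \<circ> chart_inv \<kappa>))"

text \<open>A one-form is given by its components in every chart, as functions of the coordinates of
  that chart, subject to the transformation law of covectors. Tensor equations below are likewise
  equations between components that are required in every chart.\<close>

type_synonym 'a form1 = "'a chart \<Rightarrow> real^3 \<Rightarrow> real^3"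

definition is_form1 :: "'a chart set \<Rightarrow> 'a form1 \<Rightarrow> bool" where
  "is_form1 A \<omega> \<longleftrightarrow>
     (\<forall>\<kappa>\<in>A. \<forall>\<kappa>'\<in>A. \<forall>x\<in>snd \<kappa> ` (fst \<kappa> \<inter> fst \<kappa>'). \<forall>v.
        \<omega> \<kappa> x \<bullet> v =
        \<omega> \<kappa>' (transition \<kappa> \<kappa>' x) \<bullet> frechet_derivative (transition \<kappa> \<kappa>') (at x) v)"


section \<open>Tensor calculus in a coordinate chart\<close>

definition differential :: "(real^'n \<Rightarrow> real) \<Rightarrow> real^'n::finite \<Rightarrow> real^'n" where
  "differential f x = (\<chi> i. partial i f x)"

definition ext_deriv :: "(real^'n \<Rightarrow> real^'n) \<Rightarrow> real^'n::finite \<Rightarrow> real^'n^'n" where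
  "ext_deriv \<alpha> x = (\<chi> i j. partial i (\<lambda>y. \<alpha> y $ j) x - partial j (\<lambda>y. \<alpha> y $ i) x)"

definition wedge :: "real^'n \<Rightarrow> real^'n \<Rightarrow> real^'n^'n::finite" where
  "wedge \<alpha> \<beta> = (\<chi> i j. \<alpha> $ i * \<beta> $ j - \<alpha> $ j * \<beta> $ i)"

text \<open>Pointwise operations with respect to a scalar product h on the tangent space.\<close>

definition sharp :: "real^'n^'n \<Rightarrow> real^'n \<Rightarrow> real^'n::finite" where
  "sharp h \<alpha> = matrix_inv h *v \<alpha>"

definition contract2 :: "real^'n^'n \<Rightarrow> real^'n^'n \<Rightarrow> real^'n \<Rightarrow> real^'n::finite" where
  "contract2 h T \<alpha> = (\<chi> j. \<Sum>i\<in>UNIV. sharp h \<alpha> $ i * T $ i $ j)"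

definition contract1 :: "real^'n^'n \<Rightarrow> real^'n \<Rightarrow> real^'n \<Rightarrow> real" where
  "contract1 h \<omega> \<alpha> = \<omega> \<bullet> sharp h (\<alpha> :: real^'n::finite)"

definition metric_trace :: "real^'n^'n \<Rightarrow> real^'n^'n::finite \<Rightarrow> real" where
  "metric_trace h T = (\<Sum>i\<in>UNIV. \<Sum>j\<in>UNIV. matrix_inv h $ i $ j * T $ i $ j)"

definition metric_norm_sq :: "real^'n^'n \<Rightarrow> real^'n^'n::finite \<Rightarrow> real" where
  "metric_norm_sq h T =
     (\<Sum>i\<in>UNIV. \<Sum>j\<in>UNIV. \<Sum>k\<in>UNIV. \<Sum>l\<in>UNIV.
        matrix_inv h $ i $ k * matrix_inv h $ j $ l * T $ i $ j * T $ k $ l)"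

text \<open>From here on h is a metric in coordinates, with Levi-Civita connection given by its
  Christoffel symbols; the first index of \<^term>\<open>christoffel h k i j\<close> is the upper one.\<close>

definition christoffel :: "(real^'n \<Rightarrow> real^'n^'n) \<Rightarrow> 'n \<Rightarrow> 'n \<Rightarrow> 'n \<Rightarrow> real^'n::finite \<Rightarrow> real" where
  "christoffel h k i j x =
     (\<Sum>l\<in>UNIV. matrix_inv (h x) $ k $ l *
        (partial i (\<lambda>y. h y $ j $ l) x + partial j (\<lambda>y. h y $ i $ l) x
         - partial l (\<lambda>y. h y $ i $ j) x)) / 2"

text \<open>The sign convention is the one in which round spheres have positive Ricci curvature.\<close>

definition ricci :: "(real^'n \<Rightarrow> real^'n^'n) \<Rightarrow> real^'n::finite \<Rightarrow> real^'n^'n" where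
  "ricci h x = (\<chi> j k. \<Sum>i\<in>UNIV.
     partial i (christoffel h i j k) x - partial j (christoffel h i i k) x
     + (\<Sum>m\<in>UNIV. christoffel h i i m x * christoffel h m j k x
                 - christoffel h i j m x * christoffel h m i k x))"

definition scalar_curvature :: "(real^'n \<Rightarrow> real^'n^'n) \<Rightarrow> real^'n::finite \<Rightarrow> real" where
  "scalar_curvature h x = metric_trace (h x) (ricci h x)"

definition cov_deriv2 ::
    "(real^'n \<Rightarrow> real^'n^'n) \<Rightarrow> (real^'n \<Rightarrow> real^'n^'n) \<Rightarrow> 'n \<Rightarrow> 'n \<Rightarrow> 'n \<Rightarrow> real^'n::finite \<Rightarrow> real" where
  "cov_deriv2 h T k i j x =
     partial k (\<lambda>y. T y $ i $ j) x
     - (\<Sum>l\<in>UNIV. christoffel h l k i x * T x $ l $ j)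
     - (\<Sum>l\<in>UNIV. christoffel h l k j x * T x $ i $ l)"

definition divergence2 ::
    "(real^'n \<Rightarrow> real^'n^'n) \<Rightarrow> (real^'n \<Rightarrow> real^'n^'n) \<Rightarrow> real^'n::finite \<Rightarrow> real^'n" where
  "divergence2 h T x =
     (\<chi> j. \<Sum>i\<in>UNIV. \<Sum>k\<in>UNIV. matrix_inv (h x) $ i $ k * cov_deriv2 h T k i j x)"


section \<open>Parallel spinor flows\<close>

datatype leg = Leg_u | Leg_l | Leg_n

type_synonym 'a coframes = "real \<Rightarrow> leg \<Rightarrow> 'a form1"

definition smooth_coframe_family :: "'a chart set \<Rightarrow> real set \<Rightarrow> 'a coframes \<Rightarrow> bool" where
  "smooth_coframe_family A I e \<longleftrightarrow>
     (\<forall>t\<in>I. \<forall>a. is_form1 A (e t a)) \<and>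
     (\<forall>a. \<forall>\<kappa>\<in>A. smooth_on (I \<times> chart_image \<kappa>) (\<lambda>(t, x). e t a \<kappa> x)) \<and>
     (\<forall>t\<in>I. \<forall>\<kappa>\<in>A. \<forall>x\<in>chart_image \<kappa>.
        inj (\<lambda>a. e t a \<kappa> x) \<and> independent (range (\<lambda>a. e t a \<kappa> x)))"

definition smooth_function_family :: "'a chart set \<Rightarrow> real set \<Rightarrow> (real \<Rightarrow> 'a \<Rightarrow> real) \<Rightarrow> bool" where
  "smooth_function_family A I \<beta> \<longleftrightarrow>
     (\<forall>\<kappa>\<in>A. smooth_on (I \<times> chart_image \<kappa>) (\<lambda>(t, x). \<beta> t (chart_inv \<kappa> x)))"

definition coframe_metric :: "'a coframes \<Rightarrow> real \<Rightarrow> 'a chart \<Rightarrow> real^3 \<Rightarrow> real^3^3" where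
  "coframe_metric e t \<kappa> x =
     (\<chi> i j. e t Leg_u \<kappa> x $ i * e t Leg_u \<kappa> x $ j
           + e t Leg_l \<kappa> x $ i * e t Leg_l \<kappa> x $ j
           + e t Leg_n \<kappa> x $ i * e t Leg_n \<kappa> x $ j)"

definition Theta ::
    "(real \<Rightarrow> 'a \<Rightarrow> real) \<Rightarrow> 'a coframes \<Rightarrow> real \<Rightarrow> 'a chart \<Rightarrow> real^3 \<Rightarrow> real^3^3" where
  "Theta \<beta> e t \<kappa> x =
     (- 1 / (2 * \<beta> t (chart_inv \<kappa> x))) *\<^sub>R
       vector_derivative (\<lambda>s. coframe_metric e s \<kappa> x) (at t)"

definition Theta_leg ::
    "(real \<Rightarrow> 'a \<Rightarrow> real) \<Rightarrow> 'a coframes \<Rightarrow> real \<Rightarrow> leg \<Rightarrow> 'a form1" where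
  "Theta_leg \<beta> e t a \<kappa> x = contract2 (coframe_metric e t \<kappa> x) (Theta \<beta> e t \<kappa> x) (e t a \<kappa> x)"

definition d_lapse :: "(real \<Rightarrow> 'a \<Rightarrow> real) \<Rightarrow> real \<Rightarrow> 'a form1" where
  "d_lapse \<beta> t \<kappa> x = differential (\<beta> t \<circ> chart_inv \<kappa>) x"

definition d_lapse_leg ::
    "(real \<Rightarrow> 'a \<Rightarrow> real) \<Rightarrow> 'a coframes \<Rightarrow> real \<Rightarrow> leg \<Rightarrow> 'a chart \<Rightarrow> real^3 \<Rightarrow> real" where
  "d_lapse_leg \<beta> e t a \<kappa> x = contract1 (coframe_metric e t \<kappa> x) (d_lapse \<beta> t \<kappa> x) (e t a \<kappa> x)"

definition exact_form1 :: "'a chart set \<Rightarrow> 'a form1 \<Rightarrow> bool" where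
  "exact_form1 A \<omega> \<longleftrightarrow>
     (\<exists>f. smooth_function A f \<and>
        (\<forall>\<kappa>\<in>A. \<forall>x\<in>chart_image \<kappa>. \<omega> \<kappa> x = differential (f \<circ> chart_inv \<kappa>) x))"

definition parallel_spinor_flow ::
    "'a chart set \<Rightarrow> real set \<Rightarrow> (real \<Rightarrow> 'a \<Rightarrow> real) \<Rightarrow> 'a coframes \<Rightarrow> bool" where
  "parallel_spinor_flow A I \<beta> e \<longleftrightarrow>
     smooth_function_family A I \<beta> \<and> (\<forall>t\<in>I. \<forall>p. \<beta> t p > 0) \<and>
     smooth_coframe_family A I e \<and>
     (\<forall>t\<in>I. \<forall>\<kappa>\<in>A. \<forall>x\<in>chart_image \<kappa>. \<forall>a.
        vector_derivative (\<lambda>s. e s a \<kappa> x) (at t)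
          + d_lapse_leg \<beta> e t a \<kappa> x *\<^sub>R e t Leg_u \<kappa> x
          + \<beta> t (chart_inv \<kappa> x) *\<^sub>R Theta_leg \<beta> e t a \<kappa> x
        = (if a = Leg_u then d_lapse \<beta> t \<kappa> x else 0)) \<and>
     (\<forall>t\<in>I. \<forall>\<kappa>\<in>A. \<forall>x\<in>chart_image \<kappa>. \<forall>a.
        ext_deriv (e t a \<kappa>) x = wedge (Theta_leg \<beta> e t a \<kappa> x) (e t Leg_u \<kappa> x)) \<and>
     (\<forall>t\<in>I. \<forall>\<kappa>\<in>A. \<forall>x\<in>chart_image \<kappa>.
        vector_derivative (\<lambda>s. Theta_leg \<beta> e s Leg_u \<kappa> x) (at t)
          + differential (d_lapse_leg \<beta> e t Leg_u \<kappa>) x = 0) \<and>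
     (\<forall>t\<in>I. exact_form1 A (Theta_leg \<beta> e t Leg_u))"

definition hamiltonian_constraint ::
    "'a chart set \<Rightarrow> (real \<Rightarrow> 'a \<Rightarrow> real) \<Rightarrow> 'a coframes \<Rightarrow> real \<Rightarrow> bool" where
  "hamiltonian_constraint A \<beta> e t \<longleftrightarrow>
     (\<forall>\<kappa>\<in>A. \<forall>x\<in>chart_image \<kappa>.
        scalar_curvature (coframe_metric e t \<kappa>) x =
          metric_norm_sq (coframe_metric e t \<kappa> x) (Theta \<beta> e t \<kappa> x)
          - (metric_trace (coframe_metric e t \<kappa> x) (Theta \<beta> e t \<kappa> x))\<^sup>2)"

definition momentum_constraint ::
    "'a chart set \<Rightarrow> (real \<Rightarrow> 'a \<Rightarrow> real) \<Rightarrow> 'a coframes \<Rightarrow> real \<Rightarrow> bool" where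
  "momentum_constraint A \<beta> e t \<longleftrightarrow>
     (\<forall>\<kappa>\<in>A. \<forall>x\<in>chart_image \<kappa>.
        differential (\<lambda>y. metric_trace (coframe_metric e t \<kappa> y) (Theta \<beta> e t \<kappa> y)) x =
          divergence2 (coframe_metric e t \<kappa>) (Theta \<beta> e t \<kappa>) x)"


section \<open>Cauchy hypersurfaces in products of an interval and a three-manifold\<close>

text \<open>Spacetimes are products of an open interval with the manifold, covered by the charts
  that leave the time coordinate unchanged; a metric is given by its components in these
  charts, as a bilinear form at every coordinate point.\<close>

type_synonym 'a metric4 =
  "'a chart \<Rightarrow> real \<times> (real^3) \<Rightarrow> real \<times> (real^3) \<Rightarrow> real \<times> (real^3) \<Rightarrow> real"

definition spacetime_metric :: "(real \<Rightarrow> 'a \<Rightarrow> real) \<Rightarrow> 'a coframes \<Rightarrow> 'a metric4" where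
  "spacetime_metric \<beta> e \<kappa> p v w =
     - (\<beta> (fst p) (chart_inv \<kappa> (snd p)))\<^sup>2 * (fst v * fst w)
     + snd v \<bullet> (coframe_metric e (fst p) \<kappa> (snd p) *v snd w)"

definition curve_in_chart :: "'a chart \<Rightarrow> (real \<Rightarrow> real \<times> 'a) \<Rightarrow> real \<Rightarrow> real \<times> (real^3)" where
  "curve_in_chart \<kappa> c s = (fst (c s), snd \<kappa> (snd (c s)))"

definition smooth_curve ::
    "'a::topological_space chart set \<Rightarrow> real set \<Rightarrow> real set \<Rightarrow> (real \<Rightarrow> real \<times> 'a) \<Rightarrow> bool" where
  "smooth_curve A I J c \<longleftrightarrow>
     open J \<and> is_interval J \<and> J \<noteq> {} \<and>
     c ` J \<subseteq> I \<times> UNIV \<and> continuous_on J c \<and>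
     (\<forall>\<kappa>\<in>A. smooth_on {s\<in>J. snd (c s) \<in> fst \<kappa>} (curve_in_chart \<kappa> c))"

definition causal_curve ::
    "'a::topological_space chart set \<Rightarrow> real set \<Rightarrow> 'a metric4 \<Rightarrow> real set \<Rightarrow>
     (real \<Rightarrow> real \<times> 'a) \<Rightarrow> bool" where
  "causal_curve A I g J c \<longleftrightarrow>
     smooth_curve A I J c \<and>
     (\<forall>\<kappa>\<in>A. \<forall>s\<in>J. snd (c s) \<in> fst \<kappa> \<longrightarrow>
        (let v = vector_derivative (curve_in_chart \<kappa> c) (at s)
         in v \<noteq> 0 \<and> g \<kappa> (curve_in_chart \<kappa> c s) v v \<le> 0))"

definition right_endpoint ::
    "real set \<Rightarrow> (real \<Rightarrow> 'p::topological_space) \<Rightarrow> 'p \<Rightarrow> bool" where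
  "right_endpoint J c p \<longleftrightarrow> (\<forall>W. open W \<and> p \<in> W \<longrightarrow> (\<exists>s0\<in>J. \<forall>s\<in>J. s0 \<le> s \<longrightarrow> c s \<in> W))"

definition left_endpoint ::
    "real set \<Rightarrow> (real \<Rightarrow> 'p::topological_space) \<Rightarrow> 'p \<Rightarrow> bool" where
  "left_endpoint J c p \<longleftrightarrow> (\<forall>W. open W \<and> p \<in> W \<longrightarrow> (\<exists>s0\<in>J. \<forall>s\<in>J. s \<le> s0 \<longrightarrow> c s \<in> W))"

definition inextendible ::
    "real set \<Rightarrow> real set \<Rightarrow> (real \<Rightarrow> real \<times> 'a::topological_space) \<Rightarrow> bool" where
  "inextendible I J c \<longleftrightarrow>
     (\<forall>p\<in>I \<times> UNIV. \<not> right_endpoint J c p \<and> \<not> left_endpoint J c p)"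

text \<open>Inextendible causal (timelike or null) curves meet a Cauchy hypersurface exactly once, and
  a spacetime is globally hyperbolic if it has a Cauchy hypersurface. Causal curves have
  nowhere vanishing velocity but no prescribed time orientation.\<close>

definition cauchy_hypersurface ::
    "'a::topological_space chart set \<Rightarrow> real set \<Rightarrow> 'a metric4 \<Rightarrow> (real \<times> 'a) set \<Rightarrow> bool" where
  "cauchy_hypersurface A I g S \<longleftrightarrow>
     S \<subseteq> I \<times> UNIV \<and>
     (\<forall>J c. causal_curve A I g J c \<and> inextendible I J c \<longrightarrow> (\<exists>!s. s \<in> J \<and> c s \<in> S))"

definition globally_hyperbolic ::
    "'a::topological_space chart set \<Rightarrow> real set \<Rightarrow> 'a metric4 \<Rightarrow> bool" where
  "globally_hyperbolic A I g \<longleftrightarrow> (\<exists>S. cauchy_hypersurface A I g S)"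

end

theory Submission
  imports Defs
begin

text \<open>Put \<open>e\<^sub>0 = \<beta> dt\<close>, so that \<open>g = - e\<^sub>0 \<otimes> e\<^sub>0 + h\<close>, and \<open>u = e\<^sub>0 + e\<^sub>u\<close>. With the one-forms
  \<open>\<kappa>\<^sub>a = \<Theta>(e\<^sub>a) - d\<beta>(e\<^sub>a) dt\<close> the equations of a parallel spinor flow become structure equations on
  spacetime,
  \<open>du = \<kappa>\<^sub>u \<and> u\<close>, \<open>de\<^sub>l = \<kappa>\<^sub>l \<and> u\<close>, \<open>de\<^sub>n = \<kappa>\<^sub>n \<and> u\<close>, \<open>de\<^sub>0 = \<Sum>\<^sub>a \<kappa>\<^sub>a \<and> e\<^sub>a\<close>, \<open>d\<kappa>\<^sub>u = 0\<close>;
  they say that \<open>u\<close> spans a parallel null line with flat connection. All curvature then sits in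
  \<open>\<Omega>\<^sub>c = d\<kappa>\<^sub>c + \<kappa>\<^sub>u \<and> \<kappa>\<^sub>c\<close> for \<open>c = l, n\<close>. Applying \<open>d\<close> to the structure equations gives
  \<open>\<Omega>\<^sub>c \<and> u = 0\<close> and \<open>\<Omega>\<^sub>l \<and> e\<^sub>l + \<Omega>\<^sub>n \<and> e\<^sub>n = 0\<close>, so that \<open>\<Omega>\<^sub>c\<close> is annihilated by the null vector \<open>k\<close>
  with \<open>e\<^sub>0(k) = 1\<close> and \<open>e\<^sub>u(k) = -1\<close>. The function \<open>f = \<Omega>\<^sub>l(e\<^sub>l, e\<^sub>u) + \<Omega>\<^sub>n(e\<^sub>n, e\<^sub>u)\<close>, called the
  defect below, is up to sign the factor of \<open>u \<otimes> u\<close> in the Ricci tensor of \<open>g\<close>.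

  On a slice, \<open>\<Omega>\<^sub>c\<close> restricts to \<open>d\<Theta>(e\<^sub>c) - \<Theta>(e\<^sub>c) \<and> \<Theta>(e\<^sub>u)\<close>, and the structure equations determine
  the Levi-Civita connection of the slice. The two sides of the Hamiltonian constraint turn out
  to differ by \<open>-2 f\<close> and those of the momentum constraint by \<open>- f e\<^sub>u\<close>. Hence the Hamiltonian constraint
  is equivalent to \<open>f = 0\<close> (\<open>hamiltonian_iff\<close>), and \<open>f = 0\<close> implies the momentum constraint
  (\<open>momentum\<close>).

  It remains to propagate \<open>f = 0\<close> from \<open>t = 0\<close>. Applying \<open>d\<close> once more gives \<open>d\<Omega>\<^sub>c = - \<kappa>\<^sub>u \<and> \<Omega>\<^sub>c\<close>, and
  evaluation on \<open>k, e\<^sub>c, e\<^sub>u\<close> yields \<open>k(f) = - 2 \<kappa>\<^sub>u(k) f\<close> (\<open>transport\<close>): along an integral curve of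
  \<open>\<beta> k = \<partial>\<^sub>t - \<beta> e\<^sub>u\<close> the defect solves a linear ordinary differential equation, so it vanishes
  everywhere on the curve or nowhere. A maximal integral curve is an inextendible null curve
  (\<open>maximal_curve_inextendible\<close>, \<open>integral_curve_causal\<close>), so it meets the Cauchy hypersurface
  \<open>t = 0\<close>, where the defect vanishes. The computations take place in charts; that the vanishing
  of \<open>f\<close> is independent of the chart follows because \<open>f\<close> is a polynomial in scalar functions and
  their derivatives along the frame (\<open>defect_scalar\<close>).\<close>

section \<open>Smooth functions\<close>

abbreviation dir :: "'v::real_normed_vector \<Rightarrow> ('v \<Rightarrow> 'w::real_normed_vector) \<Rightarrow> 'v \<Rightarrow> 'w" where
  "dir v f p \<equiv> frechet_derivative f (at p) v"

lemma dir_eqI: "(f has_derivative f') (at p) \<Longrightarrow> dir v f p = f' v"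
  by (metis frechet_derivative_at)

lemma has_derivative_dir: "f differentiable (at p) \<Longrightarrow> (f has_derivative (\<lambda>v. dir v f p)) (at p)"
  by (simp add: frechet_derivative_works)

lemma differentiable_cong_open:
  assumes "open S" "x \<in> S" "\<And>y. y \<in> S \<Longrightarrow> f y = g y" "f differentiable (at x)"
  shows "g differentiable (at x)"
  using assms unfolding differentiable_def
  by (metis (no_types, lifting) has_derivative_transform_within_open)

lemma dir_cong_open:
  assumes "open S" "x \<in> S" "\<And>y. y \<in> S \<Longrightarrow> f y = g y" "f differentiable (at x)"
  shows "dir v f x = dir v g x"
  using frechet_derivative_transform_within_open[OF assms(4,1,2,3)] by simp

lemma C_k_on_cong:
  assumes "open S" "\<And>x. x \<in> S \<Longrightarrow> f x = g x" "C_k_on k S f"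
  shows "C_k_on k S g"
  using assms(2,3)
proof (induction k arbitrary: f g)
  case 0 then show ?case by (simp cong: continuous_on_cong)
next
  case (Suc k)
  have "g differentiable (at x)" if "x \<in> S" for x
    using differentiable_cong_open[OF assms(1) that Suc.prems(1)] Suc.prems(2) that by simp
  moreover have "C_k_on k S (\<lambda>x. dir v g x)" for v
  proof (rule Suc.IH[of "\<lambda>x. dir v f x"])
    show "dir v f x = dir v g x" if "x \<in> S" for x
      using dir_cong_open[OF assms(1) that Suc.prems(1)] Suc.prems(2) that by simp
    show "C_k_on k S (\<lambda>x. dir v f x)" using Suc.prems(2) by simp
  qed
  ultimately show ?case by simp
qed

lemma C_k_on_SucD: "C_k_on (Suc k) S f \<Longrightarrow> C_k_on k S f"
proof (induction k arbitrary: f)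
  case 0
  then show ?case
    by (simp add: continuous_at_imp_continuous_on differentiable_imp_continuous_within)
next
  case (Suc k) then show ?case by (metis C_k_on.simps(2))
qed

lemma C_k_on_subset: "T \<subseteq> S \<Longrightarrow> C_k_on k S f \<Longrightarrow> C_k_on k T f"
  by (induction k arbitrary: f) (auto intro: continuous_on_subset)

lemma C_k_on_const: "C_k_on k S (\<lambda>x. c)"
  by (induction k arbitrary: c) auto

text \<open>A formula for the derivative is available at the points of the set only, whereas the derivative
  in \<^const>\<open>C_k_on\<close> is a function on the whole space; openness bridges the difference.\<close>

lemma C_k_on_SucI:
  assumes "open S" "\<And>x. x \<in> S \<Longrightarrow> (f has_derivative (\<lambda>v. f' v x)) (at x)"
    and "\<And>v. C_k_on k S (f' v)"
  shows "C_k_on (Suc k) S f"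
proof -
  have "C_k_on k S (\<lambda>x. dir v f x)" for v
    by (rule C_k_on_cong[OF assms(1) _ assms(3)[of v]]) (simp add: dir_eqI[OF assms(2)])
  then show ?thesis using assms(2) by (auto simp: differentiable_def)
qed

lemma C_k_on_has_derivative:
  "C_k_on (Suc k) S f \<Longrightarrow> x \<in> S \<Longrightarrow> (f has_derivative (\<lambda>v. dir v f x)) (at x)"
  by (auto intro: has_derivative_dir)

lemma C_k_on_add:
  assumes "open S" "C_k_on k S f" "C_k_on k S g" shows "C_k_on k S (\<lambda>x. f x + g x)"
  using assms(2,3)
proof (induction k arbitrary: f g)
  case 0 then show ?case by (simp add: continuous_on_add)
next
  case (Suc k)
  show ?case
  proof (rule C_k_on_SucI[OF assms(1)])
    show "((\<lambda>x. f x + g x) has_derivative (\<lambda>v. dir v f x + dir v g x)) (at x)" if "x \<in> S" for x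
      by (intro has_derivative_add C_k_on_has_derivative[OF Suc.prems(1) that]
            C_k_on_has_derivative[OF Suc.prems(2) that])
  qed (use Suc in auto)
qed

lemma C_k_on_bounded_linear:
  assumes "open S" "bounded_linear L" "C_k_on k S f" shows "C_k_on k S (\<lambda>x. L (f x))"
  using assms(3)
proof (induction k arbitrary: f)
  case 0 then show ?case by (simp add: bounded_linear.continuous_on[OF assms(2)])
next
  case (Suc k)
  show ?case
  proof (rule C_k_on_SucI[OF assms(1)])
    show "((\<lambda>x. L (f x)) has_derivative (\<lambda>v. L (dir v f x))) (at x)" if "x \<in> S" for x
      by (rule bounded_linear.has_derivative[OF assms(2) C_k_on_has_derivative[OF Suc.prems that]])
  qed (use Suc in auto)
qed

lemma C_k_on_bounded_bilinear:
  assumes "open S" "bounded_bilinear B" "C_k_on k S f" "C_k_on k S g"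
  shows "C_k_on k S (\<lambda>x. B (f x) (g x))"
  using assms(3,4)
proof (induction k arbitrary: f g)
  case 0 then show ?case by (simp add: bounded_bilinear.continuous_on[OF assms(2)])
next
  case (Suc k)
  show ?case
  proof (rule C_k_on_SucI[OF assms(1)])
    show "((\<lambda>x. B (f x) (g x)) has_derivative (\<lambda>v. B (f x) (dir v g x) + B (dir v f x) (g x))) (at x)"
      if "x \<in> S" for x
      using bounded_bilinear.FDERIV[OF assms(2) C_k_on_has_derivative[OF Suc.prems(1) that]
          C_k_on_has_derivative[OF Suc.prems(2) that]] .
    fix v
    show "C_k_on k S (\<lambda>x. B (f x) (dir v g x) + B (dir v f x) (g x))"
      by (intro C_k_on_add[OF assms(1)] Suc.IH) (use Suc.prems C_k_on_SucD in auto)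
  qed
qed

lemma C_k_on_sum:
  assumes "open S" "finite I" "\<And>i. i \<in> I \<Longrightarrow> C_k_on k S (f i)"
  shows "C_k_on k S (\<lambda>x. \<Sum>i\<in>I. f i x)"
  using assms(2,3) by (induction I) (auto intro: C_k_on_add[OF assms(1)] C_k_on_const)

text \<open>The derivative is expanded in a basis because \<^const>\<open>C_k_on\<close> controls derivatives in one fixed
  direction at a time, while the chain rule differentiates in a direction that moves.\<close>

lemma C_k_on_compose:
  fixes g :: "'u::real_normed_vector \<Rightarrow> 'v::euclidean_space" and f :: "'v \<Rightarrow> 'w::real_normed_vector"
  assumes "open S" "g ` S \<subseteq> T" "C_k_on k T f" "C_k_on k S g"
  shows "C_k_on k S (\<lambda>x. f (g x))"
  using assms(3,4)
proof (induction k arbitrary: f)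
  case 0 then show ?case using assms(2) by (auto intro: continuous_on_compose2)
next
  case (Suc k)
  define f' where "f' v x = (\<Sum>b\<in>Basis. (dir v g x \<bullet> b) *\<^sub>R dir b f (g x))" for v x
  show ?case
  proof (rule C_k_on_SucI[OF assms(1)])
    fix x assume x: "x \<in> S"
    have f: "(f has_derivative (\<lambda>v. dir v f (g x))) (at (g x))"
      using assms(2) x Suc.prems(1) by (blast intro: C_k_on_has_derivative)
    have "dir w f (g x) = (\<Sum>b\<in>Basis. (w \<bullet> b) *\<^sub>R dir b f (g x))" for w
    proof -
      have "linear (\<lambda>v. dir v f (g x))" using f has_derivative_linear by blast
      then show ?thesis
        by (subst euclidean_representation[of w, symmetric]) (simp add: linear_sum linear_scale)
    qed
    then have "(\<lambda>v. dir (dir v g x) f (g x)) = (\<lambda>v. f' v x)" unfolding f'_def by metis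
    then show "((\<lambda>x. f (g x)) has_derivative (\<lambda>v. f' v x)) (at x)"
      using has_derivative_compose[OF C_k_on_has_derivative[OF Suc.prems(2) x] f] by simp
  next
    fix v
    show "C_k_on k S (f' v)" unfolding f'_def
    proof (intro C_k_on_sum[OF assms(1)] C_k_on_bounded_bilinear[OF assms(1) bounded_bilinear_scaleR])
      fix b :: 'v
      show "C_k_on k S (\<lambda>x. dir v g x \<bullet> b)"
        by (rule C_k_on_bounded_linear[OF assms(1) bounded_linear_inner_left]) (use Suc.prems in auto)
      show "C_k_on k S (\<lambda>x. dir b f (g x))"
        by (rule Suc.IH) (use Suc.prems C_k_on_SucD in auto)
    qed simp
  qed
qed

lemma C_k_on_inverse:
  fixes f :: "'v::real_normed_vector \<Rightarrow> real"
  assumes "open S" "\<And>x. x \<in> S \<Longrightarrow> f x \<noteq> 0" "C_k_on k S f"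
  shows "C_k_on k S (\<lambda>x. inverse (f x))"
  using assms(3)
proof (induction k)
  case 0 then show ?case using assms(2) by (auto intro: continuous_on_inverse)
next
  case (Suc k)
  show ?case
  proof (rule C_k_on_SucI[OF assms(1)])
    show "((\<lambda>x. inverse (f x)) has_derivative (\<lambda>v. - (inverse (f x) * dir v f x * inverse (f x)))) (at x)"
      if "x \<in> S" for x
      by (rule Deriv.has_derivative_inverse[OF assms(2)[OF that] C_k_on_has_derivative[OF Suc.prems that]])
    fix v
    have i: "C_k_on k S (\<lambda>x. inverse (f x))" using Suc C_k_on_SucD by blast
    have "C_k_on k S (\<lambda>x. (inverse (f x) * dir v f x) * inverse (f x))"
      using Suc.prems
      by (intro C_k_on_bounded_bilinear[OF assms(1) bounded_bilinear_mult] i) simp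
    then show "C_k_on k S (\<lambda>x. - (inverse (f x) * dir v f x * inverse (f x)))"
      by (rule C_k_on_bounded_linear[OF assms(1) bounded_linear_minus[OF bounded_linear_ident]])
  qed
qed

lemma smooth_on_cong:
  "open S \<Longrightarrow> (\<And>x. x \<in> S \<Longrightarrow> f x = g x) \<Longrightarrow> smooth_on S f \<Longrightarrow> smooth_on S g"
  unfolding smooth_on_def by (metis C_k_on_cong)

lemma smooth_on_differentiable: "smooth_on S f \<Longrightarrow> x \<in> S \<Longrightarrow> f differentiable (at x)"
  unfolding smooth_on_def by (metis C_k_on.simps(2))

lemma smooth_on_has_derivative:
  "smooth_on S f \<Longrightarrow> x \<in> S \<Longrightarrow> (f has_derivative (\<lambda>v. dir v f x)) (at x)"
  by (simp add: has_derivative_dir smooth_on_differentiable)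

lemma smooth_on_continuous_on: "smooth_on S f \<Longrightarrow> continuous_on S f"
  unfolding smooth_on_def by (metis C_k_on.simps(1))

lemma smooth_on_dir: "smooth_on S f \<Longrightarrow> smooth_on S (dir v f)"
  unfolding smooth_on_def by (metis C_k_on.simps(2))

lemma smooth_on_const: "smooth_on S (\<lambda>x. c)"
  by (simp add: smooth_on_def C_k_on_const)

lemma smooth_on_bounded_linear:
  "open S \<Longrightarrow> bounded_linear L \<Longrightarrow> smooth_on S f \<Longrightarrow> smooth_on S (\<lambda>x. L (f x))"
  by (simp add: smooth_on_def C_k_on_bounded_linear)

lemma smooth_on_bounded_linear_ident:
  assumes "bounded_linear L" shows "smooth_on S L"
proof -
  have "C_k_on k UNIV L" for k
  proof (cases k)
    case 0 then show ?thesis by (simp add: linear_continuous_on[OF assms])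
  next
    case (Suc n)
    show ?thesis unfolding Suc
      by (rule C_k_on_SucI[where f'="\<lambda>v x. L v"])
        (auto simp: C_k_on_const bounded_linear_imp_has_derivative[OF assms])
  qed
  then show ?thesis using C_k_on_subset[of S UNIV] by (auto simp: smooth_on_def)
qed

lemma smooth_on_bounded_bilinear:
  "open S \<Longrightarrow> bounded_bilinear B \<Longrightarrow> smooth_on S f \<Longrightarrow> smooth_on S g
    \<Longrightarrow> smooth_on S (\<lambda>x. B (f x) (g x))"
  by (simp add: smooth_on_def C_k_on_bounded_bilinear)

lemma smooth_on_add:
  "open S \<Longrightarrow> smooth_on S f \<Longrightarrow> smooth_on S g \<Longrightarrow> smooth_on S (\<lambda>x. f x + g x)"
  by (simp add: smooth_on_def C_k_on_add)

lemma smooth_on_minus: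
  "open S \<Longrightarrow> smooth_on S f \<Longrightarrow> smooth_on S (\<lambda>x. - f x)"
  by (rule smooth_on_bounded_linear[OF _ bounded_linear_minus[OF bounded_linear_ident]])

lemma smooth_on_diff:
  "open S \<Longrightarrow> smooth_on S f \<Longrightarrow> smooth_on S g \<Longrightarrow> smooth_on S (\<lambda>x. f x - g x)"
  using smooth_on_add[OF _ _ smooth_on_minus, of S f g] by simp

lemma smooth_on_sum:
  "open S \<Longrightarrow> finite I \<Longrightarrow> (\<And>i. i \<in> I \<Longrightarrow> smooth_on S (f i)) \<Longrightarrow> smooth_on S (\<lambda>x. \<Sum>i\<in>I. f i x)"
  by (simp add: smooth_on_def C_k_on_sum)

lemmas smooth_on_mult = smooth_on_bounded_bilinear[OF _ bounded_bilinear_mult]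
lemmas smooth_on_scaleR = smooth_on_bounded_bilinear[OF _ bounded_bilinear_scaleR]
lemmas smooth_on_inner = smooth_on_bounded_bilinear[OF _ bounded_bilinear_inner]

lemma smooth_on_compose:
  fixes g :: "'u::real_normed_vector \<Rightarrow> 'v::euclidean_space" and f :: "'v \<Rightarrow> 'w::real_normed_vector"
  shows "open S \<Longrightarrow> smooth_on T f \<Longrightarrow> smooth_on S g \<Longrightarrow> g ` S \<subseteq> T \<Longrightarrow> smooth_on S (\<lambda>x. f (g x))"
  by (simp add: smooth_on_def C_k_on_compose)

lemma smooth_on_inverse:
  fixes f :: "'v::real_normed_vector \<Rightarrow> real"
  shows "open S \<Longrightarrow> smooth_on S f \<Longrightarrow> (\<And>x. x \<in> S \<Longrightarrow> f x \<noteq> 0) \<Longrightarrow> smooth_on S (\<lambda>x. inverse (f x))"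
  by (simp add: smooth_on_def C_k_on_inverse)

lemma smooth_on_vec_nth:
  fixes f :: "'v::real_normed_vector \<Rightarrow> 'w::real_normed_vector^'n"
  shows "open S \<Longrightarrow> smooth_on S f \<Longrightarrow> smooth_on S (\<lambda>x. f x $ i)"
  by (rule smooth_on_bounded_linear[OF _ bounded_linear_vec_nth])

lemma smooth_on_vecI:
  fixes f :: "'v::real_normed_vector \<Rightarrow> 'w::euclidean_space^'n"
  assumes "open S" "\<And>i. smooth_on S (\<lambda>x. f x $ i)"
  shows "smooth_on S f"
proof -
  have "linear (axis i :: 'w \<Rightarrow> 'w^'n)" for i
    by (auto simp: linear_iff vec_eq_iff axis_def)
  then have "bounded_linear (axis i :: 'w \<Rightarrow> 'w^'n)" for i
    by (simp add: linear_conv_bounded_linear)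
  then have "smooth_on S (\<lambda>x. \<Sum>i\<in>UNIV. axis i (f x $ i))"
    by (intro smooth_on_sum smooth_on_bounded_linear[OF assms(1), of "axis _"] assms finite)
  moreover have "(\<Sum>i\<in>UNIV. axis i (y $ i)) = y" for y :: "'w^'n"
    by (simp add: vec_eq_iff axis_def if_distrib[of "\<lambda>c. c $ i" for i] cong: if_cong)
  ultimately show ?thesis by simp
qed

lemma smooth_on_Pair:
  assumes "open S" "smooth_on S f" "smooth_on S g" shows "smooth_on S (\<lambda>x. (f x, g x))"
proof -
  have "smooth_on S (\<lambda>x. (f x, 0) + (0, g x))"
    using assms
    by (intro smooth_on_add smooth_on_bounded_linear[OF _ bounded_linear_Pair[OF bounded_linear_ident bounded_linear_zero]]
       smooth_on_bounded_linear[OF _ bounded_linear_Pair[OF bounded_linear_zero bounded_linear_ident]])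
  then show ?thesis by simp
qed

text \<open>The mean value theorem, applied in the two directions in turn. The left-hand side is symmetric
  in the directions, which is why mixed derivatives agree in the limit.\<close>

lemma second_difference:
  fixes f :: "'v::real_normed_vector \<Rightarrow> real"
  assumes sm: "smooth_on S f" and h: "h > 0"
    and sub: "\<And>s r. 0 \<le> s \<Longrightarrow> s \<le> h \<Longrightarrow> 0 \<le> r \<Longrightarrow> r \<le> h \<Longrightarrow> p + s *\<^sub>R u + r *\<^sub>R v \<in> S"
  obtains s r where "0 < s" "s < h" "0 < r" "r < h"
    "f (p + h *\<^sub>R u + h *\<^sub>R v) - f (p + h *\<^sub>R u) - f (p + h *\<^sub>R v) + f p
       = h * h * dir v (dir u f) (p + s *\<^sub>R u + r *\<^sub>R v)"
proof -
  define g where "g s = f (p + s *\<^sub>R u + h *\<^sub>R v) - f (p + s *\<^sub>R u)" for s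
  have line: "((\<lambda>s. F (q + s *\<^sub>R w)) has_real_derivative dir w F (q + s *\<^sub>R w)) (at s)"
    if "smooth_on S F" "q + s *\<^sub>R w \<in> S" for F :: "'v \<Rightarrow> real" and q w s
  proof -
    have "((\<lambda>s. q + s *\<^sub>R w) has_derivative (\<lambda>r. r *\<^sub>R w)) (at s)"
      by (auto intro!: derivative_eq_intros)
    from has_derivative_compose[OF this smooth_on_has_derivative[OF that]]
    have "((\<lambda>s. F (q + s *\<^sub>R w)) has_derivative (\<lambda>r. dir (r *\<^sub>R w) F (q + s *\<^sub>R w))) (at s)" .
    moreover have "dir (r *\<^sub>R w) F (q + s *\<^sub>R w) = dir w F (q + s *\<^sub>R w) * r" for r
      using linear_frechet_derivative[OF smooth_on_differentiable[OF that]] by (simp add: linear_scale)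
    ultimately show ?thesis by (simp add: has_field_derivative_def)
  qed
  have "(g has_real_derivative (dir u f (p + s *\<^sub>R u + h *\<^sub>R v) - dir u f (p + s *\<^sub>R u))) (at s)"
    if "0 \<le> s" "s \<le> h" for s
  proof -
    have 1: "((\<lambda>s. f ((p + h *\<^sub>R v) + s *\<^sub>R u)) has_real_derivative dir u f ((p + h *\<^sub>R v) + s *\<^sub>R u)) (at s)"
      using sub[of s h] that h by (intro line sm) (simp add: algebra_simps)
    have 2: "((\<lambda>s. f (p + s *\<^sub>R u)) has_real_derivative dir u f (p + s *\<^sub>R u)) (at s)"
      using sub[of s 0] that h by (intro line sm) simp
    show ?thesis using DERIV_diff[OF 1 2] unfolding g_def by (simp add: algebra_simps)
  qed
  from MVT2[OF h this] obtain s where s: "0 < s" "s < h"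
    and gs: "g h - g 0 = h * (dir u f (p + s *\<^sub>R u + h *\<^sub>R v) - dir u f (p + s *\<^sub>R u))" by auto
  have "((\<lambda>r. dir u f (p + s *\<^sub>R u + r *\<^sub>R v)) has_real_derivative
      dir v (dir u f) (p + s *\<^sub>R u + r *\<^sub>R v)) (at r)" if "0 \<le> r" "r \<le> h" for r
    using sub[of s r] that s by (intro line smooth_on_dir sm) simp
  from MVT2[OF h this] obtain r where r: "0 < r" "r < h"
    and "dir u f (p + s *\<^sub>R u + h *\<^sub>R v) - dir u f (p + s *\<^sub>R u + 0 *\<^sub>R v)
      = (h - 0) * dir v (dir u f) (p + s *\<^sub>R u + r *\<^sub>R v)" by blast
  with gs show ?thesis by (intro that[OF s r]) (simp add: g_def)
qed

lemma dir_commute: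
  fixes f :: "'v::real_normed_vector \<Rightarrow> real"
  assumes "open S" "smooth_on S f" "p \<in> S"
  shows "dir u (dir v f) p = dir v (dir u f) p"
proof (rule ccontr)
  let ?a = "dir u (dir v f)" and ?b = "dir v (dir u f)"
  assume ne: "?a p \<noteq> ?b p"
  define \<epsilon> where "\<epsilon> = dist (?a p) (?b p) / 2"
  have eps: "\<epsilon> > 0" using ne by (simp add: \<epsilon>_def)
  have "continuous_on S ?a" "continuous_on S ?b"
    by (intro smooth_on_continuous_on smooth_on_dir assms)+
  then have "isCont ?a p" "isCont ?b p" using assms by (simp_all add: continuous_on_eq_continuous_at)
  then have "(?a \<longlongrightarrow> ?a p) (nhds p)" "(?b \<longlongrightarrow> ?b p) (nhds p)"
    using tendsto_at_iff_tendsto_nhds[of ?a p] tendsto_at_iff_tendsto_nhds[of ?b p]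
    by (simp_all add: isCont_def)
  then have "eventually (\<lambda>q. dist (?a q) (?a p) < \<epsilon>) (nhds p)"
    "eventually (\<lambda>q. dist (?b q) (?b p) < \<epsilon>) (nhds p)" "eventually (\<lambda>q. q \<in> S) (nhds p)"
    using eps assms by (auto intro: tendstoD eventually_nhds_in_open)
  then have "eventually (\<lambda>q. dist (?a q) (?a p) < \<epsilon> \<and> dist (?b q) (?b p) < \<epsilon> \<and> q \<in> S) (nhds p)"
    by eventually_elim auto
  then obtain d where d: "d > 0"
    "\<And>q. dist q p < d \<Longrightarrow> dist (?a q) (?a p) < \<epsilon> \<and> dist (?b q) (?b p) < \<epsilon> \<and> q \<in> S"
    unfolding eventually_nhds_metric by blast
  define h where "h = d / (2 * (norm u + norm v + 1))"
  have pos: "norm u + norm v + 1 > 0" by (simp add: add_nonneg_pos)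
  have h: "h > 0" using d(1) pos by (simp add: h_def)
  have near: "dist (p + s *\<^sub>R u + r *\<^sub>R v) p < d" if "0 \<le> s" "s \<le> h" "0 \<le> r" "r \<le> h" for s r
  proof -
    have "dist (p + s *\<^sub>R u + r *\<^sub>R v) p = norm (s *\<^sub>R u + r *\<^sub>R v)" by (simp add: dist_norm)
    also have "\<dots> \<le> s * norm u + r * norm v" using that norm_triangle_ineq[of "s *\<^sub>R u" "r *\<^sub>R v"] by simp
    also have "\<dots> \<le> h * norm u + h * norm v" using that by (intro add_mono mult_right_mono) auto
    also have "\<dots> \<le> h * (norm u + norm v + 1)" using h by (simp add: algebra_simps)
    finally have le: "dist (p + s *\<^sub>R u + r *\<^sub>R v) p \<le> h * (norm u + norm v + 1)" .
    have "d / (2 * N) * N = d / 2" if "N > 0" for N :: real using that by simp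
    then have "h * (norm u + norm v + 1) = d / 2" unfolding h_def using pos by blast
    with le show ?thesis using d(1) by linarith
  qed
  have in_S: "p + s *\<^sub>R u + r *\<^sub>R v \<in> S" if "0 \<le> s" "s \<le> h" "0 \<le> r" "r \<le> h" for s r
    using d(2) near[OF that] by blast
  have in_S': "p + s *\<^sub>R v + r *\<^sub>R u \<in> S" if "0 \<le> s" "s \<le> h" "0 \<le> r" "r \<le> h" for s r
    using in_S[OF that(3,4,1,2)] by (simp add: algebra_simps)
  obtain s r where sr: "0 < s" "s < h" "0 < r" "r < h" and
    e1: "f (p + h *\<^sub>R u + h *\<^sub>R v) - f (p + h *\<^sub>R u) - f (p + h *\<^sub>R v) + f p
       = h * h * ?b (p + s *\<^sub>R u + r *\<^sub>R v)"
    by (rule second_difference[OF assms(2) h, of p u v]) (rule in_S)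
  obtain s' r' where sr': "0 < s'" "s' < h" "0 < r'" "r' < h" and
    e2: "f (p + h *\<^sub>R v + h *\<^sub>R u) - f (p + h *\<^sub>R v) - f (p + h *\<^sub>R u) + f p
       = h * h * ?a (p + s' *\<^sub>R v + r' *\<^sub>R u)"
    by (rule second_difference[OF assms(2) h, of p v u]) (rule in_S')
  have "h * h * ?b (p + s *\<^sub>R u + r *\<^sub>R v) = h * h * ?a (p + r' *\<^sub>R u + s' *\<^sub>R v)"
    using e1 e2 by (simp add: algebra_simps)
  then have "?b (p + s *\<^sub>R u + r *\<^sub>R v) = ?a (p + r' *\<^sub>R u + s' *\<^sub>R v)" using h by simp
  moreover have "dist (?b (p + s *\<^sub>R u + r *\<^sub>R v)) (?b p) < \<epsilon>"
    "dist (?a (p + r' *\<^sub>R u + s' *\<^sub>R v)) (?a p) < \<epsilon>"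
    using d(2) near sr sr' by auto
  ultimately have "dist (?a p) (?b p) < 2 * \<epsilon>" by (smt (verit) dist_commute dist_triangle)
  then show False by (simp add: \<epsilon>_def)
qed

section \<open>Exterior calculus on an open set\<close>

text \<open>Differential forms are evaluated on constant vector fields. These commute, so the exterior
  derivative has no bracket terms and no coordinates are chosen.\<close>

definition ext1 :: "('v \<Rightarrow> 'v \<Rightarrow> real) \<Rightarrow> 'v::real_normed_vector \<Rightarrow> 'v \<Rightarrow> 'v \<Rightarrow> real" where
  "ext1 \<alpha> p v w = dir v (\<lambda>q. \<alpha> q w) p - dir w (\<lambda>q. \<alpha> q v) p"

definition ext2 :: "('v \<Rightarrow> 'v \<Rightarrow> 'v \<Rightarrow> real) \<Rightarrow> 'v::real_normed_vector \<Rightarrow> 'v \<Rightarrow> 'v \<Rightarrow> 'v \<Rightarrow> real" where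
  "ext2 \<Omega> p u v w = dir u (\<lambda>q. \<Omega> q v w) p + dir v (\<lambda>q. \<Omega> q w u) p + dir w (\<lambda>q. \<Omega> q u v) p"

definition wedge11 :: "('v \<Rightarrow> real) \<Rightarrow> ('v \<Rightarrow> real) \<Rightarrow> 'v \<Rightarrow> 'v \<Rightarrow> real" where
  "wedge11 a b v w = a v * b w - a w * b v"

definition wedge21 :: "('v \<Rightarrow> 'v \<Rightarrow> real) \<Rightarrow> ('v \<Rightarrow> real) \<Rightarrow> 'v \<Rightarrow> 'v \<Rightarrow> 'v \<Rightarrow> real" where
  "wedge21 \<Omega> b u v w = \<Omega> u v * b w + \<Omega> v w * b u + \<Omega> w u * b v"

lemma dir_add:
  "f differentiable (at p) \<Longrightarrow> g differentiable (at p) \<Longrightarrow> dir v (\<lambda>q. f q + g q) p = dir v f p + dir v g p"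
  by (rule dir_eqI[OF has_derivative_add[OF has_derivative_dir has_derivative_dir]])

lemma dir_diff:
  "f differentiable (at p) \<Longrightarrow> g differentiable (at p) \<Longrightarrow> dir v (\<lambda>q. f q - g q) p = dir v f p - dir v g p"
  by (rule dir_eqI[OF has_derivative_diff[OF has_derivative_dir has_derivative_dir]])

lemma dir_mult:
  fixes f g :: "'v::real_normed_vector \<Rightarrow> real"
  shows "f differentiable (at p) \<Longrightarrow> g differentiable (at p) \<Longrightarrow>
    dir v (\<lambda>q. f q * g q) p = f p * dir v g p + dir v f p * g p"
  by (rule dir_eqI[OF has_derivative_mult[OF has_derivative_dir has_derivative_dir]])

lemma dir_linear: "f differentiable (at p) \<Longrightarrow> linear (\<lambda>v. dir v f p)"
  by (rule linear_frechet_derivative)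

lemma ext2_wedge11:
  assumes "\<And>v. (\<lambda>q. \<alpha> q v) differentiable (at p)" "\<And>v. (\<lambda>q. \<beta> q v) differentiable (at p)"
  shows "ext2 (\<lambda>q. wedge11 (\<alpha> q) (\<beta> q)) p u v w
    = wedge21 (ext1 \<alpha> p) (\<beta> p) u v w - wedge21 (ext1 \<beta> p) (\<alpha> p) u v w"
  unfolding ext2_def wedge11_def wedge21_def ext1_def
  by (simp add: dir_diff dir_mult assms differentiable_mult) (simp add: algebra_simps)

lemma ext2_add:
  assumes "\<And>v w. (\<lambda>q. \<Omega> q v w) differentiable (at p)" "\<And>v w. (\<lambda>q. \<Psi> q v w) differentiable (at p)"
  shows "ext2 (\<lambda>q v w. \<Omega> q v w + \<Psi> q v w) p u v w = ext2 \<Omega> p u v w + ext2 \<Psi> p u v w"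
  unfolding ext2_def by (simp add: dir_add assms)

lemma ext2_scale:
  assumes "a differentiable (at p)" "\<And>v w. (\<lambda>q. \<Omega> q v w) differentiable (at p)"
  shows "ext2 (\<lambda>q v w. a q * \<Omega> q v w) p u v w
    = a p * ext2 \<Omega> p u v w + wedge21 (\<Omega> p) (\<lambda>v. dir v a p) u v w"
  unfolding ext2_def wedge21_def by (simp add: dir_mult assms) (simp add: algebra_simps)

lemma ext2_cong_open:
  assumes "open W" "p \<in> W" "\<And>q v w. q \<in> W \<Longrightarrow> \<Omega> q v w = \<Psi> q v w"
    and "\<And>v w. (\<lambda>q. \<Omega> q v w) differentiable (at p)"
  shows "ext2 \<Omega> p u v w = ext2 \<Psi> p u v w"
proof -
  have "dir u (\<lambda>q. \<Omega> q v w) p = dir u (\<lambda>q. \<Psi> q v w) p" for u v w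
    by (rule dir_cong_open[OF assms(1,2) _ assms(4)]) (rule assms(3))
  then show ?thesis by (simp add: ext2_def)
qed

lemma smooth_on_ext1:
  assumes "open W" "\<And>v. smooth_on W (\<lambda>q. \<alpha> q v)"
  shows "smooth_on W (\<lambda>q. ext1 \<alpha> q v w)"
  unfolding ext1_def by (intro smooth_on_diff smooth_on_dir assms)

lemma ext2_ext1:
  assumes W: "open W" "p \<in> W" and sm: "\<And>v. smooth_on W (\<lambda>q. \<alpha> q v)"
  shows "ext2 (ext1 \<alpha>) p u v w = 0"
proof -
  have "dir u (\<lambda>q. ext1 \<alpha> q v w) p
      = dir u (dir v (\<lambda>q. \<alpha> q w)) p - dir u (dir w (\<lambda>q. \<alpha> q v)) p" for u v w
    unfolding ext1_def
    by (intro dir_diff smooth_on_differentiable[OF smooth_on_dir[OF sm] W(2)])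
  then show ?thesis
    using dir_commute[OF W(1) sm W(2)] by (simp add: ext2_def)
qed

lemma ext1_linear:
  assumes W: "open W" "p \<in> W" and sm: "\<And>v. smooth_on W (\<lambda>q. \<alpha> q v)"
    and lin: "\<And>q. q \<in> W \<Longrightarrow> linear (\<alpha> q)"
  shows "linear (\<lambda>v. ext1 \<alpha> p v w)"
proof (rule linearI)
  have d: "(\<lambda>q. \<alpha> q v) differentiable (at p)" for v using smooth_on_differentiable[OF sm W(2)] .
  note L = dir_linear[OF d]
  have "dir w (\<lambda>q. \<alpha> q (x + y)) p = dir w (\<lambda>q. \<alpha> q x + \<alpha> q y) p" for x y
    by (rule dir_cong_open[OF W]) (auto simp: linear_add[OF lin] d)
  then have "dir w (\<lambda>q. \<alpha> q (x + y)) p = dir w (\<lambda>q. \<alpha> q x) p + dir w (\<lambda>q. \<alpha> q y) p" for x y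
    by (simp add: dir_add d)
  then show "ext1 \<alpha> p (x + y) w = ext1 \<alpha> p x w + ext1 \<alpha> p y w" for x y
    using linear_add[OF L] by (simp add: ext1_def)
  have "dir w (\<lambda>q. \<alpha> q (c *\<^sub>R x)) p = dir w (\<lambda>q. c * \<alpha> q x) p" for c x
    by (rule dir_cong_open[OF W]) (auto simp: linear_scale[OF lin] d)
  then have "dir w (\<lambda>q. \<alpha> q (c *\<^sub>R x)) p = c * dir w (\<lambda>q. \<alpha> q x) p" for c x
    by (simp add: dir_mult d)
  then show "ext1 \<alpha> p (c *\<^sub>R x) w = c *\<^sub>R ext1 \<alpha> p x w" for c x
    using linear_scale[OF L] by (simp add: ext1_def algebra_simps)
qed

section \<open>Transport of the curvature along the null direction\<close>

text \<open>Structure equations of a Lorentzian coframe \<open>\<epsilon>\<close> (timelike), \<open>\<upsilon> - \<epsilon>\<close>, \<open>\<mu>\<close>, \<open>\<nu>\<close> (spacelike) whose null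
  form \<open>\<upsilon>\<close> spans a parallel line; \<open>\<kappa>\<close>, \<open>\<kappa>\<^sub>l\<close>, \<open>\<kappa>\<^sub>n\<close> are the connection forms. The vector fields are the
  frame dual to \<open>\<epsilon>\<close>, \<open>\<upsilon>\<close>, \<open>\<mu>\<close>, \<open>\<nu>\<close>. As \<open>\<upsilon>\<close> takes the place of \<open>\<upsilon> - \<epsilon>\<close> in this basis, the field dual
  to \<open>\<epsilon>\<close> is the null field \<open>k\<close>.\<close>

locale null_structure =
  fixes W :: "'v::euclidean_space set"
    and \<upsilon> \<epsilon> \<mu> \<nu> \<kappa> \<kappa>\<^sub>l \<kappa>\<^sub>n :: "'v \<Rightarrow> 'v \<Rightarrow> real"
    and k E\<^sub>u E\<^sub>l E\<^sub>n :: "'v \<Rightarrow> 'v"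
  assumes W: "open W"
    and smooth_forms: "smooth_on W (\<lambda>q. \<upsilon> q v)" "smooth_on W (\<lambda>q. \<epsilon> q v)"
      "smooth_on W (\<lambda>q. \<mu> q v)" "smooth_on W (\<lambda>q. \<nu> q v)"
      "smooth_on W (\<lambda>q. \<kappa> q v)" "smooth_on W (\<lambda>q. \<kappa>\<^sub>l q v)" "smooth_on W (\<lambda>q. \<kappa>\<^sub>n q v)"
    and smooth_frame: "smooth_on W E\<^sub>u" "smooth_on W E\<^sub>l" "smooth_on W E\<^sub>n"
    and linear_\<kappa>: "q \<in> W \<Longrightarrow> linear (\<kappa> q)" "q \<in> W \<Longrightarrow> linear (\<kappa>\<^sub>l q)" "q \<in> W \<Longrightarrow> linear (\<kappa>\<^sub>n q)"
    and structure_\<upsilon>: "q \<in> W \<Longrightarrow> ext1 \<upsilon> q v w = wedge11 (\<kappa> q) (\<upsilon> q) v w"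
    and structure_\<mu>: "q \<in> W \<Longrightarrow> ext1 \<mu> q v w = wedge11 (\<kappa>\<^sub>l q) (\<upsilon> q) v w"
    and structure_\<nu>: "q \<in> W \<Longrightarrow> ext1 \<nu> q v w = wedge11 (\<kappa>\<^sub>n q) (\<upsilon> q) v w"
    and structure_\<epsilon>: "q \<in> W \<Longrightarrow> ext1 \<epsilon> q v w =
      wedge11 (\<kappa> q) (\<upsilon> q) v w - wedge11 (\<kappa> q) (\<epsilon> q) v w
      + wedge11 (\<kappa>\<^sub>l q) (\<mu> q) v w + wedge11 (\<kappa>\<^sub>n q) (\<nu> q) v w"
    and \<kappa>_closed: "q \<in> W \<Longrightarrow> ext1 \<kappa> q v w = 0"
    and expand: "q \<in> W \<Longrightarrow>
      v = \<epsilon> q v *\<^sub>R k q + \<upsilon> q v *\<^sub>R E\<^sub>u q + \<mu> q v *\<^sub>R E\<^sub>l q + \<nu> q v *\<^sub>R E\<^sub>n q"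
    and dual: "q \<in> W \<Longrightarrow> \<upsilon> q (k q) = 0" "q \<in> W \<Longrightarrow> \<mu> q (k q) = 0" "q \<in> W \<Longrightarrow> \<nu> q (k q) = 0"
      "q \<in> W \<Longrightarrow> \<upsilon> q (E\<^sub>u q) = 1" "q \<in> W \<Longrightarrow> \<mu> q (E\<^sub>u q) = 0" "q \<in> W \<Longrightarrow> \<nu> q (E\<^sub>u q) = 0"
      "q \<in> W \<Longrightarrow> \<upsilon> q (E\<^sub>l q) = 0" "q \<in> W \<Longrightarrow> \<mu> q (E\<^sub>l q) = 1" "q \<in> W \<Longrightarrow> \<nu> q (E\<^sub>l q) = 0"
      "q \<in> W \<Longrightarrow> \<upsilon> q (E\<^sub>n q) = 0" "q \<in> W \<Longrightarrow> \<mu> q (E\<^sub>n q) = 0" "q \<in> W \<Longrightarrow> \<nu> q (E\<^sub>n q) = 1"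
begin

text \<open>The structure is symmetric in \<open>\<mu>\<close> and \<open>\<nu>\<close>, so what is shown for \<open>\<kappa>\<^sub>l\<close> holds for \<open>\<kappa>\<^sub>n\<close> as well.\<close>

lemma swap: "null_structure W \<upsilon> \<epsilon> \<nu> \<mu> \<kappa> \<kappa>\<^sub>n \<kappa>\<^sub>l k E\<^sub>u E\<^sub>n E\<^sub>l"
proof (rule null_structure.intro)
  show "q \<in> W \<Longrightarrow> ext1 \<epsilon> q v w =
      wedge11 (\<kappa> q) (\<upsilon> q) v w - wedge11 (\<kappa> q) (\<epsilon> q) v w
      + wedge11 (\<kappa>\<^sub>n q) (\<nu> q) v w + wedge11 (\<kappa>\<^sub>l q) (\<mu> q) v w" for q v w
    using structure_\<epsilon>[of q v w] by simp
  show "q \<in> W \<Longrightarrow>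
      v = \<epsilon> q v *\<^sub>R k q + \<upsilon> q v *\<^sub>R E\<^sub>u q + \<nu> q v *\<^sub>R E\<^sub>n q + \<mu> q v *\<^sub>R E\<^sub>l q" for q v
    using expand[of q v] by (simp add: algebra_simps)
qed (fact W smooth_forms smooth_frame linear_\<kappa> structure_\<upsilon> structure_\<mu> structure_\<nu> \<kappa>_closed dual)+

lemma differentiable_forms:
  assumes "p \<in> W"
  shows "(\<lambda>q. \<upsilon> q v) differentiable (at p)" "(\<lambda>q. \<epsilon> q v) differentiable (at p)"
      "(\<lambda>q. \<mu> q v) differentiable (at p)" "(\<lambda>q. \<nu> q v) differentiable (at p)"
      "(\<lambda>q. \<kappa> q v) differentiable (at p)" "(\<lambda>q. \<kappa>\<^sub>l q v) differentiable (at p)" "(\<lambda>q. \<kappa>\<^sub>n q v) differentiable (at p)"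
  using smooth_forms smooth_on_differentiable[OF _ assms] by blast+

definition curv\<^sub>l :: "'v \<Rightarrow> 'v \<Rightarrow> 'v \<Rightarrow> real" where
  "curv\<^sub>l q v w = ext1 \<kappa>\<^sub>l q v w + wedge11 (\<kappa> q) (\<kappa>\<^sub>l q) v w"

definition curv\<^sub>n :: "'v \<Rightarrow> 'v \<Rightarrow> 'v \<Rightarrow> real" where
  "curv\<^sub>n q v w = ext1 \<kappa>\<^sub>n q v w + wedge11 (\<kappa> q) (\<kappa>\<^sub>n q) v w"

lemma curv\<^sub>l_antisym: "curv\<^sub>l q v w = - curv\<^sub>l q w v"
  by (simp add: curv\<^sub>l_def ext1_def wedge11_def)

text \<open>The first Bianchi identity for \<open>\<mu>\<close>, that is, \<open>d(d\<mu>) = 0\<close>.\<close>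

lemma curv\<^sub>l_wedge_\<upsilon>: assumes p: "p \<in> W" shows "wedge21 (curv\<^sub>l p) (\<upsilon> p) u v w = 0"
proof -
  note diffs = differentiable_forms[OF p]
  have "0 = ext2 (ext1 \<mu>) p u v w" using ext2_ext1[OF W p smooth_forms(3)] by simp
  also have "\<dots> = ext2 (\<lambda>q. wedge11 (\<kappa>\<^sub>l q) (\<upsilon> q)) p u v w"
    by (rule ext2_cong_open[OF W p])
      (simp_all add: structure_\<mu> smooth_on_differentiable[OF smooth_on_ext1[OF W smooth_forms(3)] p])
  also have "\<dots> = wedge21 (ext1 \<kappa>\<^sub>l p) (\<upsilon> p) u v w - wedge21 (ext1 \<upsilon> p) (\<kappa>\<^sub>l p) u v w"
    by (rule ext2_wedge11) (fact diffs)+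
  finally show ?thesis
    by (simp add: wedge21_def curv\<^sub>l_def structure_\<upsilon>[OF p] wedge11_def algebra_simps)
qed

text \<open>The first Bianchi identity for \<open>\<epsilon>\<close>, that is, \<open>d(d\<epsilon>) = 0\<close>. The spacelike form \<open>\<upsilon> - \<epsilon>\<close> contributes no
  curvature because \<open>\<kappa>\<close> is closed.\<close>

lemma curv_cyclic:
  assumes p: "p \<in> W" shows "wedge21 (curv\<^sub>l p) (\<mu> p) u v w + wedge21 (curv\<^sub>n p) (\<nu> p) u v w = 0"
proof -
  note diffs = differentiable_forms[OF p]
  have dw: "(\<lambda>q. wedge11 (\<alpha> q) (\<beta> q) v w) differentiable (at p)"
    if "\<And>v. (\<lambda>q. \<alpha> q v) differentiable (at p)" "\<And>v. (\<lambda>q. \<beta> q v) differentiable (at p)" for \<alpha> \<beta> v w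
    unfolding wedge11_def using that by (intro differentiable_diff differentiable_mult)
  let ?\<epsilon>\<^sub>u = "\<lambda>q v. \<upsilon> q v - \<epsilon> q v"
  have d\<epsilon>\<^sub>u: "(\<lambda>q. ?\<epsilon>\<^sub>u q v) differentiable (at p)" for v by (intro differentiable_diff diffs)
  let ?S = "\<lambda>q v w. (wedge11 (\<kappa> q) (?\<epsilon>\<^sub>u q) v w + wedge11 (\<kappa>\<^sub>l q) (\<mu> q) v w) + wedge11 (\<kappa>\<^sub>n q) (\<nu> q) v w"
  have eps: "ext1 \<epsilon> q v w = ?S q v w" if "q \<in> W" for q v w
    unfolding structure_\<epsilon>[OF that] by (simp add: wedge11_def algebra_simps)
  have "0 = ext2 (ext1 \<epsilon>) p u v w" using ext2_ext1[OF W p smooth_forms(2)] by simp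
  also have "\<dots> = ext2 ?S p u v w"
    by (rule ext2_cong_open[OF W p eps])
      (simp_all add: smooth_on_differentiable[OF smooth_on_ext1[OF W smooth_forms(2)] p])
  also have "\<dots> = (wedge21 (ext1 \<kappa> p) (?\<epsilon>\<^sub>u p) u v w - wedge21 (ext1 ?\<epsilon>\<^sub>u p) (\<kappa> p) u v w)
     + (wedge21 (ext1 \<kappa>\<^sub>l p) (\<mu> p) u v w - wedge21 (ext1 \<mu> p) (\<kappa>\<^sub>l p) u v w)
     + (wedge21 (ext1 \<kappa>\<^sub>n p) (\<nu> p) u v w - wedge21 (ext1 \<nu> p) (\<kappa>\<^sub>n p) u v w)"
    by (simp only: ext2_add ext2_wedge11 dw d\<epsilon>\<^sub>u diffs differentiable_add)
  finally have *: "0 = (wedge21 (ext1 \<kappa> p) (?\<epsilon>\<^sub>u p) u v w - wedge21 (ext1 ?\<epsilon>\<^sub>u p) (\<kappa> p) u v w)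
     + (wedge21 (ext1 \<kappa>\<^sub>l p) (\<mu> p) u v w - wedge21 (ext1 \<mu> p) (\<kappa>\<^sub>l p) u v w)
     + (wedge21 (ext1 \<kappa>\<^sub>n p) (\<nu> p) u v w - wedge21 (ext1 \<nu> p) (\<kappa>\<^sub>n p) u v w)" .
  have "ext1 ?\<epsilon>\<^sub>u p v w = ext1 \<upsilon> p v w - ext1 \<epsilon> p v w" for v w
    unfolding ext1_def by (simp add: dir_diff diffs)
  then have "ext1 ?\<epsilon>\<^sub>u p v w = wedge11 (\<kappa> p) (\<epsilon> p) v w - wedge11 (\<kappa>\<^sub>l p) (\<mu> p) v w - wedge11 (\<kappa>\<^sub>n p) (\<nu> p) v w" for v w
    by (simp add: structure_\<upsilon>[OF p] structure_\<epsilon>[OF p])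
  with * show ?thesis
    by (simp add: wedge21_def curv\<^sub>l_def curv\<^sub>n_def structure_\<mu>[OF p] structure_\<nu>[OF p] \<kappa>_closed[OF p]
      wedge11_def algebra_simps)
qed

lemma curv\<^sub>l_linear:
  assumes p: "p \<in> W" shows "linear (\<lambda>v. curv\<^sub>l p v w)" "linear (\<lambda>w. curv\<^sub>l p v w)"
proof -
  have 1: "linear (\<lambda>v. curv\<^sub>l p v w)" for w
    using ext1_linear[OF W p smooth_forms(6) linear_\<kappa>(2), of w] linear_\<kappa>(1,2)[OF p]
    by (simp add: linear_iff curv\<^sub>l_def wedge11_def algebra_simps)
  then show "linear (\<lambda>v. curv\<^sub>l p v w)" .
  have "linear (\<lambda>w. - curv\<^sub>l p w v)" using 1 by (rule linear_compose_neg)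
  then show "linear (\<lambda>w. curv\<^sub>l p v w)" using curv\<^sub>l_antisym[of p v] by simp
qed

definition coeff :: "'v \<Rightarrow> real" where "coeff q = curv\<^sub>l q (E\<^sub>l q) (E\<^sub>u q)"
definition mixed_coeff :: "'v \<Rightarrow> real" where "mixed_coeff q = curv\<^sub>l q (E\<^sub>n q) (E\<^sub>u q)"

lemma smooth_on_curv\<^sub>l: "smooth_on W (\<lambda>q. curv\<^sub>l q v w)"
  unfolding curv\<^sub>l_def wedge11_def
  by (intro smooth_on_add smooth_on_diff smooth_on_mult smooth_on_ext1 smooth_forms W)

lemma smooth_on_curv\<^sub>l_fields:
  assumes "smooth_on W X" "smooth_on W Y" shows "smooth_on W (\<lambda>q. curv\<^sub>l q (X q) (Y q))"
proof -
  have "smooth_on W (\<lambda>q. \<Sum>b\<in>Basis. \<Sum>c\<in>Basis. (X q \<bullet> b) * ((Y q \<bullet> c) * curv\<^sub>l q b c))"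
    by (intro smooth_on_sum smooth_on_mult smooth_on_curv\<^sub>l smooth_on_inner assms smooth_on_const W finite_Basis)
  then show ?thesis
  proof (rule smooth_on_cong[OF W, rotated])
    fix q assume q: "q \<in> W"
    note L = curv\<^sub>l_linear[OF q]
    have "curv\<^sub>l q (X q) (Y q) = (\<Sum>b\<in>Basis. (X q \<bullet> b) * curv\<^sub>l q b (Y q))"
      by (subst (1) euclidean_representation[of "X q", symmetric]) (simp add: linear_sum[OF L(1)] linear_scale[OF L(1)])
    moreover have "curv\<^sub>l q b (Y q) = (\<Sum>c\<in>Basis. (Y q \<bullet> c) * curv\<^sub>l q b c)" for b
      by (subst (1) euclidean_representation[of "Y q", symmetric]) (simp add: linear_sum[OF L(2)] linear_scale[OF L(2)])
    ultimately show "(\<Sum>b\<in>Basis. \<Sum>c\<in>Basis. (X q \<bullet> b) * ((Y q \<bullet> c) * curv\<^sub>l q b c)) = curv\<^sub>l q (X q) (Y q)"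
      by (simp add: sum_distrib_left)
  qed
qed

text \<open>On \<open>k\<close>, \<open>E\<^sub>l\<close>, \<open>E\<^sub>u\<close> the form \<open>\<nu>\<close> vanishes and \<open>\<mu>\<close> is nonzero on \<open>E\<^sub>l\<close> only, so the cyclic identity has
  a single surviving term; the other Bianchi identity extends this to all second arguments.\<close>

lemma curv\<^sub>l_null: assumes p: "p \<in> W" shows "curv\<^sub>l p (k p) v = 0"
proof -
  have "curv\<^sub>l p (k p) (E\<^sub>u p) = 0"
    using curv_cyclic[OF p, of "k p" "E\<^sub>l p" "E\<^sub>u p"] curv\<^sub>l_antisym[of p "E\<^sub>u p" "k p"]
    by (simp add: wedge21_def dual p)
  then show ?thesis
    using curv\<^sub>l_wedge_\<upsilon>[OF p, of "k p" v "E\<^sub>u p"] curv\<^sub>l_antisym[of p "E\<^sub>u p" "k p"]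
    by (simp add: wedge21_def dual p)
qed

lemma curv\<^sub>l_decomposition:
  assumes p: "p \<in> W"
  shows "curv\<^sub>l p v w = coeff p * wedge11 (\<mu> p) (\<upsilon> p) v w + mixed_coeff p * wedge11 (\<nu> p) (\<upsilon> p) v w"
proof -
  have E: "curv\<^sub>l p v (E\<^sub>u p) = \<mu> p v * coeff p + \<nu> p v * mixed_coeff p" for v
  proof -
    note L = curv\<^sub>l_linear(1)[OF p, of "E\<^sub>u p"]
    have "curv\<^sub>l p (E\<^sub>u p) (E\<^sub>u p) = 0" using curv\<^sub>l_antisym[of p "E\<^sub>u p" "E\<^sub>u p"] by simp
    then show ?thesis
      by (subst (1) expand[OF p, of v])
        (simp add: linear_add[OF L] linear_scale[OF L] curv\<^sub>l_null[OF p] coeff_def mixed_coeff_def)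
  qed
  show ?thesis
    using curv\<^sub>l_wedge_\<upsilon>[OF p, of v w "E\<^sub>u p"] E[of v] E[of w] curv\<^sub>l_antisym[of p "E\<^sub>u p" v]
    by (simp add: wedge21_def wedge11_def dual p algebra_simps)
qed

text \<open>The second Bianchi identity \<open>d curv\<^sub>l = - \<kappa> \<and> curv\<^sub>l\<close>, evaluated on \<open>k, E\<^sub>l, E\<^sub>u\<close>. Since \<open>curv\<^sub>l\<close> is a
  combination of \<open>\<mu> \<and> \<upsilon>\<close> and \<open>\<nu> \<and> \<upsilon>\<close>, only the derivative of the first coefficient along \<open>k\<close> survives.
  One of the two factors \<open>\<kappa>(k)\<close> stems from \<open>d\<upsilon>\<close>, the other from the right-hand side.\<close>

proposition transport:
  assumes p: "p \<in> W"
  shows "dir (k p) coeff p = - 2 * \<kappa> p (k p) * coeff p"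
proof -
  note diffs = differentiable_forms[OF p]
  have dw: "(\<lambda>q. wedge11 (\<alpha> q) (\<beta> q) v w) differentiable (at p)"
    if "\<And>v. (\<lambda>q. \<alpha> q v) differentiable (at p)" "\<And>v. (\<lambda>q. \<beta> q v) differentiable (at p)" for \<alpha> \<beta> v w
    unfolding wedge11_def using that by (intro differentiable_diff differentiable_mult)
  have dc: "coeff differentiable (at p)" "mixed_coeff differentiable (at p)"
    unfolding coeff_def[abs_def] mixed_coeff_def[abs_def]
    by (intro smooth_on_differentiable[OF smooth_on_curv\<^sub>l_fields p] smooth_frame)+
  \<comment> \<open>The frame is frozen at \<open>p\<close>, because \<^const>\<open>ext2\<close> takes constant vectors.\<close>
  let ?u = "k p" and ?v = "E\<^sub>l p" and ?w = "E\<^sub>u p"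
  have "ext2 curv\<^sub>l p ?u ?v ?w = ext2 (ext1 \<kappa>\<^sub>l) p ?u ?v ?w + ext2 (\<lambda>q. wedge11 (\<kappa> q) (\<kappa>\<^sub>l q)) p ?u ?v ?w"
    unfolding curv\<^sub>l_def[abs_def]
    by (rule ext2_add)
      (simp_all add: smooth_on_differentiable[OF smooth_on_ext1[OF W smooth_forms(6)] p] dw diffs)
  also have "\<dots> = - wedge21 (ext1 \<kappa>\<^sub>l p) (\<kappa> p) ?u ?v ?w"
    by (simp add: ext2_ext1[OF W p smooth_forms(6)] ext2_wedge11 diffs)
      (simp add: wedge21_def \<kappa>_closed[OF p])
  also have "\<dots> = - wedge21 (curv\<^sub>l p) (\<kappa> p) ?u ?v ?w"
    by (simp add: wedge21_def curv\<^sub>l_def wedge11_def algebra_simps)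
  also have "\<dots> = - \<kappa> p (k p) * coeff p"
    using curv\<^sub>l_null[OF p] curv\<^sub>l_antisym[of p ?w ?u] by (simp add: wedge21_def coeff_def)
  finally have 1: "ext2 curv\<^sub>l p ?u ?v ?w = - \<kappa> p (k p) * coeff p" .
  have "ext2 curv\<^sub>l p ?u ?v ?w = ext2 (\<lambda>q v w. coeff q * wedge11 (\<mu> q) (\<upsilon> q) v w
      + mixed_coeff q * wedge11 (\<nu> q) (\<upsilon> q) v w) p ?u ?v ?w"
    by (rule ext2_cong_open[OF W p curv\<^sub>l_decomposition])
      (simp_all add: smooth_on_differentiable[OF smooth_on_curv\<^sub>l p])
  also have "\<dots> =
      coeff p * (wedge21 (ext1 \<mu> p) (\<upsilon> p) ?u ?v ?w - wedge21 (ext1 \<upsilon> p) (\<mu> p) ?u ?v ?w)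
      + wedge21 (wedge11 (\<mu> p) (\<upsilon> p)) (\<lambda>v. dir v coeff p) ?u ?v ?w
      + (mixed_coeff p * (wedge21 (ext1 \<nu> p) (\<upsilon> p) ?u ?v ?w - wedge21 (ext1 \<upsilon> p) (\<nu> p) ?u ?v ?w)
      + wedge21 (wedge11 (\<nu> p) (\<upsilon> p)) (\<lambda>v. dir v mixed_coeff p) ?u ?v ?w)"
    by (simp only: ext2_add ext2_scale ext2_wedge11 dw dc diffs differentiable_mult)
  also have "\<dots> = coeff p * \<kappa> p (k p) + dir (k p) coeff p"
    by (simp add: wedge21_def wedge11_def structure_\<upsilon>[OF p] structure_\<mu>[OF p] structure_\<nu>[OF p] dual[OF p])
  finally show ?thesis using 1 by (simp add: algebra_simps)
qed

end

section \<open>Coframes and their dual frames\<close>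

lemma UNIV_leg: "(UNIV :: leg set) = {Leg_u, Leg_l, Leg_n}"
  using leg.exhaust by blast

instance leg :: finite
  by standard (simp add: UNIV_leg)

lemma sum_leg: "(\<Sum>a\<in>UNIV. f a) = f Leg_u + f Leg_l + f Leg_n" for f :: "leg \<Rightarrow> 'b::comm_monoid_add"
  by (simp add: UNIV_leg add.assoc)

lemma CARD_leg: "CARD(leg) = 3" by (simp add: UNIV_leg)

definition coframe :: "(leg \<Rightarrow> real^3) \<Rightarrow> bool" where
  "coframe e \<longleftrightarrow> inj e \<and> independent (range e)"

definition gram :: "(leg \<Rightarrow> real^3) \<Rightarrow> real^3^3" where
  "gram e = (\<chi> i j. \<Sum>a\<in>UNIV. e a $ i * e a $ j)"

definition frame :: "(leg \<Rightarrow> real^3) \<Rightarrow> leg \<Rightarrow> real^3" where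
  "frame e a = matrix_inv (gram e) *v e a"

lemma gram_mult: "gram e *v w = (\<Sum>a\<in>UNIV. (e a \<bullet> w) *\<^sub>R e a)"
  by (simp add: vec_eq_iff gram_def matrix_vector_mult_def inner_vec_def sum_leg sum_3 algebra_simps)

context
  fixes e :: "leg \<Rightarrow> real^3"
  assumes cof: "coframe e"
begin

lemma coframe_zero: assumes "\<And>a. e a \<bullet> w = 0" shows "w = 0"
proof -
  have "card (range e) = 3" using cof by (simp add: coframe_def card_image CARD_leg)
  then have "UNIV \<subseteq> span (range e)"
    using cof by (intro card_ge_dim_independent) (auto simp: coframe_def)
  moreover have "orthogonal w y" if "y \<in> range e" for y
    using assms that by (auto simp: orthogonal_def inner_commute)
  ultimately have "orthogonal w w"
    by (intro orthogonal_to_span[of w "range e" w]) auto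
  then show ?thesis by (simp add: orthogonal_def)
qed

lemma coframe_coeffs_zero:
  assumes "(\<Sum>a\<in>UNIV. c a *\<^sub>R e a) = 0" shows "c a = 0"
proof -
  have inj: "inj e" and ind: "independent (range e)" using cof by (auto simp: coframe_def)
  have "(\<Sum>v\<in>range e. c (inv e v) *\<^sub>R v) = 0"
    using assms inj by (simp add: sum.reindex)
  from independentD[OF ind _ _ this, of "e a"] inj show ?thesis by simp
qed

text \<open>The quadratic form of the Gram matrix is the sum of the squares of the coframe components.\<close>

lemma gram_invertible: "invertible (gram e)"
proof -
  have "w = 0" if "gram e *v w = 0" for w
  proof -
    have "(\<Sum>a\<in>UNIV. (e a \<bullet> w)\<^sup>2) = w \<bullet> (gram e *v w)"
      by (simp add: gram_mult inner_sum_right power2_eq_square inner_commute)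
    then have "(\<Sum>a\<in>UNIV. (e a \<bullet> w)\<^sup>2) = 0" using that by simp
    then show "w = 0" by (intro coframe_zero) (simp add: sum_nonneg_eq_0_iff)
  qed
  then have "\<exists>B. B ** gram e = mat 1"
    unfolding matrix_left_invertible_ker by blast
  then show ?thesis unfolding invertible_left_inverse .
qed

lemma gram_frame: "gram e *v frame e a = e a"
proof -
  have "gram e ** matrix_inv (gram e) = mat 1"
    using someI_ex[OF gram_invertible[unfolded invertible_def]] by (simp add: matrix_inv_def)
  then show ?thesis by (simp add: frame_def matrix_vector_mul_assoc)
qed

lemma frame_dual: "e b \<bullet> frame e a = (if a = b then 1 else 0)"
proof -
  have "(\<Sum>b\<in>UNIV. (e b \<bullet> frame e a - (if a = b then 1 else 0)) *\<^sub>R e b) = 0"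
    using gram_frame[of a]
    by (cases a) (simp_all add: gram_mult sum_leg algebra_simps)
  from coframe_coeffs_zero[OF this, of b] show ?thesis by simp
qed

lemma frame_expand: "v = (\<Sum>a\<in>UNIV. (e a \<bullet> v) *\<^sub>R frame e a)"
proof -
  have "v - (\<Sum>a\<in>UNIV. (e a \<bullet> v) *\<^sub>R frame e a) = 0"
    by (rule coframe_zero)
      (case_tac a; simp add: sum_leg inner_diff_right inner_add_right frame_dual)
  then show ?thesis by simp
qed

lemma coframe_expand: "w = (\<Sum>a\<in>UNIV. (frame e a \<bullet> w) *\<^sub>R e a)"
proof -
  have "z \<bullet> w = z \<bullet> (\<Sum>a\<in>UNIV. (frame e a \<bullet> w) *\<^sub>R e a)" for z
    by (subst (1) frame_expand[of z]) (simp add: sum_leg inner_add_left inner_add_right inner_commute)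
  then show ?thesis using vector_eq_ldot by blast
qed

lemma frame_coframe_nth: "(\<Sum>a\<in>UNIV. frame e a $ i * e a $ j) = (if i = j then 1 else 0)"
proof -
  have "(axis j 1 :: real^3) $ i = (\<Sum>a\<in>UNIV. (e a \<bullet> axis j 1) *\<^sub>R frame e a) $ i"
    using frame_expand[of "axis j 1"] by simp
  moreover have "e a \<bullet> axis j 1 = e a $ j" for a by (simp add: inner_axis)
  moreover have "(axis j 1 :: real^3) $ i = (if i = j then 1 else 0)" by (simp add: axis_def)
  ultimately show ?thesis by (simp add: mult.commute)
qed

lemma coframe_frame_nth: "(\<Sum>i\<in>UNIV. e b $ i * frame e a $ i) = (if a = b then 1 else 0)"
  using frame_dual[of b a] by (simp add: inner_vec_def)

lemma matrix_inv_gram: "matrix_inv (gram e) $ i $ j = (\<Sum>a\<in>UNIV. frame e a $ i * frame e a $ j)"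
proof -
  have "matrix_inv (gram e) $ i $ j = (matrix_inv (gram e) *v axis j 1) $ i"
    by (simp add: matrix_vector_mul_component inner_axis)
  also have "axis j 1 = (\<Sum>a\<in>UNIV. (frame e a \<bullet> axis j 1) *\<^sub>R e a)" by (rule coframe_expand)
  also have "(matrix_inv (gram e) *v \<dots>) = (\<Sum>a\<in>UNIV. frame e a $ j *\<^sub>R frame e a)"
    by (simp add: linear_sum[OF matrix_vector_mul_linear] linear_scale[OF matrix_vector_mul_linear]
        frame_def inner_axis)
  finally show ?thesis by (simp add: mult.commute)
qed

lemma sharp_gram: "sharp (gram e) (e a) = frame e a"
  by (simp add: sharp_def frame_def)

lemma frame_eqI: assumes "\<And>b. e b \<bullet> v = (if a = b then 1 else 0)" shows "v = frame e a"
  using coframe_zero[of "v - frame e a"] assms by (simp add: inner_diff_right frame_dual)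

text \<open>Cramer's rule in the form of a cross product. It shows that the dual frame depends smoothly on
  the coframe.\<close>

lemma frame_cross:
  assumes "a \<noteq> b" "a \<noteq> c" "b \<noteq> c"
  shows "e a \<bullet> cross3 (e b) (e c) \<noteq> 0"
    and "frame e a = inverse (e a \<bullet> cross3 (e b) (e c)) *\<^sub>R cross3 (e b) (e c)"
proof -
  let ?v = "cross3 (e b) (e c)"
  have legs: "d = a \<or> d = b \<or> d = c" for d using assms by (cases a; cases b; cases c; cases d) auto
  have ort: "e b \<bullet> ?v = 0" "e c \<bullet> ?v = 0" by (simp_all add: dot_cross_self)
  have "?v \<noteq> 0"
  proof
    assume "?v = 0"
    then have "collinear {0, e b, e c}" by (simp add: cross_eq_0)
    then have "e b = 0 \<or> (\<exists>r. e c = r *\<^sub>R e b)" by (auto simp: collinear_lemma)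
    moreover have "e b \<noteq> 0" using frame_dual[of b b] by auto
    ultimately obtain r where "e c = r *\<^sub>R e b" by blast
    then show False using frame_dual[of c c] frame_dual[of b c] assms by simp
  qed
  then show ne: "e a \<bullet> ?v \<noteq> 0" using coframe_zero[of ?v] ort legs by metis
  show "frame e a = inverse (e a \<bullet> ?v) *\<^sub>R ?v"
  proof (rule frame_eqI[symmetric])
    show "e d \<bullet> inverse (e a \<bullet> ?v) *\<^sub>R ?v = (if a = d then 1 else 0)" for d
      using legs[of d] ort ne assms by auto
  qed
qed

end

lemma smooth_on_cross3:
  "open S \<Longrightarrow> smooth_on S f \<Longrightarrow> smooth_on S g \<Longrightarrow> smooth_on S (\<lambda>x. cross3 (f x) (g x))"
  by (rule smooth_on_bounded_bilinear[OF _ bilinear_conv_bounded_bilinear[THEN iffD1, OF bilinear_cross]])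

lemma smooth_on_frame:
  fixes e :: "leg \<Rightarrow> 'v::real_normed_vector \<Rightarrow> real^3"
  assumes S: "open S" and sm: "\<And>a. smooth_on S (e a)" and cof: "\<And>x. x \<in> S \<Longrightarrow> coframe (\<lambda>a. e a x)"
  shows "smooth_on S (\<lambda>x. frame (\<lambda>a. e a x) a)"
proof -
  obtain b c where bc: "a \<noteq> b" "a \<noteq> c" "b \<noteq> c"
    by (cases a) (metis leg.distinct)+
  have "smooth_on S (\<lambda>x. inverse (e a x \<bullet> cross3 (e b x) (e c x)) *\<^sub>R cross3 (e b x) (e c x))"
    by (intro smooth_on_scaleR smooth_on_inverse smooth_on_inner smooth_on_cross3 sm S
        frame_cross(1)[OF cof bc])
  then show ?thesis
    by (rule smooth_on_cong[OF S, rotated]) (simp add: frame_cross(2)[OF cof bc])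
qed

section \<open>Curvature of a slice\<close>

lemma partial_smooth: "smooth_on S f \<Longrightarrow> smooth_on S (partial i f)"
  unfolding partial_def[abs_def] by (rule smooth_on_dir)

lemma partial_add:
  "f differentiable (at x) \<Longrightarrow> g differentiable (at x) \<Longrightarrow>
    partial i (\<lambda>y. f y + g y) x = partial i f x + partial i g x"
  by (simp add: partial_def dir_add)

lemma partial_diff:
  "f differentiable (at x) \<Longrightarrow> g differentiable (at x) \<Longrightarrow>
    partial i (\<lambda>y. f y - g y) x = partial i f x - partial i g x"
  by (simp add: partial_def dir_diff)

lemma partial_mult:
  "f differentiable (at x) \<Longrightarrow> g differentiable (at x) \<Longrightarrow>
    partial i (\<lambda>y. f y * g y) x = f x * partial i g x + partial i f x * g x"
  by (simp add: partial_def dir_mult)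

lemma partial_sum:
  assumes "finite A" "\<And>a. a \<in> A \<Longrightarrow> f a differentiable (at x)"
  shows "partial i (\<lambda>y. \<Sum>a\<in>A. f a y) x = (\<Sum>a\<in>A. partial i (f a) x)"
  using assms
proof (induction A)
  case empty then show ?case by (simp add: partial_def)
next
  case (insert a A)
  then have "(\<lambda>y. \<Sum>a\<in>A. f a y) differentiable (at x)" by (intro differentiable_sum) auto
  with insert show ?case by (simp add: partial_add)
qed

lemma partial_const: "partial i (\<lambda>y. c) x = 0"
  by (simp add: partial_def)

lemma partial_cong_open:
  assumes "open S" "x \<in> S" "\<And>y. y \<in> S \<Longrightarrow> f y = g y" "f differentiable (at x)"
  shows "partial i f x = partial i g x"
  using dir_cong_open[OF assms] by (simp add: partial_def)

lemma partial_commute: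
  assumes "open S" "smooth_on S f" "x \<in> S"
  shows "partial i (partial j f) x = partial j (partial i f) x"
  using dir_commute[OF assms] by (simp add: partial_def[abs_def])

lemma gram_eq: "gram e $ i $ j = (\<Sum>a\<in>UNIV. e a $ i * e a $ j)"
  by (simp add: gram_def)

lemma dir_partials:
  fixes f :: "real^'n \<Rightarrow> real"
  assumes "f differentiable (at p)"
  shows "dir v f p = (\<Sum>i\<in>UNIV. v $ i * partial i f p)"
proof -
  note L = dir_linear[OF assms]
  have "dir v f p = dir (\<Sum>i\<in>UNIV. v $ i *s axis i 1) f p" by (simp only: basis_expansion)
  then show ?thesis
    by (simp add: linear_sum[OF L] linear_scale[OF L] scalar_mult_eq_scaleR partial_def)
qed

lemma ext1_coord:
  fixes \<alpha> :: "real^'n \<Rightarrow> real^'n"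
  assumes d: "\<And>j. (\<lambda>q. \<alpha> q $ j) differentiable (at p)"
  shows "ext1 (\<lambda>q v. \<alpha> q \<bullet> v) p v w = (\<Sum>i\<in>UNIV. \<Sum>j\<in>UNIV. v $ i * w $ j *
      (partial i (\<lambda>q. \<alpha> q $ j) p - partial j (\<lambda>q. \<alpha> q $ i) p))"
proof -
  have D: "dir v (\<lambda>q. \<alpha> q \<bullet> w) p = (\<Sum>i\<in>UNIV. \<Sum>j\<in>UNIV. v $ i * w $ j * partial i (\<lambda>q. \<alpha> q $ j) p)" for v w
  proof -
    have "(\<lambda>q. \<alpha> q \<bullet> w) = (\<lambda>q. \<Sum>j\<in>UNIV. w $ j * \<alpha> q $ j)" by (simp add: inner_vec_def mult.commute)
    moreover have "(\<lambda>q. \<Sum>j\<in>UNIV. w $ j * \<alpha> q $ j) differentiable (at p)"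
      by (intro differentiable_sum ballI differentiable_mult d differentiable_const finite)
    ultimately show ?thesis
      by (simp add: dir_partials partial_sum partial_mult d partial_const differentiable_mult sum_distrib_left mult_ac)
  qed
  have "dir w (\<lambda>q. \<alpha> q \<bullet> v) p = (\<Sum>i\<in>UNIV. \<Sum>j\<in>UNIV. v $ i * w $ j * partial j (\<lambda>q. \<alpha> q $ i) p)"
    unfolding D by (subst sum.swap) (simp add: mult_ac)
  then show ?thesis unfolding ext1_def D[where v=v and w=w] by (simp add: right_diff_distrib sum_subtractf)
qed

text \<open>The flow equations without time derivatives, at a fixed time and in a chart: \<open>h\<close> is the metric,
  \<open>E\<close> the dual frame, and \<open>\<theta> a\<close> the one-form \<open>\<Theta>(e\<^sub>a)\<close>.\<close>

locale spinor_slice =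
  fixes U :: "(real^3) set" and e :: "leg \<Rightarrow> real^3 \<Rightarrow> real^3" and \<Theta> :: "real^3 \<Rightarrow> real^3^3"
    and h :: "real^3 \<Rightarrow> real^3^3" and E \<theta> :: "leg \<Rightarrow> real^3 \<Rightarrow> real^3"
  defines "h \<equiv> \<lambda>x. gram (\<lambda>a. e a x)"
    and "E \<equiv> \<lambda>a x. frame (\<lambda>a. e a x) a"
    and "\<theta> \<equiv> \<lambda>a x. contract2 (h x) (\<Theta> x) (e a x)"
  assumes U: "open U"
    and smooth_e: "smooth_on U (e a)"
    and cof: "x \<in> U \<Longrightarrow> coframe (\<lambda>a. e a x)"
    and smooth_\<Theta>: "smooth_on U (\<lambda>x. \<Theta> x $ i $ j)"
    and \<Theta>_sym: "x \<in> U \<Longrightarrow> \<Theta> x $ i $ j = \<Theta> x $ j $ i"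
    and ext_e: "x \<in> U \<Longrightarrow> ext_deriv (e a) x = wedge (\<theta> a x) (e Leg_u x)"
    and \<theta>_u_closed: "x \<in> U \<Longrightarrow> ext_deriv (\<theta> Leg_u) x = 0"
begin

lemma smooth_e_nth: "smooth_on U (\<lambda>x. e a x $ i)"
  by (rule smooth_on_vec_nth[OF U smooth_e])

lemma smooth_E: "smooth_on U (E a)"
  unfolding E_def by (rule smooth_on_frame[OF U smooth_e cof])

lemma smooth_E_nth: "smooth_on U (\<lambda>x. E a x $ i)"
  by (rule smooth_on_vec_nth[OF U smooth_E])

lemma smooth_h: "smooth_on U (\<lambda>x. h x $ i $ j)"
  unfolding h_def gram_eq by (intro smooth_on_sum smooth_on_mult smooth_e_nth U finite)

lemma e_E: "x \<in> U \<Longrightarrow> (\<Sum>i\<in>UNIV. e b x $ i * E a x $ i) = (if a = b then 1 else 0)"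
  unfolding E_def by (rule coframe_frame_nth[OF cof])

lemma E_e: "x \<in> U \<Longrightarrow> (\<Sum>a\<in>UNIV. E a x $ i * e a x $ j) = (if i = j then 1 else 0)"
  unfolding E_def by (rule frame_coframe_nth[OF cof])

lemma inv_h: "x \<in> U \<Longrightarrow> matrix_inv (h x) $ i $ j = (\<Sum>a\<in>UNIV. E a x $ i * E a x $ j)"
  unfolding E_def h_def by (rule matrix_inv_gram[OF cof])

lemma smooth_inv_h: "smooth_on U (\<lambda>x. matrix_inv (h x) $ i $ j)"
  by (rule smooth_on_cong[OF U, where f="\<lambda>x. \<Sum>a\<in>UNIV. E a x $ i * E a x $ j"])
    (auto simp: inv_h intro!: smooth_on_sum smooth_on_mult smooth_E_nth U)

lemma \<theta>_nth: "x \<in> U \<Longrightarrow> \<theta> a x $ j = (\<Sum>i\<in>UNIV. E a x $ i * \<Theta> x $ i $ j)"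
  by (simp add: \<theta>_def contract2_def E_def h_def sharp_gram[OF cof])

lemma smooth_\<theta>_nth: "smooth_on U (\<lambda>x. \<theta> a x $ j)"
  by (rule smooth_on_cong[OF U, where f="\<lambda>x. \<Sum>i\<in>UNIV. E a x $ i * \<Theta> x $ i $ j"])
    (auto simp: \<theta>_nth intro!: smooth_on_sum smooth_on_mult smooth_E_nth smooth_\<Theta> U)

lemma \<Theta>_expand: assumes "x \<in> U" shows "\<Theta> x $ j $ k = (\<Sum>a\<in>UNIV. \<theta> a x $ j * e a x $ k)"
proof -
  have "(\<Sum>a\<in>UNIV. \<theta> a x $ j * e a x $ k)
      = (\<Sum>a\<in>UNIV. \<Sum>i\<in>UNIV. (E a x $ i * e a x $ k) * \<Theta> x $ i $ j)"
    by (simp add: \<theta>_nth assms sum_distrib_left sum_distrib_right mult_ac)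
  also have "\<dots> = (\<Sum>i\<in>UNIV. (\<Sum>a\<in>UNIV. E a x $ i * e a x $ k) * \<Theta> x $ i $ j)"
    by (subst sum.swap) (simp add: sum_distrib_right)
  also have "\<dots> = \<Theta> x $ k $ j" by (simp add: E_e assms if_distrib[of "\<lambda>c. c * y" for y] cong: if_cong)
  finally show ?thesis using \<Theta>_sym[OF assms] by simp
qed

lemma smooth_christoffel: "smooth_on U (christoffel h k i j)"
proof -
  have "smooth_on U (\<lambda>x. (\<Sum>l\<in>UNIV. matrix_inv (h x) $ k $ l *
        (partial i (\<lambda>y. h y $ j $ l) x + partial j (\<lambda>y. h y $ i $ l) x
         - partial l (\<lambda>y. h y $ i $ j) x)) * (1/2))"
    by (intro smooth_on_mult smooth_on_sum smooth_on_const smooth_inv_h smooth_on_add smooth_on_diff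
        partial_smooth smooth_h U finite)
  then show ?thesis by (simp add: christoffel_def[abs_def])
qed

lemma h_sym: "h x $ i $ j = h x $ j $ i"
  by (simp add: h_def gram_def mult.commute)

lemma christoffel_sym: "christoffel h k i j x = christoffel h k j i x"
  using h_sym by (simp add: christoffel_def algebra_simps)

lemmas diffs = smooth_on_differentiable[OF smooth_e_nth] smooth_on_differentiable[OF smooth_E_nth]
  smooth_on_differentiable[OF smooth_h] smooth_on_differentiable[OF smooth_\<Theta>]
  smooth_on_differentiable[OF smooth_\<theta>_nth] smooth_on_differentiable[OF smooth_christoffel]
  smooth_on_differentiable[OF partial_smooth[OF smooth_e_nth]]

lemma partial_e_antisym:
  assumes "x \<in> U"
  shows "partial j (\<lambda>y. e a y $ i) x = partial i (\<lambda>y. e a y $ j) x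
     - (\<theta> a x $ i * e Leg_u x $ j - \<theta> a x $ j * e Leg_u x $ i)"
proof -
  have "ext_deriv (e a) x $ i $ j = wedge (\<theta> a x) (e Leg_u x) $ i $ j" using ext_e[OF assms] by simp
  then show ?thesis by (simp add: ext_deriv_def wedge_def)
qed

lemma partial_h:
  assumes "x \<in> U"
  shows "partial l (\<lambda>y. h y $ i $ j) x =
    (\<Sum>a\<in>UNIV. e a x $ i * partial l (\<lambda>y. e a y $ j) x + partial l (\<lambda>y. e a y $ i) x * e a x $ j)"
  unfolding h_def gram_eq
  by (simp add: partial_sum partial_mult diffs assms differentiable_mult)

text \<open>A candidate for the covariant derivative of the coframe: its antisymmetric part is
  \<open>\<theta>\<^sub>a \<and> e\<^sub>u = de\<^sub>a\<close>, and its matrix of one-forms in the coframe is skew. These are the properties that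
  characterise the Levi-Civita connection.\<close>

definition cov_e :: "leg \<Rightarrow> 3 \<Rightarrow> 3 \<Rightarrow> real^3 \<Rightarrow> real" where
  "cov_e a i j x = \<theta> a x $ i * e Leg_u x $ j - (if a = Leg_u then \<Theta> x $ i $ j else 0)"

text \<open>The usual derivation of the Levi-Civita connection: in the combination of derivatives of the
  metric, all antisymmetric parts are replaced by \<open>\<theta>\<^sub>b \<and> e\<^sub>u\<close>, and the sums over the legs rebuild \<open>\<Theta>\<close>.\<close>

lemma christoffel_coframe:
  assumes x: "x \<in> U"
  shows "(\<Sum>k\<in>UNIV. e a x $ k * christoffel h k i j x) = partial i (\<lambda>y. e a y $ j) x - cov_e a i j x"
proof -
  let ?d = "\<lambda>a i j. partial i (\<lambda>y. e a y $ j) x" and ?u = "e Leg_u x"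
  define S where "S l = partial i (\<lambda>y. h y $ j $ l) x + partial j (\<lambda>y. h y $ i $ l) x
         - partial l (\<lambda>y. h y $ i $ j) x" for l
  have S: "S l = 2 * ((\<Sum>b\<in>UNIV. e b x $ l * ?d b i j) - \<Theta> x $ i $ l * ?u $ j + \<Theta> x $ i $ j * ?u $ l)" for l
  proof -
    have "S l = (\<Sum>b\<in>UNIV. e b x $ l * (2 * ?d b i j)
        - (\<theta> b x $ i * e b x $ l) * ?u $ j + (\<theta> b x $ j * e b x $ l) * ?u $ i
        + (\<theta> b x $ i * e b x $ j) * ?u $ l - (\<theta> b x $ l * e b x $ j) * ?u $ i
        + (\<theta> b x $ j * e b x $ i) * ?u $ l - (\<theta> b x $ l * e b x $ i) * ?u $ j)"
      unfolding S_def partial_h[OF x] sum.distrib[symmetric] sum_subtractf[symmetric]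
    proof (rule sum.cong[OF refl])
      fix b
      note A = partial_e_antisym[OF x, of j b i] partial_e_antisym[OF x, of l b i]
        partial_e_antisym[OF x, of l b j]
      show "e b x $ j * ?d b i l + ?d b i j * e b x $ l + (e b x $ i * ?d b j l + ?d b j i * e b x $ l)
          - (e b x $ i * ?d b l j + ?d b l i * e b x $ j) = e b x $ l * (2 * ?d b i j)
        - (\<theta> b x $ i * e b x $ l) * ?u $ j + (\<theta> b x $ j * e b x $ l) * ?u $ i
        + (\<theta> b x $ i * e b x $ j) * ?u $ l - (\<theta> b x $ l * e b x $ j) * ?u $ i
        + (\<theta> b x $ j * e b x $ i) * ?u $ l - (\<theta> b x $ l * e b x $ i) * ?u $ j"
        unfolding A by (simp add: algebra_simps)
    qed
    also have "\<dots> = 2 * (\<Sum>b\<in>UNIV. e b x $ l * ?d b i j)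
        - \<Theta> x $ i $ l * ?u $ j + \<Theta> x $ j $ l * ?u $ i + \<Theta> x $ i $ j * ?u $ l
        - \<Theta> x $ l $ j * ?u $ i + \<Theta> x $ j $ i * ?u $ l - \<Theta> x $ l $ i * ?u $ j"
      unfolding \<Theta>_expand[OF x] sum_distrib_left sum_distrib_right
      by (simp add: sum.distrib sum_subtractf mult_ac)
    also have "\<dots> = 2 * ((\<Sum>b\<in>UNIV. e b x $ l * ?d b i j) - \<Theta> x $ i $ l * ?u $ j + \<Theta> x $ i $ j * ?u $ l)"
      using \<Theta>_sym[OF x, of l j] \<Theta>_sym[OF x, of j i] \<Theta>_sym[OF x, of l i] by (simp add: algebra_simps)
    finally show ?thesis .
  qed
  have S_half: "S l / 2 = (\<Sum>b\<in>UNIV. e b x $ l * ?d b i j) - \<Theta> x $ i $ l * ?u $ j + \<Theta> x $ i $ j * ?u $ l" for l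
    unfolding S by (rule nonzero_mult_div_cancel_left) simp
  have inv: "(\<Sum>k\<in>UNIV. e a x $ k * matrix_inv (h x) $ k $ l) = E a x $ l" for l
  proof -
    have "(\<Sum>k\<in>UNIV. e a x $ k * matrix_inv (h x) $ k $ l)
        = (\<Sum>b\<in>UNIV. (\<Sum>k\<in>UNIV. e a x $ k * E b x $ k) * E b x $ l)"
      unfolding inv_h[OF x] sum_distrib_left sum_distrib_right by (subst sum.swap) (simp add: mult_ac)
    then show ?thesis by (simp add: e_E[OF x] if_distrib[of "\<lambda>c. c * y" for y] cong: if_cong)
  qed
  have "(\<Sum>k\<in>UNIV. e a x $ k * christoffel h k i j x)
     = (\<Sum>l\<in>UNIV. (\<Sum>k\<in>UNIV. e a x $ k * matrix_inv (h x) $ k $ l) * (S l / 2))"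
    unfolding christoffel_def S_def sum_distrib_left sum_distrib_right sum_divide_distrib
    by (subst sum.swap) (simp add: mult_ac)
  also have "\<dots> = (\<Sum>l\<in>UNIV. E a x $ l * ((\<Sum>b\<in>UNIV. e b x $ l * ?d b i j)
       - \<Theta> x $ i $ l * ?u $ j + \<Theta> x $ i $ j * ?u $ l))"
    by (simp only: inv S_half)
  also have "\<dots> = (\<Sum>b\<in>UNIV. (\<Sum>l\<in>UNIV. e b x $ l * E a x $ l) * ?d b i j)
       - (\<Sum>l\<in>UNIV. E a x $ l * \<Theta> x $ l $ i) * ?u $ j
       + \<Theta> x $ i $ j * (\<Sum>l\<in>UNIV. ?u $ l * E a x $ l)"
    unfolding sum_distrib_left sum_distrib_right
    by (subst sum.swap[where A="UNIV :: leg set"])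
      (simp add: sum.distrib sum_subtractf sum_distrib_left algebra_simps \<Theta>_sym[OF x, of i])
  also have "\<dots> = ?d a i j - cov_e a i j x"
    by (simp add: e_E[OF x] \<theta>_nth[OF x, symmetric] cov_e_def if_distrib[of "\<lambda>c. c * y" for y] cong: if_cong)
  finally show ?thesis .
qed

lemma smooth_cov_e: "smooth_on U (cov_e a i j)"
  unfolding cov_e_def[abs_def]
  by (cases "a = Leg_u"; simp; intro smooth_on_diff smooth_on_mult smooth_\<theta>_nth smooth_e_nth smooth_\<Theta> U)

text \<open>The Riemann tensor, with the upper index in third place.\<close>

definition riemann :: "3 \<Rightarrow> 3 \<Rightarrow> 3 \<Rightarrow> 3 \<Rightarrow> real^3 \<Rightarrow> real" where
  "riemann i j p k x = partial i (christoffel h p j k) x - partial j (christoffel h p i k) x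
     + (\<Sum>m\<in>UNIV. christoffel h p i m x * christoffel h m j k x
                 - christoffel h p j m x * christoffel h m i k x)"

lemma ricci_riemann: "ricci h x $ j $ k = (\<Sum>i\<in>UNIV. riemann i j i k x)"
  by (simp add: ricci_def riemann_def)

text \<open>The derivative of \<open>christoffel_coframe\<close>, antisymmetrised. It yields the curvature from the
  covariant derivative of the coframe, without any derivative of a Christoffel symbol.\<close>

lemma ricci_identity:
  assumes x: "x \<in> U"
  shows "(\<Sum>p\<in>UNIV. e a x $ p * riemann i j p k x) =
    (partial j (cov_e a i k) x - (\<Sum>m\<in>UNIV. cov_e a i m x * christoffel h m j k x))
    - (partial i (cov_e a j k) x - (\<Sum>m\<in>UNIV. cov_e a j m x * christoffel h m i k x))"
proof -
  let ?\<Gamma> = "\<lambda>p i k. christoffel h p i k x"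
  have dcov: "cov_e a i k differentiable (at x)" for i k by (rule smooth_on_differentiable[OF smooth_cov_e x])
  have D: "(\<Sum>p\<in>UNIV. e a x $ p * partial j (christoffel h p i k) x)
      = partial j (partial i (\<lambda>y. e a y $ k)) x - partial j (cov_e a i k) x
        - (\<Sum>p\<in>UNIV. partial j (\<lambda>y. e a y $ p) x * ?\<Gamma> p i k)" for i j
  proof -
    have "partial j (\<lambda>y. \<Sum>p\<in>UNIV. e a y $ p * christoffel h p i k y) x
        = partial j (\<lambda>y. partial i (\<lambda>y. e a y $ k) y - cov_e a i k y) x"
      by (rule partial_cong_open[OF U x christoffel_coframe])
        (auto intro!: differentiable_sum differentiable_mult diffs x)
    also have "\<dots> = partial j (partial i (\<lambda>y. e a y $ k)) x - partial j (cov_e a i k) x"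
      by (intro partial_diff diffs x dcov)
    finally show ?thesis
      by (simp add: partial_sum partial_mult diffs x differentiable_mult sum.distrib)
  qed
  have Q: "(\<Sum>p\<in>UNIV. e a x $ p * (\<Sum>m\<in>UNIV. ?\<Gamma> p i m * ?\<Gamma> m j k))
      = (\<Sum>m\<in>UNIV. (partial i (\<lambda>y. e a y $ m) x - cov_e a i m x) * ?\<Gamma> m j k)" for i j
    unfolding christoffel_coframe[OF x, symmetric] sum_distrib_left sum_distrib_right
    by (subst sum.swap) (simp add: mult_ac)
  have "(\<Sum>p\<in>UNIV. e a x $ p * riemann i j p k x) =
     (\<Sum>p\<in>UNIV. e a x $ p * partial i (christoffel h p j k) x)
     - (\<Sum>p\<in>UNIV. e a x $ p * partial j (christoffel h p i k) x)
     + (\<Sum>p\<in>UNIV. e a x $ p * (\<Sum>m\<in>UNIV. ?\<Gamma> p i m * ?\<Gamma> m j k))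
     - (\<Sum>p\<in>UNIV. e a x $ p * (\<Sum>m\<in>UNIV. ?\<Gamma> p j m * ?\<Gamma> m i k))"
    unfolding riemann_def by (simp add: algebra_simps sum.distrib sum_subtractf)
  then show ?thesis
    unfolding D Q using partial_commute[OF U smooth_e_nth x, of i j a k]
    by (simp add: algebra_simps sum.distrib sum_subtractf)
qed

lemma partial_e_cov: "x \<in> U \<Longrightarrow> partial j (\<lambda>y. e a y $ k) x
   = cov_e a j k x + (\<Sum>m\<in>UNIV. e a x $ m * christoffel h m j k x)"
  using christoffel_coframe[of x a j k] by simp

text \<open>The covariant derivative of \<open>\<Theta>\<close>, antisymmetrised in the derivative and the first index; the
  Christoffel symbols that carry both of these as lower indices cancel.\<close>

definition codazzi :: "3 \<Rightarrow> 3 \<Rightarrow> 3 \<Rightarrow> real^3 \<Rightarrow> real" where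
  "codazzi j i k x =
    (partial j (\<lambda>y. \<Theta> y $ i $ k) x - (\<Sum>m\<in>UNIV. \<Theta> x $ i $ m * christoffel h m j k x))
    - (partial i (\<lambda>y. \<Theta> y $ j $ k) x - (\<Sum>m\<in>UNIV. \<Theta> x $ j $ m * christoffel h m i k x))"

definition d\<theta> :: "leg \<Rightarrow> 3 \<Rightarrow> 3 \<Rightarrow> real^3 \<Rightarrow> real" where
  "d\<theta> a i j x = partial i (\<lambda>y. \<theta> a y $ j) x - partial j (\<lambda>y. \<theta> a y $ i) x"

lemma d\<theta>_u: "x \<in> U \<Longrightarrow> d\<theta> Leg_u i j x = 0"
proof -
  assume "x \<in> U"
  then have "ext_deriv (\<theta> Leg_u) x $ i $ j = 0" by (simp add: \<theta>_u_closed)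
  then show ?thesis by (simp add: ext_deriv_def d\<theta>_def)
qed

lemma cov_\<Theta>:
  assumes x: "x \<in> U"
  shows "partial j (\<lambda>y. \<Theta> y $ i $ k) x - (\<Sum>m\<in>UNIV. \<Theta> x $ i $ m * christoffel h m j k x)
    = (\<Sum>c\<in>UNIV. partial j (\<lambda>y. \<theta> c y $ i) x * e c x $ k + \<theta> c x $ i * cov_e c j k x)"
proof -
  have "partial j (\<lambda>y. \<Theta> y $ i $ k) x = partial j (\<lambda>y. \<Sum>c\<in>UNIV. \<theta> c y $ i * e c y $ k) x"
    by (rule partial_cong_open[OF U x \<Theta>_expand diffs(4)[OF x]])
  also have "\<dots> = (\<Sum>c\<in>UNIV. \<theta> c x $ i * partial j (\<lambda>y. e c y $ k) x + partial j (\<lambda>y. \<theta> c y $ i) x * e c x $ k)"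
    by (simp add: partial_sum partial_mult diffs x differentiable_mult)
  finally have 1: "partial j (\<lambda>y. \<Theta> y $ i $ k) x = \<dots>" .
  have 2: "(\<Sum>m\<in>UNIV. \<Theta> x $ i $ m * christoffel h m j k x)
     = (\<Sum>c\<in>UNIV. \<theta> c x $ i * (\<Sum>m\<in>UNIV. e c x $ m * christoffel h m j k x))"
    unfolding \<Theta>_expand[OF x] sum_distrib_left sum_distrib_right by (subst sum.swap) (simp add: mult_ac)
  show ?thesis unfolding 1 2 partial_e_cov[OF x]
    by (simp add: sum.distrib algebra_simps)
qed

text \<open>From \<open>\<Theta> = \<Sum>\<^sub>c \<theta>\<^sub>c \<otimes> e\<^sub>c\<close>: the forms \<open>\<theta>\<^sub>c\<close> are differentiated exteriorly and the \<open>e\<^sub>c\<close> covariantly.\<close>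

lemma codazzi_eq:
  assumes x: "x \<in> U"
  shows "codazzi j i k x = - (\<Sum>c\<in>UNIV. d\<theta> c i j x * e c x $ k)
      - \<theta> Leg_u x $ i * \<Theta> x $ j $ k + \<theta> Leg_u x $ j * \<Theta> x $ i $ k"
proof -
  note D = cov_\<Theta>[OF x]
  have N: "(\<Sum>c\<in>UNIV. \<theta> c x $ i * cov_e c j k x)
     = (\<Sum>c\<in>UNIV. \<theta> c x $ i * \<theta> c x $ j) * e Leg_u x $ k - \<theta> Leg_u x $ i * \<Theta> x $ j $ k" for i j
    by (simp add: sum_leg cov_e_def algebra_simps)
  have C: "(\<Sum>c\<in>UNIV. \<theta> c x $ i * \<theta> c x $ j) = (\<Sum>c\<in>UNIV. \<theta> c x $ j * \<theta> c x $ i)" by (simp add: mult.commute)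
  show ?thesis
    unfolding codazzi_def D sum.distrib N C d\<theta>_def
    by (simp add: sum_subtractf algebra_simps)
qed

lemma riemann_coframe:
  assumes x: "x \<in> U"
  shows "(\<Sum>p\<in>UNIV. e a x $ p * riemann i j p k x) =
     - d\<theta> a i j x * e Leg_u x $ k
     + \<theta> a x $ i * (\<theta> Leg_u x $ j * e Leg_u x $ k - \<Theta> x $ j $ k)
     - \<theta> a x $ j * (\<theta> Leg_u x $ i * e Leg_u x $ k - \<Theta> x $ i $ k)
     - (if a = Leg_u then codazzi j i k x else 0)"
proof -
  have P: "partial j (cov_e a i k) x = partial j (\<lambda>y. \<theta> a y $ i) x * e Leg_u x $ k
      + \<theta> a x $ i * partial j (\<lambda>y. e Leg_u y $ k) x
      - (if a = Leg_u then partial j (\<lambda>y. \<Theta> y $ i $ k) x else 0)" for i j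
    unfolding cov_e_def[abs_def]
    by (cases "a = Leg_u"; simp add: partial_diff partial_mult diffs x differentiable_mult)
  have S: "(\<Sum>m\<in>UNIV. cov_e a i m x * christoffel h m j k x)
      = \<theta> a x $ i * (\<Sum>m\<in>UNIV. e Leg_u x $ m * christoffel h m j k x)
      - (if a = Leg_u then \<Sum>m\<in>UNIV. \<Theta> x $ i $ m * christoffel h m j k x else 0)" for i j
    unfolding cov_e_def
    by (cases "a = Leg_u"; simp add: algebra_simps sum_subtractf sum_distrib_left)
  have u: "cov_e Leg_u j k x = \<theta> Leg_u x $ j * e Leg_u x $ k - \<Theta> x $ j $ k" for j k by (simp add: cov_e_def)
  show ?thesis
    unfolding ricci_identity[OF x] P S partial_e_cov[OF x] u
    by (cases "a = Leg_u"; simp add: codazzi_def d\<theta>_def algebra_simps)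
qed

definition T :: "leg \<Rightarrow> leg \<Rightarrow> real^3 \<Rightarrow> real" where "T a b x = \<theta> a x \<bullet> E b x"

definition D\<theta> :: "leg \<Rightarrow> leg \<Rightarrow> leg \<Rightarrow> real^3 \<Rightarrow> real" where
  "D\<theta> c a b x = ext1 (\<lambda>q v. \<theta> c q \<bullet> v) x (E a x) (E b x)"

lemma T_nth: "T a b x = (\<Sum>i\<in>UNIV. E b x $ i * \<theta> a x $ i)"
  by (simp add: T_def inner_vec_def mult.commute)

lemma E_\<Theta>: "x \<in> U \<Longrightarrow> (\<Sum>k\<in>UNIV. E b x $ k * \<Theta> x $ j $ k) = \<theta> b x $ j"
  using \<Theta>_sym[of x j] by (simp add: \<theta>_nth)

lemma E_e': "x \<in> U \<Longrightarrow> (\<Sum>k\<in>UNIV. E b x $ k * e c x $ k) = (if b = c then 1 else 0)"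
  using e_E[of x c b] by (simp add: mult.commute)

lemma T_sym: assumes "x \<in> U" shows "T a b x = T b a x"
proof -
  have "T a b x = (\<Sum>i\<in>UNIV. \<Sum>k\<in>UNIV. E b x $ i * (E a x $ k * \<Theta> x $ i $ k))"
    by (simp add: T_nth E_\<Theta>[OF assms, symmetric] sum_distrib_left)
  also have "\<dots> = (\<Sum>k\<in>UNIV. E a x $ k * (\<Sum>i\<in>UNIV. E b x $ i * \<Theta> x $ i $ k))"
    unfolding sum_distrib_left by (subst sum.swap) (simp add: mult_ac)
  also have "\<dots> = T b a x" by (simp add: T_nth \<theta>_nth[OF assms])
  finally show ?thesis .
qed

lemma D\<theta>_nth:
  assumes "x \<in> U"
  shows "D\<theta> c a b x = (\<Sum>i\<in>UNIV. \<Sum>j\<in>UNIV. E a x $ i * E b x $ j * d\<theta> c i j x)"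
  unfolding D\<theta>_def d\<theta>_def by (rule ext1_coord[OF diffs(5)[OF assms]])

lemma D\<theta>_antisym: "D\<theta> c a b x = - D\<theta> c b a x"
  by (simp add: D\<theta>_def ext1_def)

lemma D\<theta>_u: "x \<in> U \<Longrightarrow> D\<theta> Leg_u a b x = 0"
  by (simp add: D\<theta>_nth d\<theta>_u)

text \<open>With \<open>\<Omega>\<^sub>c = d\<theta>\<^sub>c - \<theta>\<^sub>c \<and> \<theta>\<^sub>u\<close> this is \<open>\<Omega>\<^sub>l(E\<^sub>l, E\<^sub>u) + \<Omega>\<^sub>n(E\<^sub>n, E\<^sub>u)\<close>.\<close>

definition curvature_defect :: "real^3 \<Rightarrow> real" where
  "curvature_defect x =
     (D\<theta> Leg_l Leg_l Leg_u x - (T Leg_l Leg_l x * T Leg_u Leg_u x - T Leg_l Leg_u x * T Leg_u Leg_l x))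
   + (D\<theta> Leg_n Leg_n Leg_u x - (T Leg_n Leg_n x * T Leg_u Leg_u x - T Leg_n Leg_u x * T Leg_u Leg_n x))"

lemma metric_trace_\<Theta>: assumes x: "x \<in> U" shows "metric_trace (h x) (\<Theta> x) = (\<Sum>a\<in>UNIV. T a a x)"
proof -
  have "metric_trace (h x) (\<Theta> x)
     = (\<Sum>i\<in>UNIV. \<Sum>a\<in>UNIV. E a x $ i * (\<Sum>j\<in>UNIV. E a x $ j * \<Theta> x $ i $ j))"
    unfolding metric_trace_def inv_h[OF x] sum_distrib_left sum_distrib_right
    by (subst sum.swap[where A="UNIV :: leg set"]) (simp add: mult_ac)
  then show ?thesis unfolding E_\<Theta>[OF x] T_nth by (simp add: sum.swap[where A="UNIV :: leg set"])
qed

lemma metric_norm_sq_\<Theta>: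
  assumes x: "x \<in> U" shows "metric_norm_sq (h x) (\<Theta> x) = (\<Sum>a\<in>UNIV. \<Sum>b\<in>UNIV. (T a b x)\<^sup>2)"
proof -
  have T2: "T a b x = (\<Sum>i\<in>UNIV. \<Sum>j\<in>UNIV. E a x $ i * E b x $ j * \<Theta> x $ i $ j)" for a b
    unfolding T_nth \<theta>_nth[OF x] sum_distrib_left by (subst sum.swap) (simp add: mult_ac)
  have "(\<Sum>a\<in>UNIV. \<Sum>b\<in>UNIV. (T a b x)\<^sup>2) = (\<Sum>a\<in>UNIV. \<Sum>b\<in>UNIV. (T b a x)\<^sup>2)"
    by (rule sum.swap)
  also have "(\<Sum>a\<in>UNIV. \<Sum>b\<in>UNIV. (T b a x)\<^sup>2)
     = (\<Sum>a\<in>UNIV. \<Sum>b\<in>UNIV. \<Sum>i\<in>UNIV. \<Sum>j\<in>UNIV. \<Sum>k\<in>UNIV. \<Sum>l\<in>UNIV.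
         E b x $ k * E a x $ l * \<Theta> x $ k $ l * (E b x $ i * E a x $ j * \<Theta> x $ i $ j))"
    unfolding power2_eq_square T2 sum_distrib_left sum_distrib_right ..
  also have "\<dots> = (\<Sum>i\<in>UNIV. \<Sum>j\<in>UNIV. \<Sum>k\<in>UNIV. \<Sum>l\<in>UNIV. \<Sum>a\<in>UNIV. \<Sum>b\<in>UNIV.
         E b x $ k * E a x $ l * \<Theta> x $ k $ l * (E b x $ i * E a x $ j * \<Theta> x $ i $ j))"
    by (simp add: sum.swap[where A="UNIV :: leg set" and B="UNIV :: 3 set"])
  also have "\<dots> = metric_norm_sq (h x) (\<Theta> x)"
    unfolding metric_norm_sq_def inv_h[OF x] sum_distrib_left sum_distrib_right
    by (simp add: mult_ac)
  finally show ?thesis by simp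
qed

lemma codazzi_contract:
  assumes x: "x \<in> U"
  shows "(\<Sum>k\<in>UNIV. E b x $ k * codazzi j i k x)
    = - d\<theta> b i j x - \<theta> Leg_u x $ i * \<theta> b x $ j + \<theta> Leg_u x $ j * \<theta> b x $ i"
proof -
  have "(\<Sum>k\<in>UNIV. E b x $ k * codazzi j i k x)
    = - (\<Sum>c\<in>UNIV. d\<theta> c i j x * (\<Sum>k\<in>UNIV. E b x $ k * e c x $ k))
      - \<theta> Leg_u x $ i * (\<Sum>k\<in>UNIV. E b x $ k * \<Theta> x $ j $ k)
      + \<theta> Leg_u x $ j * (\<Sum>k\<in>UNIV. E b x $ k * \<Theta> x $ i $ k)"
    unfolding codazzi_eq[OF x] sum_distrib_left[where A="UNIV :: 3 set"]
    by (simp add: sum_leg algebra_simps sum.distrib sum_subtractf sum_negf)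
  then show ?thesis unfolding E_e'[OF x] E_\<Theta>[OF x] by (cases b; simp add: sum_leg)
qed

text \<open>Up to sign the curvature forms of the coframe are \<open>d\<theta>\<^sub>l\<close>, \<open>d\<theta>\<^sub>n\<close> and \<open>\<theta>\<^sub>l \<and> \<theta>\<^sub>n\<close>; the scalar curvature is
  twice the sum of their components in the three coordinate planes of the frame.\<close>

lemma scalar_curvature_eq:
  assumes x: "x \<in> U"
  shows "scalar_curvature h x =
    - 2 * (D\<theta> Leg_l Leg_l Leg_u x + D\<theta> Leg_n Leg_n Leg_u x)
    - 2 * (T Leg_l Leg_l x * T Leg_n Leg_n x - (T Leg_l Leg_n x)\<^sup>2)"
proof -
  let ?\<delta> = "\<lambda>b. if b = Leg_u then 1 else 0 :: real"
  define bil where "bil a b F = (\<Sum>i\<in>UNIV. \<Sum>j\<in>UNIV. E a x $ i * E b x $ j * F i j)" for a b and F :: "3 \<Rightarrow> 3 \<Rightarrow> real"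
  define Q where "Q a b i j = (\<Sum>k\<in>UNIV. E b x $ k * (\<Sum>p\<in>UNIV. e a x $ p * riemann i j p k x))" for a b i j
  have contr: "(\<Sum>i\<in>UNIV. riemann i j i k x)
      = (\<Sum>a\<in>UNIV. \<Sum>i\<in>UNIV. E a x $ i * (\<Sum>p\<in>UNIV. e a x $ p * riemann i j p k x))" for j k
  proof -
    have "(\<Sum>a\<in>UNIV. \<Sum>i\<in>UNIV. E a x $ i * (\<Sum>p\<in>UNIV. e a x $ p * riemann i j p k x))
      = (\<Sum>i\<in>UNIV. \<Sum>p\<in>UNIV. (\<Sum>a\<in>UNIV. E a x $ i * e a x $ p) * riemann i j p k x)"
      unfolding sum_distrib_left sum_distrib_right
      by (simp add: sum.swap[where A="UNIV :: leg set" and B="UNIV :: 3 set"] mult_ac)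
    then show ?thesis by (simp add: E_e[OF x] if_distrib[of "\<lambda>c. c * y" for y] cong: if_cong)
  qed
  have "scalar_curvature h x = (\<Sum>j\<in>UNIV. \<Sum>k\<in>UNIV. (\<Sum>b\<in>UNIV. E b x $ j * E b x $ k) *
      (\<Sum>a\<in>UNIV. \<Sum>i\<in>UNIV. E a x $ i * (\<Sum>p\<in>UNIV. e a x $ p * riemann i j p k x)))"
    by (simp only: scalar_curvature_def metric_trace_def ricci_riemann inv_h[OF x] contr)
  also have "\<dots> = (\<Sum>a\<in>UNIV. \<Sum>b\<in>UNIV. bil a b (Q a b))"
  proof -
    have "bil a b (Q a b) = (\<Sum>j\<in>UNIV. \<Sum>k\<in>UNIV. (E b x $ j * E b x $ k) *
        (\<Sum>i\<in>UNIV. E a x $ i * (\<Sum>p\<in>UNIV. e a x $ p * riemann i j p k x)))" for a b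
    proof -
      have "bil a b (Q a b) = (\<Sum>j\<in>UNIV. \<Sum>i\<in>UNIV. \<Sum>k\<in>UNIV. (E b x $ j * E b x $ k) *
        (E a x $ i * (\<Sum>p\<in>UNIV. e a x $ p * riemann i j p k x)))"
        unfolding bil_def Q_def sum_distrib_left[of "E _ _ $ _ * E _ _ $ _"]
        by (subst sum.swap) (simp add: mult_ac)
      also have "\<dots> = (\<Sum>j\<in>UNIV. \<Sum>k\<in>UNIV. \<Sum>i\<in>UNIV. (E b x $ j * E b x $ k) *
        (E a x $ i * (\<Sum>p\<in>UNIV. e a x $ p * riemann i j p k x)))"
        by (rule sum.cong[OF refl sum.swap])
      finally show ?thesis by (simp add: sum_distrib_left)
    qed
    then show ?thesis by (simp add: sum_leg algebra_simps sum.distrib)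
  qed
  also have "\<dots> = (\<Sum>a\<in>UNIV. \<Sum>b\<in>UNIV. - D\<theta> a a b x * ?\<delta> b
      + T a a x * (T Leg_u b x * ?\<delta> b - T b b x) - T a b x * (T Leg_u a x * ?\<delta> b - T b a x)
      - ?\<delta> a * (- D\<theta> b a b x - T Leg_u a x * T b b x + T Leg_u b x * T b a x))"
  proof (intro sum.cong[OF refl])
    fix a b
    have Q: "Q a b i j = - (?\<delta> b * d\<theta> a i j x)
        + ?\<delta> b * (\<theta> a x $ i * \<theta> Leg_u x $ j) - \<theta> a x $ i * \<theta> b x $ j
        - ?\<delta> b * (\<theta> Leg_u x $ i * \<theta> a x $ j) + \<theta> b x $ i * \<theta> a x $ j
        + ?\<delta> a * (d\<theta> b i j x) + ?\<delta> a * (\<theta> Leg_u x $ i * \<theta> b x $ j) - ?\<delta> a * (\<theta> b x $ i * \<theta> Leg_u x $ j)" for i j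
    proof -
      have "Q a b i j = - d\<theta> a i j x * (\<Sum>k\<in>UNIV. E b x $ k * e Leg_u x $ k)
        + \<theta> a x $ i * (\<theta> Leg_u x $ j * (\<Sum>k\<in>UNIV. E b x $ k * e Leg_u x $ k) - (\<Sum>k\<in>UNIV. E b x $ k * \<Theta> x $ j $ k))
        - \<theta> a x $ j * (\<theta> Leg_u x $ i * (\<Sum>k\<in>UNIV. E b x $ k * e Leg_u x $ k) - (\<Sum>k\<in>UNIV. E b x $ k * \<Theta> x $ i $ k))
        - ?\<delta> a * (\<Sum>k\<in>UNIV. E b x $ k * codazzi j i k x)"
        unfolding Q_def riemann_coframe[OF x] sum_distrib_left
        by (cases a; simp add: algebra_simps sum.distrib sum_subtractf sum_distrib_left sum_negf)
      then show ?thesis unfolding codazzi_contract[OF x] E_e'[OF x] E_\<Theta>[OF x] by (simp add: algebra_simps)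
    qed
    have bil_prod: "bil a b (\<lambda>i j. \<theta> c x $ i * \<theta> d x $ j) = T c a x * T d b x" for c d
      unfolding bil_def T_nth sum_product by (simp add: mult_ac)
    have bil_d: "bil a b (\<lambda>i j. d\<theta> c i j x) = D\<theta> c a b x" for c
      unfolding bil_def D\<theta>_nth[OF x] ..
    have bil_lin: "bil a b (\<lambda>i j. F i j + G i j) = bil a b F + bil a b G"
      "bil a b (\<lambda>i j. F i j - G i j) = bil a b F - bil a b G"
      "bil a b (\<lambda>i j. - F i j) = - bil a b F"
      "bil a b (\<lambda>i j. r * F i j) = r * bil a b F" for F G r
      unfolding bil_def by (simp_all add: sum_distrib_left algebra_simps sum.distrib sum_subtractf sum_negf)
    show "bil a b (Q a b) = - D\<theta> a a b x * ?\<delta> b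
      + T a a x * (T Leg_u b x * ?\<delta> b - T b b x) - T a b x * (T Leg_u a x * ?\<delta> b - T b a x)
      - ?\<delta> a * (- D\<theta> b a b x - T Leg_u a x * T b b x + T Leg_u b x * T b a x)"
      unfolding Q[abs_def] bil_lin bil_prod bil_d by (simp add: algebra_simps)
  qed
  also have "\<dots> = - 2 * (D\<theta> Leg_l Leg_l Leg_u x + D\<theta> Leg_n Leg_n Leg_u x)
    - 2 * (T Leg_l Leg_l x * T Leg_n Leg_n x - (T Leg_l Leg_n x)\<^sup>2)"
    using D\<theta>_u[OF x] D\<theta>_antisym[of Leg_l Leg_u Leg_l x] D\<theta>_antisym[of Leg_n Leg_u Leg_n x]
      T_sym[OF x, of Leg_l Leg_u] T_sym[OF x, of Leg_n Leg_u] T_sym[OF x, of Leg_n Leg_l]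
    by (simp add: sum_leg algebra_simps power2_eq_square)
  finally show ?thesis .
qed

text \<open>In \<open>|\<Theta>|\<^sup>2 - Tr(\<Theta>)\<^sup>2\<close> the principal minor in the \<open>l\<close>-\<open>n\<close> plane agrees with the one in the scalar
  curvature, and the other two are the quadratic terms of the defect.\<close>

proposition hamiltonian_iff:
  assumes x: "x \<in> U"
  shows "scalar_curvature h x = metric_norm_sq (h x) (\<Theta> x) - (metric_trace (h x) (\<Theta> x))\<^sup>2
    \<longleftrightarrow> curvature_defect x = 0"
proof -
  have "scalar_curvature h x - (metric_norm_sq (h x) (\<Theta> x) - (metric_trace (h x) (\<Theta> x))\<^sup>2)
     = - 2 * curvature_defect x"
    unfolding scalar_curvature_eq[OF x] metric_norm_sq_\<Theta>[OF x] metric_trace_\<Theta>[OF x] curvature_defect_def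
    using T_sym[OF x, of Leg_l Leg_u] T_sym[OF x, of Leg_n Leg_u] T_sym[OF x, of Leg_n Leg_l]
    by (simp add: sum_leg algebra_simps power2_eq_square)
  then show ?thesis by auto
qed

text \<open>From \<open>d(de\<^sub>c) = 0\<close>, that is, \<open>d\<theta>\<^sub>c \<and> e\<^sub>u = \<theta>\<^sub>c \<and> \<theta>\<^sub>u \<and> e\<^sub>u\<close>.\<close>

lemma D\<theta>_bianchi:
  assumes x: "x \<in> U"
  shows "D\<theta> c Leg_l Leg_n x = T c Leg_l x * T Leg_u Leg_n x - T c Leg_n x * T Leg_u Leg_l x"
proof -
  define \<alpha> \<tau> where "\<alpha> = (\<lambda>a q v. e a q \<bullet> v)" and "\<tau> = (\<lambda>a q v. \<theta> a q \<bullet> v)"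
  have sm: "smooth_on U (\<lambda>q. \<alpha> a q v)" "smooth_on U (\<lambda>q. \<tau> a q v)" for a v
    unfolding \<alpha>_def \<tau>_def
    by (intro smooth_on_inner smooth_e smooth_on_vecI smooth_\<theta>_nth smooth_on_const U)+
  have d\<alpha>: "ext1 (\<alpha> a) q v w = wedge11 (\<tau> a q) (\<alpha> Leg_u q) v w" if q: "q \<in> U" for a q v w
  proof -
    have "ext1 (\<alpha> a) q v w = (\<Sum>i\<in>UNIV. \<Sum>j\<in>UNIV. v $ i * w $ j * wedge (\<theta> a q) (e Leg_u q) $ i $ j)"
      unfolding \<alpha>_def ext_e[OF q, symmetric] ext_deriv_def by (simp add: ext1_coord[OF diffs(1)[OF q]])
    also have "\<dots> = wedge11 (\<tau> a q) (\<alpha> Leg_u q) v w"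
      unfolding wedge11_def \<tau>_def \<alpha>_def inner_vec_def wedge_def by (simp add: sum_3 algebra_simps)
    finally show ?thesis .
  qed
  have "0 = ext2 (ext1 (\<alpha> c)) x (E Leg_l x) (E Leg_n x) (E Leg_u x)"
    using ext2_ext1[OF U x sm(1)] by simp
  also have "\<dots> = ext2 (\<lambda>q. wedge11 (\<tau> c q) (\<alpha> Leg_u q)) x (E Leg_l x) (E Leg_n x) (E Leg_u x)"
    by (rule ext2_cong_open[OF U x d\<alpha>])
      (simp_all add: smooth_on_differentiable[OF smooth_on_ext1[OF U sm(1)] x])
  also have "\<dots> = wedge21 (ext1 (\<tau> c) x) (\<alpha> Leg_u x) (E Leg_l x) (E Leg_n x) (E Leg_u x)
      - wedge21 (ext1 (\<alpha> Leg_u) x) (\<tau> c x) (E Leg_l x) (E Leg_n x) (E Leg_u x)"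
    by (rule ext2_wedge11) (fact smooth_on_differentiable[OF sm(2) x] smooth_on_differentiable[OF sm(1) x])+
  finally have *: "0 = \<dots>" .
  have dual: "\<alpha> Leg_u x (E a x) = (if a = Leg_u then 1 else 0)" for a
    using e_E[OF x, of Leg_u a] by (simp add: \<alpha>_def inner_vec_def)
  have \<tau>T: "\<tau> a x (E b x) = T a b x" for a b by (simp add: \<tau>_def T_def)
  have \<tau>D: "ext1 (\<tau> c) x (E a x) (E b x) = D\<theta> c a b x" for a b by (simp add: \<tau>_def D\<theta>_def)
  show ?thesis using *
    unfolding wedge21_def d\<alpha>[OF x] wedge11_def dual \<tau>T \<tau>D by simp
qed

lemma partial_E:
  assumes x: "x \<in> U"
  shows "partial j (\<lambda>y. E a y $ m) x =
    - (\<Sum>c\<in>UNIV. E c x $ m * (\<Sum>i\<in>UNIV. E a x $ i * cov_e c j i x))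
    - (\<Sum>i\<in>UNIV. E a x $ i * christoffel h m j i x)"
proof -
  have 1: "(\<Sum>i\<in>UNIV. e c x $ i * partial j (\<lambda>y. E a y $ i) x)
      = - (\<Sum>i\<in>UNIV. E a x $ i * cov_e c j i x)
        - (\<Sum>n\<in>UNIV. e c x $ n * (\<Sum>i\<in>UNIV. E a x $ i * christoffel h n j i x))" for c
  proof -
    have "partial j (\<lambda>y. \<Sum>i\<in>UNIV. e c y $ i * E a y $ i) x = partial j (\<lambda>y. if a = c then 1 else 0) x"
      by (rule partial_cong_open[OF U x e_E]) (auto intro!: differentiable_sum differentiable_mult diffs x)
    then have "(\<Sum>i\<in>UNIV. e c x $ i * partial j (\<lambda>y. E a y $ i) x + partial j (\<lambda>y. e c y $ i) x * E a x $ i) = 0"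
      by (simp add: partial_sum partial_mult diffs x differentiable_mult partial_const)
    then have "(\<Sum>i\<in>UNIV. e c x $ i * partial j (\<lambda>y. E a y $ i) x)
      = - (\<Sum>i\<in>UNIV. E a x $ i * partial j (\<lambda>y. e c y $ i) x)"
      by (simp add: sum.distrib mult.commute)
    also have "\<dots> = - (\<Sum>i\<in>UNIV. E a x $ i * cov_e c j i x)
        - (\<Sum>i\<in>UNIV. E a x $ i * (\<Sum>n\<in>UNIV. e c x $ n * christoffel h n j i x))"
      unfolding partial_e_cov[OF x] by (simp add: sum.distrib algebra_simps)
    also have "(\<Sum>i\<in>UNIV. E a x $ i * (\<Sum>n\<in>UNIV. e c x $ n * christoffel h n j i x))
        = (\<Sum>n\<in>UNIV. e c x $ n * (\<Sum>i\<in>UNIV. E a x $ i * christoffel h n j i x))"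
      unfolding sum_distrib_left by (subst sum.swap) (simp add: mult_ac)
    finally show ?thesis .
  qed
  have res: "(\<Sum>c\<in>UNIV. E c x $ m * (\<Sum>n\<in>UNIV. e c x $ n * F n)) = F m" for F :: "3 \<Rightarrow> real"
  proof -
    have "(\<Sum>c\<in>UNIV. E c x $ m * (\<Sum>n\<in>UNIV. e c x $ n * F n))
      = (\<Sum>n\<in>UNIV. (\<Sum>c\<in>UNIV. E c x $ m * e c x $ n) * F n)"
      unfolding sum_distrib_left sum_distrib_right by (subst sum.swap) (simp add: mult_ac)
    then show ?thesis by (simp add: E_e[OF x] if_distrib[of "\<lambda>c. c * y" for y] cong: if_cong)
  qed
  have "partial j (\<lambda>y. E a y $ m) x = (\<Sum>c\<in>UNIV. E c x $ m * (\<Sum>i\<in>UNIV. e c x $ i * partial j (\<lambda>y. E a y $ i) x))"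
    by (rule res[symmetric])
  also have "\<dots> = - (\<Sum>c\<in>UNIV. E c x $ m * (\<Sum>i\<in>UNIV. E a x $ i * cov_e c j i x))
    - (\<Sum>c\<in>UNIV. E c x $ m * (\<Sum>n\<in>UNIV. e c x $ n * (\<Sum>i\<in>UNIV. E a x $ i * christoffel h n j i x)))"
    unfolding 1 by (simp add: algebra_simps sum_subtractf sum_negf)
  finally show ?thesis unfolding res .
qed

lemma cov_e_contract:
  assumes x: "x \<in> U"
  shows "(\<Sum>i\<in>UNIV. E a x $ i * cov_e c j i x)
    = \<theta> c x $ j * (if a = Leg_u then 1 else 0) - (if c = Leg_u then \<theta> a x $ j else 0)"
proof -
  have "(\<Sum>i\<in>UNIV. E a x $ i * cov_e c j i x) = \<theta> c x $ j * (\<Sum>i\<in>UNIV. E a x $ i * e Leg_u x $ i)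
    - (if c = Leg_u then (\<Sum>i\<in>UNIV. E a x $ i * \<Theta> x $ j $ i) else 0)"
    unfolding cov_e_def by (cases "c = Leg_u"; simp add: algebra_simps sum_subtractf sum_distrib_left)
  then show ?thesis unfolding E_e'[OF x] E_\<Theta>[OF x] .
qed

text \<open>The trace is the sum of \<open>\<Theta>(E\<^sub>a, E\<^sub>a)\<close>. Differentiating the frame produces the connection matrix
  contracted with \<open>\<Theta>\<close>, which vanishes since one is skew and the other symmetric.\<close>

lemma partial_trace:
  assumes x: "x \<in> U"
  shows "partial j (\<lambda>y. metric_trace (h y) (\<Theta> y)) x
    = (\<Sum>i\<in>UNIV. \<Sum>k\<in>UNIV. matrix_inv (h x) $ i $ k * cov_deriv2 h \<Theta> j i k x)"
proof -
  have anti: "(\<Sum>a\<in>UNIV. \<Sum>c\<in>UNIV. T c a x * (\<Sum>i\<in>UNIV. E a x $ i * cov_e c j i x)) = 0"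
    unfolding cov_e_contract[OF x]
    using T_sym[OF x, of Leg_l Leg_u] T_sym[OF x, of Leg_n Leg_u] T_sym[OF x, of Leg_n Leg_l]
    by (simp add: sum_leg algebra_simps)
  define P where "P = (\<Sum>a\<in>UNIV. \<Sum>i\<in>UNIV. E a x $ i * partial j (\<lambda>y. \<theta> a y $ i) x)
      - (\<Sum>a\<in>UNIV. \<Sum>m\<in>UNIV. \<theta> a x $ m * (\<Sum>i\<in>UNIV. E a x $ i * christoffel h m j i x))"
  have "partial j (\<lambda>y. metric_trace (h y) (\<Theta> y)) x = partial j (\<lambda>y. \<Sum>a\<in>UNIV. \<Sum>i\<in>UNIV. E a y $ i * \<theta> a y $ i) x"
    by (rule partial_cong_open[OF U x, symmetric])
      (auto simp: metric_trace_\<Theta> T_nth intro!: differentiable_sum differentiable_mult diffs x)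
  also have "\<dots> = (\<Sum>a\<in>UNIV. \<Sum>i\<in>UNIV. E a x $ i * partial j (\<lambda>y. \<theta> a y $ i) x
      + partial j (\<lambda>y. E a y $ i) x * \<theta> a x $ i)"
    by (simp add: partial_sum partial_mult diffs x differentiable_mult differentiable_sum)
  also have "\<dots> = P - (\<Sum>a\<in>UNIV. \<Sum>m\<in>UNIV. (\<Sum>c\<in>UNIV. E c x $ m * (\<Sum>i\<in>UNIV. E a x $ i * cov_e c j i x)) * \<theta> a x $ m)"
    unfolding partial_E[OF x] P_def by (simp add: algebra_simps sum.distrib sum_subtractf sum_negf)
  also have "(\<Sum>a\<in>UNIV. \<Sum>m\<in>UNIV. (\<Sum>c\<in>UNIV. E c x $ m * (\<Sum>i\<in>UNIV. E a x $ i * cov_e c j i x)) * \<theta> a x $ m)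
      = (\<Sum>a\<in>UNIV. \<Sum>c\<in>UNIV. T a c x * (\<Sum>i\<in>UNIV. E a x $ i * cov_e c j i x))"
  proof (rule sum.cong[OF refl])
    fix a
    have "(\<Sum>m\<in>UNIV. (\<Sum>c\<in>UNIV. E c x $ m * F c) * \<theta> a x $ m) = (\<Sum>c\<in>UNIV. T a c x * F c)" for F
      unfolding T_nth sum_distrib_left sum_distrib_right by (subst sum.swap) (simp add: mult_ac)
    then show "(\<Sum>m\<in>UNIV. (\<Sum>c\<in>UNIV. E c x $ m * (\<Sum>i\<in>UNIV. E a x $ i * cov_e c j i x)) * \<theta> a x $ m)
      = (\<Sum>c\<in>UNIV. T a c x * (\<Sum>i\<in>UNIV. E a x $ i * cov_e c j i x))" .
  qed
  also have "\<dots> = 0" using anti T_sym[OF x] by simp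
  finally have L: "partial j (\<lambda>y. metric_trace (h y) (\<Theta> y)) x = P" by simp
  have trace_term: "(\<Sum>i\<in>UNIV. E a x $ i * (\<Sum>k\<in>UNIV. E a x $ k * cov_deriv2 h \<Theta> j i k x))
    = (\<Sum>i\<in>UNIV. E a x $ i * partial j (\<lambda>y. \<theta> a y $ i) x)
        - (\<Sum>m\<in>UNIV. \<theta> a x $ m * (\<Sum>i\<in>UNIV. E a x $ i * christoffel h m j i x))
        + (\<Sum>c\<in>UNIV. T c a x * (\<Sum>i\<in>UNIV. E a x $ i * cov_e c j i x))" for a
  proof -
    have K: "(\<Sum>k\<in>UNIV. E a x $ k * cov_deriv2 h \<Theta> j i k x)
       = partial j (\<lambda>y. \<theta> a y $ i) x + (\<Sum>c\<in>UNIV. \<theta> c x $ i * (\<Sum>k\<in>UNIV. E a x $ k * cov_e c j k x))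
        - (\<Sum>l\<in>UNIV. christoffel h l j i x * \<theta> a x $ l)" for i
    proof -
      have cv: "cov_deriv2 h \<Theta> j i k x
        = (\<Sum>c\<in>UNIV. partial j (\<lambda>y. \<theta> c y $ i) x * e c x $ k + \<theta> c x $ i * cov_e c j k x)
          - (\<Sum>l\<in>UNIV. christoffel h l j i x * \<Theta> x $ l $ k)" for k
        unfolding cov_\<Theta>[OF x, symmetric] cov_deriv2_def by (simp add: mult.commute)
      have "(\<Sum>k\<in>UNIV. E a x $ k * cov_deriv2 h \<Theta> j i k x)
        = (\<Sum>c\<in>UNIV. partial j (\<lambda>y. \<theta> c y $ i) x * (\<Sum>k\<in>UNIV. E a x $ k * e c x $ k))
         + (\<Sum>c\<in>UNIV. \<theta> c x $ i * (\<Sum>k\<in>UNIV. E a x $ k * cov_e c j k x))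
         - (\<Sum>k\<in>UNIV. E a x $ k * (\<Sum>l\<in>UNIV. christoffel h l j i x * \<Theta> x $ l $ k))"
        unfolding cv by (simp add: sum_leg algebra_simps sum.distrib sum_subtractf sum_distrib_left)
      also have "(\<Sum>k\<in>UNIV. E a x $ k * (\<Sum>l\<in>UNIV. christoffel h l j i x * \<Theta> x $ l $ k))
        = (\<Sum>l\<in>UNIV. christoffel h l j i x * (\<Sum>k\<in>UNIV. E a x $ k * \<Theta> x $ l $ k))"
        unfolding sum_distrib_left by (subst sum.swap) (simp add: mult_ac)
      finally show ?thesis unfolding E_e'[OF x] E_\<Theta>[OF x] by (cases a; simp add: sum_leg)
    qed
    have S: "(\<Sum>i\<in>UNIV. E a x $ i * (\<Sum>l\<in>UNIV. christoffel h l j i x * \<theta> a x $ l))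
       = (\<Sum>m\<in>UNIV. \<theta> a x $ m * (\<Sum>i\<in>UNIV. E a x $ i * christoffel h m j i x))"
      unfolding sum_distrib_left by (subst sum.swap) (simp add: mult_ac)
    have R: "(\<Sum>i\<in>UNIV. E a x $ i * (\<Sum>c\<in>UNIV. \<theta> c x $ i * F c)) = (\<Sum>c\<in>UNIV. T c a x * F c)" for F
      unfolding T_nth sum_distrib_left sum_distrib_right by (subst sum.swap) (simp add: mult_ac)
    show ?thesis
      unfolding K R[symmetric] S[symmetric] by (simp add: algebra_simps sum.distrib sum_subtractf)
  qed
  have "(\<Sum>i\<in>UNIV. \<Sum>k\<in>UNIV. matrix_inv (h x) $ i $ k * cov_deriv2 h \<Theta> j i k x)
    = (\<Sum>a\<in>UNIV. \<Sum>i\<in>UNIV. E a x $ i * (\<Sum>k\<in>UNIV. E a x $ k * cov_deriv2 h \<Theta> j i k x))"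
    unfolding inv_h[OF x] sum_distrib_left sum_distrib_right
    by (simp add: sum.swap[where A="UNIV :: leg set" and B="UNIV :: 3 set"] mult_ac)
  also have "\<dots> = P + (\<Sum>a\<in>UNIV. \<Sum>c\<in>UNIV. T c a x * (\<Sum>i\<in>UNIV. E a x $ i * cov_e c j i x))"
    unfolding P_def trace_term by (simp only: sum.distrib sum_subtractf)
  finally show ?thesis using L anti by simp
qed

text \<open>The difference of the two sides is a contraction of the antisymmetrised derivative of \<open>\<Theta>\<close>. Its
  components along \<open>E\<^sub>l\<close> and \<open>E\<^sub>n\<close> vanish by \<open>D\<theta>_bianchi\<close>, and along \<open>E\<^sub>u\<close> it is minus the defect.\<close>

proposition momentum:
  assumes x: "x \<in> U" and defect: "curvature_defect x = 0"
  shows "differential (\<lambda>y. metric_trace (h y) (\<Theta> y)) x = divergence2 h \<Theta> x"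
proof -
  define M where "M j = differential (\<lambda>y. metric_trace (h y) (\<Theta> y)) x $ j - divergence2 h \<Theta> x $ j" for j
  have M: "M j = (\<Sum>b\<in>UNIV. - (\<Sum>k\<in>UNIV. E b x $ k * d\<theta> b k j x)
      - T Leg_u b x * \<theta> b x $ j + \<theta> Leg_u x $ j * T b b x)" for j
  proof -
    have cod: "cov_deriv2 h \<Theta> j i k x - cov_deriv2 h \<Theta> k i j x = codazzi j k i x" for i k
    proof -
      have p: "partial k (\<lambda>y. \<Theta> y $ i $ j) x = partial k (\<lambda>y. \<Theta> y $ j $ i) x" for i j k
        by (rule partial_cong_open[OF U x \<Theta>_sym diffs(4)[OF x]])
      show ?thesis
        unfolding cov_deriv2_def codazzi_def p[of j i k] p[of k i j]
        using christoffel_sym[of _ j k x] \<Theta>_sym[OF x, of _ k] \<Theta>_sym[OF x, of i] \<Theta>_sym[OF x, of _ j]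
        by (simp add: mult.commute)
    qed
    have "M j = (\<Sum>i\<in>UNIV. \<Sum>k\<in>UNIV. matrix_inv (h x) $ i $ k * codazzi j k i x)"
      unfolding M_def differential_def divergence2_def cod[symmetric]
      by (simp add: partial_trace[OF x] right_diff_distrib sum_subtractf)
    also have "\<dots> = (\<Sum>b\<in>UNIV. \<Sum>k\<in>UNIV. E b x $ k * (\<Sum>i\<in>UNIV. E b x $ i * codazzi j k i x))"
      unfolding inv_h[OF x] sum_distrib_left sum_distrib_right
      by (subst (2) sum.swap) (simp add: sum.swap[where A="UNIV :: leg set" and B="UNIV :: 3 set"] mult_ac)
    also have "\<dots> = (\<Sum>b\<in>UNIV. \<Sum>k\<in>UNIV. E b x $ k *
        (- d\<theta> b k j x - \<theta> Leg_u x $ k * \<theta> b x $ j + \<theta> Leg_u x $ j * \<theta> b x $ k))"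
      unfolding codazzi_contract[OF x] ..
    also have "\<dots> = (\<Sum>b\<in>UNIV. - (\<Sum>k\<in>UNIV. E b x $ k * d\<theta> b k j x)
      - T Leg_u b x * \<theta> b x $ j + \<theta> Leg_u x $ j * T b b x)"
      unfolding T_nth by (simp add: algebra_simps sum.distrib sum_subtractf sum_negf sum_distrib_left)
    finally show ?thesis .
  qed
  have ME: "(\<Sum>j\<in>UNIV. E c x $ j * M j)
    = (\<Sum>b\<in>UNIV. - D\<theta> b b c x - T Leg_u b x * T b c x + T Leg_u c x * T b b x)" for c
  proof -
    have "(\<Sum>j\<in>UNIV. E c x $ j * M j) = (\<Sum>b\<in>UNIV. - (\<Sum>j\<in>UNIV. E c x $ j * (\<Sum>k\<in>UNIV. E b x $ k * d\<theta> b k j x))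
      - T Leg_u b x * (\<Sum>j\<in>UNIV. E c x $ j * \<theta> b x $ j) + (\<Sum>j\<in>UNIV. E c x $ j * \<theta> Leg_u x $ j) * T b b x)"
      unfolding M by (simp add: sum_leg algebra_simps sum.distrib sum_subtractf sum_negf sum_distrib_left)
    moreover have "(\<Sum>j\<in>UNIV. E c x $ j * (\<Sum>k\<in>UNIV. E b x $ k * d\<theta> b k j x)) = D\<theta> b b c x" for b
      unfolding D\<theta>_nth[OF x] sum_distrib_left by (subst sum.swap) (simp add: mult_ac)
    ultimately show ?thesis by (simp add: T_nth)
  qed
  have "(\<Sum>j\<in>UNIV. E c x $ j * M j) = 0" for c
    unfolding ME
    using defect D\<theta>_u[OF x] D\<theta>_antisym[of Leg_l Leg_l Leg_l x] D\<theta>_antisym[of Leg_n Leg_n Leg_n x]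
      D\<theta>_antisym[of Leg_n Leg_n Leg_l x] D\<theta>_bianchi[OF x, of Leg_l] D\<theta>_bianchi[OF x, of Leg_n]
      T_sym[OF x, of Leg_l Leg_u] T_sym[OF x, of Leg_n Leg_u] T_sym[OF x, of Leg_n Leg_l]
    by (cases c; simp add: sum_leg curvature_defect_def algebra_simps)
  then have "E c x \<bullet> (\<chi> j. M j) = 0" for c by (simp add: inner_vec_def)
  then have "(\<chi> j. M j) = 0"
    using coframe_expand[OF cof[OF x], of "\<chi> j. M j"] by (simp add: E_def)
  then show ?thesis by (simp add: vec_eq_iff M_def)
qed

end

section \<open>The flow in a chart\<close>

lemma smooth_on_time_slice:
  fixes F :: "real \<times> 'v::euclidean_space \<Rightarrow> 'w::real_normed_vector"
  assumes "open U" "smooth_on (I \<times> U) F" "t \<in> I"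
  shows "smooth_on U (\<lambda>x. F (t, x))"
  by (rule smooth_on_compose[OF assms(1,2) smooth_on_Pair[OF assms(1) smooth_on_const
        smooth_on_bounded_linear_ident[OF bounded_linear_ident]]])
    (use assms(3) in auto)

lemma dir_time:
  assumes "F differentiable (at (t, x))"
  shows "((\<lambda>s. F (s, x)) has_vector_derivative dir (1, 0) F (t, x)) (at t)"
proof -
  have "((\<lambda>s. (s, x)) has_derivative (\<lambda>r. (r, 0))) (at t)"
    by (intro has_derivative_Pair has_derivative_ident has_derivative_const)
  from has_derivative_compose[OF this has_derivative_dir[OF assms]]
  have "((\<lambda>s. F (s, x)) has_derivative (\<lambda>r. dir (r, 0) F (t, x))) (at t)" .
  moreover have "(\<lambda>r. dir (r, 0) F (t, x)) = (\<lambda>r. r *\<^sub>R dir (1, 0) F (t, x))"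
  proof
    show "dir (r, 0) F (t, x) = r *\<^sub>R dir (1, 0) F (t, x)" for r
      using linear_scale[OF dir_linear[OF assms], of r "(1, 0)"] by simp
  qed
  ultimately show ?thesis unfolding has_vector_derivative_def by metis
qed

lemma dir_space:
  assumes "F differentiable (at (t, x))"
  shows "dir v (\<lambda>y. F (t, y)) x = dir (0, v) F (t, x)"
proof (rule dir_eqI)
  have "((\<lambda>y. (t, y)) has_derivative (\<lambda>v. (0, v))) (at x)"
    by (intro has_derivative_Pair has_derivative_ident has_derivative_const)
  from has_derivative_compose[OF this has_derivative_dir[OF assms]]
  show "((\<lambda>y. F (t, y)) has_derivative (\<lambda>v. dir (0, v) F (t, x))) (at x)" .
qed

lemma dir_split:
  assumes "F differentiable (at p)"
  shows "dir w F p = fst w *\<^sub>R dir (1, 0) F p + dir (0, snd w) F p"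
proof -
  note L = dir_linear[OF assms]
  have "dir (fst w *\<^sub>R (1, 0) + (0, snd w)) F p = fst w *\<^sub>R dir (1, 0) F p + dir (0, snd w) F p"
    by (simp only: linear_add[OF L] linear_scale[OF L])
  then show ?thesis by simp
qed

lemma dir_vec_nth:
  "F differentiable (at p) \<Longrightarrow> dir v F p $ i = dir v (\<lambda>q. F q $ i) p" for F :: "_ \<Rightarrow> 'w::real_normed_vector^'n"
  by (rule dir_eqI[symmetric, OF bounded_linear.has_derivative[OF bounded_linear_vec_nth has_derivative_dir]])

lemma dir_inner:
  "F differentiable (at p) \<Longrightarrow> dir v (\<lambda>q. F q \<bullet> w) p = dir v F p \<bullet> w"
  by (rule dir_eqI[OF bounded_linear.has_derivative[OF bounded_linear_inner_left has_derivative_dir]])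

lemma differential_inner:
  "f differentiable (at x) \<Longrightarrow> differential f x \<bullet> v = dir v f x"
  by (simp add: dir_partials differential_def inner_vec_def mult.commute)

lemma ext_deriv_differential:
  assumes "open S" "smooth_on S f" "x \<in> S" "\<And>y. y \<in> S \<Longrightarrow> \<alpha> y = differential f y"
  shows "ext_deriv \<alpha> x = 0"
proof -
  have "partial i (\<lambda>y. \<alpha> y $ j) x = partial i (partial j f) x" for i j
    by (rule partial_cong_open[symmetric, OF assms(1,3)])
      (simp_all add: assms(4) differential_def smooth_on_differentiable[OF partial_smooth[OF assms(2)] assms(3)])
  then show ?thesis
    using partial_commute[OF assms(1-3)] by (simp add: ext_deriv_def vec_eq_iff)
qed

text \<open>The flow in one chart. To differentiate in time and space alike, all quantities become functions
  of a point of \<open>I\<close> times the chart image, with the leg as a separate argument.\<close>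

locale chart_flow =
  fixes A :: "'a::{t2_space,second_countable_topology} chart set" and I :: "real set"
    and \<beta> :: "real \<Rightarrow> 'a \<Rightarrow> real" and e :: "'a coframes" and \<kappa> :: "'a chart"
  assumes flow: "parallel_spinor_flow A I \<beta> e"
    and \<kappa>: "\<kappa> \<in> A" "is_chart \<kappa>"
    and I: "open I"
begin

abbreviation "U \<equiv> chart_image \<kappa>"
abbreviation "W \<equiv> I \<times> U"

definition B :: "real \<times> (real^3) \<Rightarrow> real" where "B p = \<beta> (fst p) (chart_inv \<kappa> (snd p))"
definition leg :: "leg \<Rightarrow> real \<times> (real^3) \<Rightarrow> real^3" where "leg a p = e (fst p) a \<kappa> (snd p)"
definition h :: "real \<times> (real^3) \<Rightarrow> real^3^3" where "h p = gram (\<lambda>a. leg a p)"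
definition E :: "leg \<Rightarrow> real \<times> (real^3) \<Rightarrow> real^3" where "E a p = frame (\<lambda>a. leg a p) a"
definition \<Theta> :: "real \<times> (real^3) \<Rightarrow> real^3^3" where "\<Theta> p = Theta \<beta> e (fst p) \<kappa> (snd p)"
definition \<theta> :: "leg \<Rightarrow> real \<times> (real^3) \<Rightarrow> real^3" where "\<theta> a p = contract2 (h p) (\<Theta> p) (leg a p)"
text \<open>The derivative \<open>d\<beta>(e\<^sub>a)\<close> of the lapse along the frame.\<close>

definition dB :: "leg \<Rightarrow> real \<times> (real^3) \<Rightarrow> real" where "dB a p = dir (0, E a p) B p"

lemma U: "open U" using \<kappa>(2) by (simp add: is_chart_def)
lemma W: "open W" using I U by (rule open_Times)

lemma flow_smooth: "smooth_function_family A I \<beta>" "smooth_coframe_family A I e"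
  using flow unfolding parallel_spinor_flow_def by blast+

lemma flow_equations:
  assumes "t \<in> I" "x \<in> U"
  shows "\<beta> t y > 0"
    and "vector_derivative (\<lambda>s. e s a \<kappa> x) (at t)
          + d_lapse_leg \<beta> e t a \<kappa> x *\<^sub>R e t Leg_u \<kappa> x
          + \<beta> t (chart_inv \<kappa> x) *\<^sub>R Theta_leg \<beta> e t a \<kappa> x
        = (if a = Leg_u then d_lapse \<beta> t \<kappa> x else 0)"
    and "ext_deriv (e t a \<kappa>) x = wedge (Theta_leg \<beta> e t a \<kappa> x) (e t Leg_u \<kappa> x)"
    and "vector_derivative (\<lambda>s. Theta_leg \<beta> e s Leg_u \<kappa> x) (at t)
          + differential (d_lapse_leg \<beta> e t Leg_u \<kappa>) x = 0"
    and "exact_form1 A (Theta_leg \<beta> e t Leg_u)"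
  using flow assms \<kappa>(1) unfolding parallel_spinor_flow_def by blast+

lemma smooth_leg: "smooth_on W (leg a)"
  using flow_smooth(2) \<kappa>(1) by (simp add: smooth_coframe_family_def leg_def[abs_def] case_prod_beta')

lemma smooth_B: "smooth_on W B"
  using flow_smooth(1) \<kappa>(1) by (simp add: smooth_function_family_def B_def[abs_def] case_prod_beta')

lemma B_pos: "p \<in> W \<Longrightarrow> B p > 0"
  using flow_equations(1) by (auto simp: B_def)

lemma coframe_leg: "p \<in> W \<Longrightarrow> coframe (\<lambda>a. leg a p)"
  using flow_smooth(2) \<kappa>(1) by (auto simp: smooth_coframe_family_def coframe_def leg_def)

lemma coframe_metric_h: "coframe_metric e t \<kappa> x = h (t, x)"
  by (simp add: coframe_metric_def h_def gram_def leg_def sum_leg)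

lemma smooth_E: "smooth_on W (E a)"
  unfolding E_def[abs_def] by (rule smooth_on_frame[OF W smooth_leg coframe_leg])

lemma smooth_h: "smooth_on W h"
  by (intro smooth_on_vecI W)
    (auto simp: h_def gram_eq intro!: smooth_on_sum smooth_on_mult smooth_on_vec_nth smooth_leg W)

lemma \<Theta>_eq: assumes "p \<in> W" shows "\<Theta> p = (- 1 / (2 * B p)) *\<^sub>R dir (1, 0) h p"
proof -
  obtain t x where p: "p = (t, x)" by fastforce
  have "h differentiable (at (t, x))" using smooth_on_differentiable[OF smooth_h] assms p by blast
  from vector_derivative_at[OF dir_time[OF this]] show ?thesis
    by (simp add: \<Theta>_def Theta_def coframe_metric_h B_def p)
qed

lemma smooth_\<Theta>: "smooth_on W \<Theta>"
proof (rule smooth_on_cong[OF W \<Theta>_eq[symmetric]])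
  have "smooth_on W (\<lambda>p. (- (1/2) * inverse (B p)) *\<^sub>R dir (1, 0) h p)"
    using B_pos by (intro smooth_on_scaleR smooth_on_mult smooth_on_const smooth_on_inverse smooth_B
        smooth_on_dir smooth_h W) force
  then show "smooth_on W (\<lambda>p. (- 1 / (2 * B p)) *\<^sub>R dir (1, 0) h p)" by (simp add: field_simps)
qed

lemma \<Theta>_sym: assumes "p \<in> W" shows "\<Theta> p $ i $ j = \<Theta> p $ j $ i"
proof -
  have d: "h differentiable (at p)" "(\<lambda>q. h q $ i) differentiable (at p)" for i
    using smooth_on_differentiable[OF smooth_h assms]
      smooth_on_differentiable[OF smooth_on_vec_nth[OF W smooth_h] assms] by blast+
  have "h q $ i $ j = h q $ j $ i" for q by (simp add: h_def gram_def mult.commute)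
  then have "dir (1, 0) h p $ i $ j = dir (1, 0) h p $ j $ i"
    by (simp add: dir_vec_nth d)
  then show ?thesis by (simp add: \<Theta>_eq assms)
qed

lemma \<theta>_eq: assumes "p \<in> W" shows "\<theta> a p = (\<chi> j. \<Sum>i\<in>UNIV. E a p $ i * \<Theta> p $ i $ j)"
  by (simp add: \<theta>_def contract2_def E_def h_def sharp_gram[OF coframe_leg[OF assms]])

lemma smooth_\<theta>: "smooth_on W (\<theta> a)"
proof (rule smooth_on_cong[OF W \<theta>_eq[symmetric]])
  show "smooth_on W (\<lambda>p. \<chi> j. \<Sum>i\<in>UNIV. E a p $ i * \<Theta> p $ i $ j)"
    by (rule smooth_on_vecI[OF W])
      (auto intro!: smooth_on_sum smooth_on_mult smooth_on_vec_nth smooth_E smooth_\<Theta> W)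
qed

lemma Theta_leg_eq: "Theta_leg \<beta> e t a \<kappa> x = \<theta> a (t, x)"
  by (simp add: Theta_leg_def \<theta>_def coframe_metric_h \<Theta>_def leg_def)

lemmas diff_leg = smooth_on_differentiable[OF smooth_leg]
lemmas diff_B = smooth_on_differentiable[OF smooth_B]
lemmas diff_\<theta> = smooth_on_differentiable[OF smooth_\<theta>]

lemma d_lapse_inner: assumes "(t, x) \<in> W" shows "d_lapse \<beta> t \<kappa> x \<bullet> v = dir (0, v) B (t, x)"
proof -
  have "smooth_on U (\<lambda>x. B (t, x))"
    using assms by (intro smooth_on_time_slice[OF U smooth_B]) auto
  moreover have "(\<lambda>x. B (t, x)) = \<beta> t \<circ> chart_inv \<kappa>" by (simp add: B_def fun_eq_iff)
  ultimately have "\<beta> t \<circ> chart_inv \<kappa> differentiable (at x)"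
    using assms by (metis smooth_on_differentiable mem_Sigma_iff)
  then show ?thesis
    using dir_space[OF diff_B[OF assms], of v] by (simp add: d_lapse_def differential_inner B_def comp_def)
qed

lemma d_lapse_leg_eq: assumes "(t, x) \<in> W" shows "d_lapse_leg \<beta> e t a \<kappa> x = dB a (t, x)"
proof -
  have "sharp (coframe_metric e t \<kappa> x) (e t a \<kappa> x) = E a (t, x)"
    using sharp_gram[OF coframe_leg[OF assms], of a]
    by (simp add: coframe_metric_h h_def E_def) (simp add: leg_def)
  then show ?thesis
    by (simp add: d_lapse_leg_def contract1_def d_lapse_inner[OF assms] dB_def)
qed

lemma smooth_dB: "smooth_on W (dB a)"
proof -
  have "smooth_on W (\<lambda>p. \<Sum>i\<in>UNIV. E a p $ i * dir (0, axis i 1) B p)"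
    by (intro smooth_on_sum smooth_on_mult smooth_on_vec_nth smooth_E smooth_on_dir smooth_B W finite)
  then show ?thesis
  proof (rule smooth_on_cong[OF W, rotated])
    fix p assume p: "p \<in> W"
    note L = dir_linear[OF diff_B[OF p]]
    have E: "(0, E a p) = (\<Sum>i\<in>UNIV. E a p $ i *\<^sub>R (0 :: real, axis i (1::real)))"
      by (simp add: sum_prod scaleR_prod_def scalar_mult_eq_scaleR[symmetric] basis_expansion)
    show "(\<Sum>i\<in>UNIV. E a p $ i * dir (0, axis i 1) B p) = dB a p"
      unfolding dB_def E by (simp only: linear_sum[OF L] linear_scale[OF L] real_scaleR_def)
  qed
qed

lemma time_leg:
  assumes p: "p \<in> W"
  shows "dir (1, 0) (leg a) p \<bullet> v = (if a = Leg_u then dir (0, v) B p else 0)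
     - dB a p * (leg Leg_u p \<bullet> v) - B p * (\<theta> a p \<bullet> v)"
proof -
  obtain t x where q: "p = (t, x)" by fastforce
  have tx: "t \<in> I" "x \<in> U" "(t, x) \<in> W" using p q by auto
  have "vector_derivative (\<lambda>s. e s a \<kappa> x) (at t) = dir (1, 0) (leg a) p"
    using vector_derivative_at[OF dir_time[OF diff_leg[OF tx(3), of a]]] by (simp add: leg_def q)
  moreover have "vector_derivative (\<lambda>s. e s a \<kappa> x) (at t)
          + d_lapse_leg \<beta> e t a \<kappa> x *\<^sub>R e t Leg_u \<kappa> x
          + \<beta> t (chart_inv \<kappa> x) *\<^sub>R Theta_leg \<beta> e t a \<kappa> x
        = (if a = Leg_u then d_lapse \<beta> t \<kappa> x else 0)"
    by (rule flow_equations(2)[OF tx(1,2)])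
  ultimately have "dir (1, 0) (leg a) p = (if a = Leg_u then d_lapse \<beta> t \<kappa> x else 0)
     - dB a p *\<^sub>R leg Leg_u p - B p *\<^sub>R \<theta> a p"
    by (simp add: d_lapse_leg_eq[OF tx(3)] Theta_leg_eq q leg_def B_def algebra_simps)
  then show ?thesis
    by (simp add: inner_diff_left d_lapse_inner[OF tx(3)] q)
qed

lemma space_ext_deriv:
  assumes sm: "smooth_on W \<alpha>" and p: "(t, x) \<in> W"
  shows "dir (0, v) \<alpha> (t, x) \<bullet> w - dir (0, w) \<alpha> (t, x) \<bullet> v =
    (\<Sum>i\<in>UNIV. \<Sum>j\<in>UNIV. v $ i * w $ j * ext_deriv (\<lambda>y. \<alpha> (t, y)) x $ i $ j)"
    and "dir (0, v) \<alpha> (t, x) \<bullet> w - dir (0, w) \<alpha> (t, x) \<bullet> v = ext1 (\<lambda>y v. \<alpha> (t, y) \<bullet> v) x v w"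
proof -
  have sl: "smooth_on U (\<lambda>y. \<alpha> (t, y))" using p by (intro smooth_on_time_slice[OF U sm]) auto
  have d: "(\<lambda>y. \<alpha> (t, y)) differentiable (at x)"
    using smooth_on_differentiable[OF sl] p by auto
  have dn: "(\<lambda>y. \<alpha> (t, y) $ j) differentiable (at x)" for j
    using smooth_on_differentiable[OF smooth_on_vec_nth[OF U sl]] p by auto
  show e: "dir (0, v) \<alpha> (t, x) \<bullet> w - dir (0, w) \<alpha> (t, x) \<bullet> v = ext1 (\<lambda>y v. \<alpha> (t, y) \<bullet> v) x v w" for v w
    unfolding ext1_def dir_inner[OF d]
    by (simp add: dir_space[OF smooth_on_differentiable[OF sm p]])
  show "dir (0, v) \<alpha> (t, x) \<bullet> w - dir (0, w) \<alpha> (t, x) \<bullet> v =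
    (\<Sum>i\<in>UNIV. \<Sum>j\<in>UNIV. v $ i * w $ j * ext_deriv (\<lambda>y. \<alpha> (t, y)) x $ i $ j)"
    unfolding e ext_deriv_def by (simp add: ext1_coord[OF dn])
qed

lemma ext_leg: "(t, x) \<in> W \<Longrightarrow> ext_deriv (\<lambda>y. leg a (t, y)) x = wedge (\<theta> a (t, x)) (leg Leg_u (t, x))"
  using flow_equations(3) by (simp add: leg_def Theta_leg_eq[symmetric])

lemma ext_\<theta>_u: assumes "(t, x) \<in> W" shows "ext_deriv (\<lambda>y. \<theta> Leg_u (t, y)) x = 0"
proof -
  have "exact_form1 A (Theta_leg \<beta> e t Leg_u)"
    using flow_equations(5) assms by blast
  then obtain f where "smooth_function A f"
    and f: "\<And>\<kappa> x. \<kappa> \<in> A \<Longrightarrow> x \<in> chart_image \<kappa> \<Longrightarrow> Theta_leg \<beta> e t Leg_u \<kappa> x = differential (f \<circ> chart_inv \<kappa>) x"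
    unfolding exact_form1_def by blast
  then have "smooth_on U (f \<circ> chart_inv \<kappa>)" using \<kappa>(1) by (simp add: smooth_function_def)
  then show ?thesis
    by (rule ext_deriv_differential[OF U]) (use assms f \<kappa>(1) in \<open>auto simp: Theta_leg_eq[symmetric]\<close>)
qed

lemma space_leg:
  assumes "p \<in> W"
  shows "dir (0, v) (leg a) p \<bullet> w - dir (0, w) (leg a) p \<bullet> v
    = (\<theta> a p \<bullet> v) * (leg Leg_u p \<bullet> w) - (\<theta> a p \<bullet> w) * (leg Leg_u p \<bullet> v)"
proof -
  obtain t x where p: "p = (t, x)" by fastforce
  show ?thesis unfolding p
    by (simp add: space_ext_deriv(1)[OF smooth_leg assms[unfolded p]] ext_leg[OF assms[unfolded p]])
      (simp add: wedge_def inner_vec_def sum_3 algebra_simps)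
qed

lemma space_\<theta>_u:
  assumes "p \<in> W" shows "dir (0, v) (\<theta> Leg_u) p \<bullet> w - dir (0, w) (\<theta> Leg_u) p \<bullet> v = 0"
proof -
  obtain t x where p: "p = (t, x)" by fastforce
  show ?thesis unfolding p
    by (simp add: space_ext_deriv(1)[OF smooth_\<theta> assms[unfolded p]] ext_\<theta>_u[OF assms[unfolded p]])
qed

lemma time_\<theta>_u:
  assumes p: "p \<in> W" shows "dir (1, 0) (\<theta> Leg_u) p \<bullet> v = - dir (0, v) (dB Leg_u) p"
proof -
  obtain t x where q: "p = (t, x)" by fastforce
  have tx: "t \<in> I" "x \<in> U" "(t, x) \<in> W" using p q by auto
  have "vector_derivative (\<lambda>s. Theta_leg \<beta> e s Leg_u \<kappa> x) (at t) = dir (1, 0) (\<theta> Leg_u) p"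
    using vector_derivative_at[OF dir_time[OF diff_\<theta>[OF tx(3)]]] by (simp add: Theta_leg_eq q)
  moreover have "vector_derivative (\<lambda>s. Theta_leg \<beta> e s Leg_u \<kappa> x) (at t)
          + differential (d_lapse_leg \<beta> e t Leg_u \<kappa>) x = 0"
    by (rule flow_equations(4)[OF tx(1,2)])
  ultimately have "dir (1, 0) (\<theta> Leg_u) p \<bullet> v = - (differential (d_lapse_leg \<beta> e t Leg_u \<kappa>) x \<bullet> v)"
    by (metis add_eq_0_iff2 inner_minus_left)
  moreover have "differential (d_lapse_leg \<beta> e t Leg_u \<kappa>) x \<bullet> v = dir (0, v) (dB Leg_u) p"
  proof -
    have d: "(\<lambda>y. dB Leg_u (t, y)) differentiable (at x)"
      using smooth_on_differentiable[OF smooth_on_time_slice[OF U smooth_dB tx(1)] tx(2)] .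
    have eq: "dB Leg_u (t, y) = d_lapse_leg \<beta> e t Leg_u \<kappa> y" if "y \<in> U" for y
      using d_lapse_leg_eq tx(1) that by simp
    have "dir v (d_lapse_leg \<beta> e t Leg_u \<kappa>) x = dir v (\<lambda>y. dB Leg_u (t, y)) x"
      by (rule dir_cong_open[symmetric, OF U tx(2) eq d])
    moreover have "d_lapse_leg \<beta> e t Leg_u \<kappa> differentiable (at x)"
      by (rule differentiable_cong_open[OF U tx(2) eq d])
    ultimately show ?thesis
      using dir_space[OF smooth_on_differentiable[OF smooth_dB tx(3)]] by (simp add: differential_inner q)
  qed
  ultimately show ?thesis by simp
qed

lemma slice:
  assumes t: "t \<in> I"
  shows "spinor_slice U (\<lambda>a x. leg a (t, x)) (\<lambda>x. \<Theta> (t, x))"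
proof
  show "open U" by (rule U)
  show "smooth_on U (\<lambda>x. leg a (t, x))" for a by (rule smooth_on_time_slice[OF U smooth_leg t])
  show "smooth_on U (\<lambda>x. \<Theta> (t, x) $ i $ j)" for i j
    by (rule smooth_on_time_slice[OF U _ t]) (intro smooth_on_vec_nth smooth_\<Theta> W)
qed (use t in \<open>auto simp: coframe_leg \<Theta>_sym ext_leg ext_\<theta>_u \<theta>_def h_def
      intro: ext_leg[unfolded \<theta>_def h_def] ext_\<theta>_u[unfolded \<theta>_def h_def]\<close>)

end

section \<open>Structure equations on spacetime\<close>

context chart_flow
begin

definition T :: "leg \<Rightarrow> leg \<Rightarrow> real \<times> (real^3) \<Rightarrow> real" where "T a b p = \<theta> a p \<bullet> E b p"

text \<open>In terms of \<open>e\<^sub>0 = \<beta> dt\<close>: \<open>\<epsilon>\<close> is \<open>e\<^sub>0\<close>, \<open>\<upsilon>\<close> is \<open>e\<^sub>0 + e\<^sub>u\<close>, the connection form of \<open>a\<close> is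
  \<open>\<Theta>(e\<^sub>a) - d\<beta>(e\<^sub>a) dt\<close>, and \<open>k\<close> is the null vector field on which \<open>\<upsilon>\<close> vanishes.\<close>

definition \<upsilon> :: "real \<times> (real^3) \<Rightarrow> real \<times> (real^3) \<Rightarrow> real" where
  "\<upsilon> p w = B p * fst w + leg Leg_u p \<bullet> snd w"
definition \<epsilon> :: "real \<times> (real^3) \<Rightarrow> real \<times> (real^3) \<Rightarrow> real" where
  "\<epsilon> p w = B p * fst w"
definition leg_form :: "leg \<Rightarrow> real \<times> (real^3) \<Rightarrow> real \<times> (real^3) \<Rightarrow> real" where
  "leg_form a p w = leg a p \<bullet> snd w"
definition connection_form :: "leg \<Rightarrow> real \<times> (real^3) \<Rightarrow> real \<times> (real^3) \<Rightarrow> real" where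
  "connection_form a p w = \<theta> a p \<bullet> snd w - dB a p * fst w"
definition k :: "real \<times> (real^3) \<Rightarrow> real \<times> (real^3)" where
  "k p = (1 / B p, - E Leg_u p)"

lemma leg_E: "p \<in> W \<Longrightarrow> leg b p \<bullet> E a p = (if a = b then 1 else 0)"
  unfolding E_def by (rule frame_dual[OF coframe_leg])

lemma E_expand: "p \<in> W \<Longrightarrow> v = (\<Sum>a\<in>UNIV. (leg a p \<bullet> v) *\<^sub>R E a p)"
  unfolding E_def by (rule frame_expand[OF coframe_leg])

lemma ext1_form:
  assumes p: "p \<in> W" and sm: "smooth_on W f" "smooth_on W \<alpha>"
  shows "ext1 (\<lambda>q w. f q * fst w + \<alpha> q \<bullet> snd w) p v w =
      fst v * (dir (1, 0) \<alpha> p \<bullet> snd w) - fst w * (dir (1, 0) \<alpha> p \<bullet> snd v)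
      + (dir (0, snd v) \<alpha> p \<bullet> snd w - dir (0, snd w) \<alpha> p \<bullet> snd v)
      + (dir (0, snd v) f p * fst w - dir (0, snd w) f p * fst v)"
proof -
  have d: "f differentiable (at p)" "\<alpha> differentiable (at p)"
    "(\<lambda>q. \<alpha> q \<bullet> w) differentiable (at p)" for w
    using smooth_on_differentiable[OF sm(1) p] smooth_on_differentiable[OF sm(2) p]
      smooth_on_differentiable[OF smooth_on_inner[OF W sm(2) smooth_on_const] p] by blast+
  have D: "dir v (\<lambda>q. f q * fst w + \<alpha> q \<bullet> snd w) p = dir v f p * fst w + dir v \<alpha> p \<bullet> snd w" for v w
    by (simp add: dir_add dir_mult d dir_inner differentiable_mult)
  show ?thesis
    unfolding ext1_def D
    unfolding dir_split[OF d(1), of v] dir_split[OF d(2), of v]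
      dir_split[OF d(1), of w] dir_split[OF d(2), of w]
    by (simp add: inner_add_left algebra_simps)
qed

lemma \<theta>_leg_sym:
  assumes p: "p \<in> W"
  shows "(\<Sum>a\<in>UNIV. (\<theta> a p \<bullet> v) * (leg a p \<bullet> w)) = (\<Sum>a\<in>UNIV. (\<theta> a p \<bullet> w) * (leg a p \<bullet> v))"
proof -
  obtain t x where q: "p = (t, x)" by fastforce
  interpret S: spinor_slice U "\<lambda>a x. leg a (t, x)" "\<lambda>x. \<Theta> (t, x)"
      "\<lambda>x. h (t, x)" "\<lambda>a x. E a (t, x)" "\<lambda>a x. \<theta> a (t, x)"
    by (rule slice) (use p q in \<open>auto simp: h_def E_def \<theta>_def\<close>)
  have \<Theta>: "\<Theta> p $ i $ j = (\<Sum>a\<in>UNIV. \<theta> a p $ i * leg a p $ j)" for i j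
    using S.\<Theta>_expand[of x] p by (simp add: q)
  have "(\<Sum>a\<in>UNIV. (\<theta> a p \<bullet> v) * (leg a p \<bullet> w)) = (\<Sum>i\<in>UNIV. \<Sum>j\<in>UNIV. v $ i * w $ j * \<Theta> p $ i $ j)" for v w
    unfolding \<Theta> by (simp add: inner_vec_def sum_leg sum_3 algebra_simps)
  then show ?thesis using \<Theta>_sym[OF p] by (simp add: sum_3 algebra_simps)
qed

lemma dir_B_expand:
  assumes p: "p \<in> W" shows "dir (0, v) B p = (\<Sum>a\<in>UNIV. dB a p * (leg a p \<bullet> v))"
proof -
  note L = dir_linear[OF diff_B[OF p]]
  have v: "(0 :: real, v) = (\<Sum>a\<in>UNIV. (leg a p \<bullet> v) *\<^sub>R (0, E a p))"
    using E_expand[OF p, of v] by (simp add: sum_leg)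
  show ?thesis
    unfolding dB_def by (subst v) (simp only: linear_sum[OF L] linear_scale[OF L] real_scaleR_def mult.commute)
qed

text \<open>The evolution equation of the coframe and its spatial structure equation combine to the equations
  for \<open>\<upsilon>\<close> and the legs. The equation for \<open>\<epsilon>\<close> is \<open>d\<epsilon> = d\<beta> \<and> dt\<close> together with the symmetry of \<open>\<Theta>\<close>. That the
  connection form of \<open>u\<close> is closed is the exactness of \<open>\<Theta>(e\<^sub>u)\<close> on the slices and its evolution
  equation.\<close>

lemma null_structure:
  "null_structure W \<upsilon> \<epsilon> (leg_form Leg_l) (leg_form Leg_n) (connection_form Leg_u) (connection_form Leg_l) (connection_form Leg_n)
     k (\<lambda>p. (0, E Leg_u p)) (\<lambda>p. (0, E Leg_l p)) (\<lambda>p. (0, E Leg_n p))"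
proof (rule null_structure.intro)
  have z: "smooth_on W (\<lambda>p. 0 :: real)" "smooth_on W (\<lambda>p. 0 :: real^3)" by (rule smooth_on_const)+
  have m: "smooth_on W (\<lambda>p. - dB a p)" for a by (rule smooth_on_minus[OF W smooth_dB])
  have f\<upsilon>: "\<upsilon> = (\<lambda>q w. B q * fst w + leg Leg_u q \<bullet> snd w)" by (simp add: fun_eq_iff \<upsilon>_def)
  have f\<epsilon>: "\<epsilon> = (\<lambda>q w. B q * fst w + 0 \<bullet> snd w)" by (simp add: fun_eq_iff \<epsilon>_def)
  have f\<mu>: "leg_form a = (\<lambda>q w. 0 * fst w + leg a q \<bullet> snd w)" for a by (simp add: fun_eq_iff leg_form_def)
  have f\<kappa>: "connection_form a = (\<lambda>q w. (- dB a q) * fst w + \<theta> a q \<bullet> snd w)" for a by (simp add: fun_eq_iff connection_form_def)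
  have sm: "smooth_on W (\<lambda>q. f q * fst v + \<alpha> q \<bullet> snd v)"
    if "smooth_on W f" "smooth_on W \<alpha>" for f :: "_ \<Rightarrow> real" and \<alpha> and v :: "real \<times> (real^3)"
    by (intro smooth_on_add smooth_on_mult smooth_on_inner that smooth_on_const W)
  show "open W" by (rule W)
  show "smooth_on W (\<lambda>q. \<upsilon> q v)" for v unfolding f\<upsilon> by (rule sm[OF smooth_B smooth_leg])
  show "smooth_on W (\<lambda>q. \<epsilon> q v)" for v unfolding f\<epsilon> by (rule sm[OF smooth_B z(2)])
  show "smooth_on W (\<lambda>q. leg_form Leg_l q v)" "smooth_on W (\<lambda>q. leg_form Leg_n q v)" for v
    unfolding f\<mu> by (rule sm[OF z(1) smooth_leg])+
  show "smooth_on W (\<lambda>q. connection_form Leg_u q v)" "smooth_on W (\<lambda>q. connection_form Leg_l q v)"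
    "smooth_on W (\<lambda>q. connection_form Leg_n q v)" for v
    unfolding f\<kappa> by (rule sm[OF m smooth_\<theta>])+
  show "smooth_on W (\<lambda>p. (0, E Leg_u p))" "smooth_on W (\<lambda>p. (0, E Leg_l p))" "smooth_on W (\<lambda>p. (0, E Leg_n p))"
    by (rule smooth_on_Pair[OF W smooth_on_const smooth_E])+
  show "linear (connection_form Leg_u q)" "linear (connection_form Leg_l q)" "linear (connection_form Leg_n q)" for q
    by (simp_all add: linear_iff connection_form_def inner_add_right algebra_simps)
  fix q assume q: "q \<in> W"
  have d\<mu>: "ext1 (leg_form a) q v w = wedge11 (connection_form a q) (\<upsilon> q) v w" if "a \<noteq> Leg_u" for a v w
    unfolding f\<mu> ext1_form[OF q z(1) smooth_leg]
    using that by (simp add: time_leg[OF q] space_leg[OF q] wedge11_def connection_form_def \<upsilon>_def algebra_simps)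
  show "ext1 (leg_form Leg_l) q v w = wedge11 (connection_form Leg_l q) (\<upsilon> q) v w"
    "ext1 (leg_form Leg_n) q v w = wedge11 (connection_form Leg_n q) (\<upsilon> q) v w" for v w
    by (simp_all add: d\<mu>)
  show "ext1 \<upsilon> q v w = wedge11 (connection_form Leg_u q) (\<upsilon> q) v w" for v w
    unfolding f\<upsilon> ext1_form[OF q smooth_B smooth_leg]
    by (simp add: time_leg[OF q] space_leg[OF q] wedge11_def connection_form_def \<upsilon>_def algebra_simps)
  show "ext1 \<epsilon> q v w = wedge11 (connection_form Leg_u q) (\<upsilon> q) v w - wedge11 (connection_form Leg_u q) (\<epsilon> q) v w
      + wedge11 (connection_form Leg_l q) (leg_form Leg_l q) v w + wedge11 (connection_form Leg_n q) (leg_form Leg_n q) v w" for v w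
    unfolding f\<epsilon> ext1_form[OF q smooth_B z(2)]
    using \<theta>_leg_sym[OF q, of "snd v" "snd w"]
    by (simp add: dir_B_expand[OF q] wedge11_def connection_form_def leg_form_def \<epsilon>_def \<upsilon>_def sum_leg algebra_simps)
  show "ext1 (connection_form Leg_u) q v w = 0" for v w
  proof -
    have "dir (0, v) (\<lambda>p. - dB Leg_u p) q = - dir (0, v) (dB Leg_u) q" for v
      by (rule dir_eqI[OF has_derivative_minus[OF has_derivative_dir[OF smooth_on_differentiable[OF smooth_dB q]]]])
    then show ?thesis
      unfolding f\<kappa> ext1_form[OF q m smooth_\<theta>]
      by (simp add: time_\<theta>_u[OF q] space_\<theta>_u[OF q] algebra_simps)
  qed
  have B: "B q \<noteq> 0" using B_pos[OF q] by simp
  show "v = \<epsilon> q v *\<^sub>R k q + \<upsilon> q v *\<^sub>R (0, E Leg_u q) + leg_form Leg_l q v *\<^sub>R (0, E Leg_l q)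
      + leg_form Leg_n q v *\<^sub>R (0, E Leg_n q)" for v
  proof (rule prod_eqI)
    show "snd v = snd (\<epsilon> q v *\<^sub>R k q + \<upsilon> q v *\<^sub>R (0, E Leg_u q) + leg_form Leg_l q v *\<^sub>R (0, E Leg_l q)
      + leg_form Leg_n q v *\<^sub>R (0, E Leg_n q))"
      by (subst E_expand[OF q, of "snd v"]) (simp add: k_def \<epsilon>_def \<upsilon>_def leg_form_def sum_leg algebra_simps)
  qed (use B in \<open>simp add: k_def \<epsilon>_def\<close>)
  show "\<upsilon> q (k q) = 0" "leg_form Leg_l q (k q) = 0" "leg_form Leg_n q (k q) = 0"
    "\<upsilon> q (0, E Leg_u q) = 1" "leg_form Leg_l q (0, E Leg_u q) = 0" "leg_form Leg_n q (0, E Leg_u q) = 0"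
    "\<upsilon> q (0, E Leg_l q) = 0" "leg_form Leg_l q (0, E Leg_l q) = 1" "leg_form Leg_n q (0, E Leg_l q) = 0"
    "\<upsilon> q (0, E Leg_n q) = 0" "leg_form Leg_l q (0, E Leg_n q) = 0" "leg_form Leg_n q (0, E Leg_n q) = 1"
    using B by (simp_all add: \<upsilon>_def leg_form_def k_def leg_E[OF q])
qed

interpretation L: null_structure W \<upsilon> \<epsilon> "leg_form Leg_l" "leg_form Leg_n" "connection_form Leg_u" "connection_form Leg_l" "connection_form Leg_n"
     k "\<lambda>p. (0, E Leg_u p)" "\<lambda>p. (0, E Leg_l p)" "\<lambda>p. (0, E Leg_n p)"
  by (rule null_structure)

interpretation N: null_structure W \<upsilon> \<epsilon> "leg_form Leg_n" "leg_form Leg_l" "connection_form Leg_u" "connection_form Leg_n" "connection_form Leg_l"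
     k "\<lambda>p. (0, E Leg_u p)" "\<lambda>p. (0, E Leg_n p)" "\<lambda>p. (0, E Leg_l p)"
  by (rule L.swap)

text \<open>Up to sign, the factor of \<open>\<upsilon> \<otimes> \<upsilon>\<close> in the Ricci tensor of spacetime.\<close>

definition defect :: "real \<times> (real^3) \<Rightarrow> real" where
  "defect p = L.coeff p + N.coeff p"

lemma ext1_connection_form_space:
  assumes p: "p \<in> W"
  shows "ext1 (connection_form a) p (0, v) (0, w) = dir (0, v) (\<theta> a) p \<bullet> w - dir (0, w) (\<theta> a) p \<bullet> v"
proof -
  have "connection_form a = (\<lambda>q w. (- dB a q) * fst w + \<theta> a q \<bullet> snd w)" by (simp add: fun_eq_iff connection_form_def)
  then show ?thesis
    by (simp only: ext1_form[OF p smooth_on_minus[OF W smooth_dB] smooth_\<theta>]) simp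
qed

lemma coeff_eq:
  assumes p: "p \<in> W"
  shows "L.coeff p = (dir (0, E Leg_l p) (\<theta> Leg_l) p \<bullet> E Leg_u p - dir (0, E Leg_u p) (\<theta> Leg_l) p \<bullet> E Leg_l p)
      - (T Leg_l Leg_l p * T Leg_u Leg_u p - T Leg_l Leg_u p * T Leg_u Leg_l p)"
    and "N.coeff p = (dir (0, E Leg_n p) (\<theta> Leg_n) p \<bullet> E Leg_u p - dir (0, E Leg_u p) (\<theta> Leg_n) p \<bullet> E Leg_n p)
      - (T Leg_n Leg_n p * T Leg_u Leg_u p - T Leg_n Leg_u p * T Leg_u Leg_n p)"
  unfolding L.coeff_def L.curv\<^sub>l_def N.coeff_def N.curv\<^sub>l_def ext1_connection_form_space[OF p] wedge11_def
  by (simp_all add: connection_form_def T_def)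

lemma slice_constraints:
  assumes "(t, x) \<in> W"
  shows "scalar_curvature (coframe_metric e t \<kappa>) x =
          metric_norm_sq (coframe_metric e t \<kappa> x) (Theta \<beta> e t \<kappa> x)
          - (metric_trace (coframe_metric e t \<kappa> x) (Theta \<beta> e t \<kappa> x))\<^sup>2 \<longleftrightarrow> defect (t, x) = 0"
      (is "?H \<longleftrightarrow> _")
    and "defect (t, x) = 0 \<Longrightarrow>
      differential (\<lambda>y. metric_trace (coframe_metric e t \<kappa> y) (Theta \<beta> e t \<kappa> y)) x =
          divergence2 (coframe_metric e t \<kappa>) (Theta \<beta> e t \<kappa>) x"
proof -
  interpret S: spinor_slice U "\<lambda>a x. leg a (t, x)" "\<lambda>x. \<Theta> (t, x)"
      "\<lambda>x. h (t, x)" "\<lambda>a x. E a (t, x)" "\<lambda>a x. \<theta> a (t, x)"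
    by (rule slice) (use assms in \<open>auto simp: h_def E_def \<theta>_def\<close>)
  have defect: "S.curvature_defect x = defect (t, x)"
    unfolding defect_def coeff_eq[OF assms] S.curvature_defect_def S.D\<theta>_def S.T_def
    unfolding space_ext_deriv(2)[OF smooth_\<theta> assms] T_def by simp
  have x: "x \<in> U" using assms by simp
  have eqs: "coframe_metric e t \<kappa> = (\<lambda>x. h (t, x))" "Theta \<beta> e t \<kappa> = (\<lambda>x. \<Theta> (t, x))"
    by (simp_all add: fun_eq_iff coframe_metric_h \<Theta>_def)
  show "?H \<longleftrightarrow> defect (t, x) = 0"
    unfolding eqs using S.hamiltonian_iff[OF x] defect by simp
  show "differential (\<lambda>y. metric_trace (coframe_metric e t \<kappa> y) (Theta \<beta> e t \<kappa> y)) x =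
          divergence2 (coframe_metric e t \<kappa>) (Theta \<beta> e t \<kappa>) x" if "defect (t, x) = 0"
    unfolding eqs using S.momentum[OF x] defect that by simp
qed

lemma smooth_defect: "smooth_on W defect"
  unfolding defect_def[abs_def] L.coeff_def N.coeff_def
  by (intro smooth_on_add L.smooth_on_curv\<^sub>l_fields N.smooth_on_curv\<^sub>l_fields L.smooth_frame W)

text \<open>This is \<open>- 2 \<beta> \<kappa>\<^sub>u(k)\<close> with \<open>\<kappa>\<^sub>u\<close> the connection form of \<open>u\<close>.\<close>

definition growth :: "real \<times> (real^3) \<Rightarrow> real" where
  "growth p = 2 * (B p * T Leg_u Leg_u p + dB Leg_u p)"

lemma smooth_T: "smooth_on W (T a b)"
  unfolding T_def[abs_def] by (intro smooth_on_inner smooth_\<theta> smooth_E W)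

lemma smooth_growth: "smooth_on W growth"
  unfolding growth_def[abs_def]
  by (intro smooth_on_mult smooth_on_add smooth_on_const smooth_B smooth_T smooth_dB W)

text \<open>The direction is \<open>\<beta> k\<close>, normalised to have time component one.\<close>

lemma defect_transport:
  assumes p: "p \<in> W"
  shows "dir (1, - B p *\<^sub>R E Leg_u p) defect p = growth p * defect p"
proof -
  have B: "B p \<noteq> 0" using B_pos[OF p] by simp
  have d: "L.coeff differentiable (at p)" "N.coeff differentiable (at p)"
    unfolding L.coeff_def[abs_def] N.coeff_def[abs_def]
    by (intro smooth_on_differentiable[OF L.smooth_on_curv\<^sub>l_fields p] smooth_on_differentiable[OF N.smooth_on_curv\<^sub>l_fields p] L.smooth_frame)+
  have "defect = (\<lambda>q. L.coeff q + N.coeff q)" by (simp add: fun_eq_iff defect_def)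
  then have k: "dir (k p) defect p = - 2 * connection_form Leg_u p (k p) * defect p"
    by (simp add: dir_add d L.transport[OF p] N.transport[OF p] algebra_simps)
  have "(1, - B p *\<^sub>R E Leg_u p) = B p *\<^sub>R k p" using B by (simp add: k_def)
  then have "dir (1, - B p *\<^sub>R E Leg_u p) defect p = B p * dir (k p) defect p"
    using linear_scale[OF dir_linear[OF smooth_on_differentiable[OF smooth_defect p]]] by simp
  also have "\<dots> = growth p * defect p"
    unfolding k using B by (simp add: connection_form_def k_def growth_def T_def field_simps)
  finally show ?thesis .
qed

text \<open>With \<open>\<theta>\<^sub>a = \<Sum>\<^sub>c T\<^sub>a\<^sub>c e\<^sub>c\<close>, only derivatives of scalar functions along the frame remain, besides
  the structure equations. In this form the defect can be compared between charts.\<close>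

lemma dir_\<theta>:
  assumes p: "p \<in> W"
  shows "dir (0, v) (\<theta> a) p \<bullet> w - dir (0, w) (\<theta> a) p \<bullet> v =
    (\<Sum>c\<in>UNIV. dir (0, v) (T a c) p * (leg c p \<bullet> w) - dir (0, w) (T a c) p * (leg c p \<bullet> v)
      + T a c p * ((\<theta> c p \<bullet> v) * (leg Leg_u p \<bullet> w) - (\<theta> c p \<bullet> w) * (leg Leg_u p \<bullet> v)))"
proof -
  have D: "dir v (\<theta> a) p \<bullet> w = (\<Sum>c\<in>UNIV. dir v (T a c) p * (leg c p \<bullet> w) + T a c p * (dir v (leg c) p \<bullet> w))" for v w
  proof -
    have dT: "T a c differentiable (at p)" "(\<lambda>q. leg c q \<bullet> w) differentiable (at p)" for c
      using smooth_on_differentiable[OF smooth_T p]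
        smooth_on_differentiable[OF smooth_on_inner[OF W smooth_leg smooth_on_const] p] by blast+
    have "dir v (\<theta> a) p \<bullet> w = dir v (\<lambda>q. \<theta> a q \<bullet> w) p" by (rule dir_inner[symmetric, OF diff_\<theta>[OF p]])
    also have "\<dots> = dir v (\<lambda>q. T a Leg_u q * (leg Leg_u q \<bullet> w) + T a Leg_l q * (leg Leg_l q \<bullet> w) + T a Leg_n q * (leg Leg_n q \<bullet> w)) p"
    proof (rule dir_cong_open[OF W p])
      fix q assume q: "q \<in> W"
      show "\<theta> a q \<bullet> w = T a Leg_u q * (leg Leg_u q \<bullet> w) + T a Leg_l q * (leg Leg_l q \<bullet> w) + T a Leg_n q * (leg Leg_n q \<bullet> w)"
        by (subst E_expand[OF q, of w]) (simp add: sum_leg T_def inner_add_right)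
    qed (rule smooth_on_differentiable[OF smooth_on_inner[OF W smooth_\<theta> smooth_on_const] p])
    also have "\<dots> = (\<Sum>c\<in>UNIV. dir v (T a c) p * (leg c p \<bullet> w) + T a c p * (dir v (leg c) p \<bullet> w))"
      by (simp add: dir_add dir_mult dT differentiable_mult differentiable_add dir_inner diff_leg[OF p] sum_leg)
    finally show ?thesis .
  qed
  show ?thesis
    unfolding D space_leg[OF p, symmetric] by (simp add: sum_leg algebra_simps)
qed

lemma defect_scalar:
  assumes p: "p \<in> W"
  shows "defect p = (\<Sum>c\<in>{Leg_l, Leg_n}. dir (0, E c p) (T c Leg_u) p - dir (0, E Leg_u p) (T c c) p
      + (\<Sum>a\<in>UNIV. T c a p * T a c p) - (T c c p * T Leg_u Leg_u p - T c Leg_u p * T Leg_u c p))"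
  unfolding defect_def coeff_eq[OF p] dir_\<theta>[OF p]
  by (simp add: leg_E[OF p] sum_leg T_def)

end

section \<open>Change of chart\<close>

lemma chart_facts:
  assumes "is_chart \<kappa>"
  shows "open (fst \<kappa>)" "open (chart_image \<kappa>)"
    and "p \<in> fst \<kappa> \<Longrightarrow> chart_inv \<kappa> (snd \<kappa> p) = p"
    and "p \<in> fst \<kappa> \<Longrightarrow> snd \<kappa> p \<in> chart_image \<kappa>"
    and "x \<in> chart_image \<kappa> \<Longrightarrow> snd \<kappa> (chart_inv \<kappa> x) = x"
    and "x \<in> chart_image \<kappa> \<Longrightarrow> chart_inv \<kappa> x \<in> fst \<kappa>"
    and "continuous_on (fst \<kappa>) (snd \<kappa>)" "continuous_on (chart_image \<kappa>) (chart_inv \<kappa>)"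
  using assms unfolding is_chart_def homeomorphism_def by auto

lemma overlap_eq:
  assumes "is_chart \<kappa>"
  shows "snd \<kappa> ` (fst \<kappa> \<inter> S) = {x \<in> chart_image \<kappa>. chart_inv \<kappa> x \<in> S}"
  using chart_facts(3-6)[OF assms] by force

lemma open_overlap:
  assumes "is_chart \<kappa>" "open S" shows "open (snd \<kappa> ` (fst \<kappa> \<inter> S))"
  unfolding overlap_eq[OF assms(1)]
  using continuous_open_preimage[OF chart_facts(8)[OF assms(1)] chart_facts(2)[OF assms(1)] assms(2)]
  by (simp add: vimage_def Int_def)

locale two_charts = K: chart_flow A I \<beta> e \<kappa> + K': chart_flow A I \<beta> e \<kappa>'
  for A :: "'a::{t2_space,second_countable_topology} chart set" and I \<beta> e \<kappa> \<kappa>' +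
  assumes atlas: "smooth_atlas A"
begin

definition overlap :: "(real^3) set" where "overlap = snd \<kappa> ` (fst \<kappa> \<inter> fst \<kappa>')"
definition \<phi> :: "real^3 \<Rightarrow> real^3" where "\<phi> = transition \<kappa> \<kappa>'"

lemma overlap_open: "open overlap"
  unfolding overlap_def by (rule open_overlap[OF K.\<kappa>(2) chart_facts(1)[OF K'.\<kappa>(2)]])

lemma smooth_\<phi>: "smooth_on overlap \<phi>"
  using atlas K.\<kappa>(1) K'.\<kappa>(1) by (simp add: smooth_atlas_def overlap_def \<phi>_def)

lemma overlap_subset: "x \<in> overlap \<Longrightarrow> x \<in> K.U"
  by (auto simp: overlap_def overlap_eq[OF K.\<kappa>(2)])

lemma \<phi>_image: "x \<in> overlap \<Longrightarrow> \<phi> x \<in> K'.U"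
  by (auto simp: overlap_def overlap_eq[OF K.\<kappa>(2)] \<phi>_def transition_def chart_facts(4)[OF K'.\<kappa>(2)])

lemma chart_inv_\<phi>: "x \<in> overlap \<Longrightarrow> chart_inv \<kappa>' (\<phi> x) = chart_inv \<kappa> x"
  by (auto simp: overlap_def overlap_eq[OF K.\<kappa>(2)] \<phi>_def transition_def chart_facts(3)[OF K'.\<kappa>(2)])

context
  fixes t x
  assumes t: "t \<in> I" and x: "x \<in> overlap"
begin

lemma in_W: "(t, x) \<in> K.W" "(t, \<phi> x) \<in> K'.W"
  using t x overlap_subset \<phi>_image by auto

lemma B_\<phi>: "K'.B (t, \<phi> x) = K.B (t, x)"
  by (simp add: K.B_def K'.B_def chart_inv_\<phi>[OF x])

lemma leg_\<phi>: "s \<in> I \<Longrightarrow> K.leg a (s, x) \<bullet> v = K'.leg a (s, \<phi> x) \<bullet> dir v \<phi> x"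
  using K.flow_smooth(2) K.\<kappa>(1) K'.\<kappa>(1) x
  unfolding smooth_coframe_family_def is_form1_def overlap_def \<phi>_def K.leg_def K'.leg_def fst_conv snd_conv by blast

lemma E_\<phi>: "dir (K.E a (t, x)) \<phi> x = K'.E a (t, \<phi> x)"
  unfolding K'.E_def
  by (rule frame_eqI[OF K'.coframe_leg[OF in_W(2)]])
    (use leg_\<phi>[OF t, of _ "K.E a (t, x)"] K.leg_E[OF in_W(1)] in auto)

lemma dir_\<phi>:
  assumes F: "F differentiable (at (t, \<phi> x))" and G: "G differentiable (at (t, x))"
    and eq: "\<And>y. y \<in> overlap \<Longrightarrow> G (t, y) = F (t, \<phi> y)"
  shows "dir (0, v) G (t, x) = dir (0, dir v \<phi> x) F (t, \<phi> x)"
proof -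
  have "((\<lambda>y. (t, \<phi> y)) has_derivative (\<lambda>v. (0, dir v \<phi> x))) (at x)"
    by (intro has_derivative_Pair has_derivative_const smooth_on_has_derivative[OF smooth_\<phi> x])
  from has_derivative_compose[OF this has_derivative_dir[OF F]]
  have "((\<lambda>y. F (t, \<phi> y)) has_derivative (\<lambda>v. dir (0, dir v \<phi> x) F (t, \<phi> x))) (at x)" .
  then have "((\<lambda>y. G (t, y)) has_derivative (\<lambda>v. dir (0, dir v \<phi> x) F (t, \<phi> x))) (at x)"
    by (rule has_derivative_transform_within_open[OF _ overlap_open x]) (simp add: eq)
  from dir_eqI[OF this] dir_space[OF G] show ?thesis by metis
qed

lemma dB_\<phi>: "K'.dB a (t, \<phi> x) = K.dB a (t, x)"
proof -
  have "K.B (t, y) = K'.B (t, \<phi> y)" if "y \<in> overlap" for y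
    by (simp add: K.B_def K'.B_def chart_inv_\<phi>[OF that])
  from dir_\<phi>[OF K'.diff_B[OF in_W(2)] K.diff_B[OF in_W(1)] this, of "K.E a (t, x)"]
  show ?thesis by (simp add: K.dB_def K'.dB_def E_\<phi>)
qed

text \<open>The evolution equation of the coframe expresses \<open>\<Theta>\<close> through the time derivative of the coframe,
  evaluated on a vector; as the transition map does not depend on time, this is the same number in
  both charts.\<close>

lemma T_\<phi>: "K'.T a b (t, \<phi> x) = K.T a b (t, x)"
proof -
  let ?v = "K.E b (t, x)" and ?v' = "K'.E b (t, \<phi> x)"
  have "((\<lambda>s. K'.leg a (s, \<phi> x) \<bullet> ?v') has_vector_derivative (dir (1, 0) (K'.leg a) (t, \<phi> x) \<bullet> ?v')) (at t)"
    by (rule bounded_linear.has_vector_derivative[OF bounded_linear_inner_left dir_time[OF K'.diff_leg[OF in_W(2)]]])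
  then have "((\<lambda>s. K.leg a (s, x) \<bullet> ?v) has_vector_derivative (dir (1, 0) (K'.leg a) (t, \<phi> x) \<bullet> ?v')) (at t)"
    by (rule has_vector_derivative_transform_within_open[OF _ K.I t]) (simp add: leg_\<phi> E_\<phi>)
  moreover have "((\<lambda>s. K.leg a (s, x) \<bullet> ?v) has_vector_derivative (dir (1, 0) (K.leg a) (t, x) \<bullet> ?v)) (at t)"
    by (rule bounded_linear.has_vector_derivative[OF bounded_linear_inner_left dir_time[OF K.diff_leg[OF in_W(1)]]])
  ultimately have "dir (1, 0) (K'.leg a) (t, \<phi> x) \<bullet> ?v' = dir (1, 0) (K.leg a) (t, x) \<bullet> ?v"
    by (rule vector_derivative_unique_at)
  then have "K.B (t, x) * (K'.\<theta> a (t, \<phi> x) \<bullet> ?v') = K.B (t, x) * (K.\<theta> a (t, x) \<bullet> ?v)"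
    unfolding K.time_leg[OF in_W(1)] K'.time_leg[OF in_W(2)] B_\<phi> dB_\<phi>
      K.leg_E[OF in_W(1)] K'.leg_E[OF in_W(2)] K.dB_def[symmetric] K'.dB_def[symmetric]
    by simp
  then show ?thesis using K.B_pos[OF in_W(1)] by (simp add: K.T_def K'.T_def)
qed

end

lemma dir_T_\<phi>:
  assumes "t \<in> I" "x \<in> overlap"
  shows "dir (0, K'.E c (t, \<phi> x)) (K'.T a b) (t, \<phi> x) = dir (0, K.E c (t, x)) (K.T a b) (t, x)"
  using dir_\<phi>[OF assms smooth_on_differentiable[OF K'.smooth_T in_W(2)[OF assms]]
      smooth_on_differentiable[OF K.smooth_T in_W(1)[OF assms]] T_\<phi>[OF assms(1), symmetric], where v="K.E c (t, x)"]
  by (simp add: E_\<phi>[OF assms])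

proposition defect_\<phi>:
  assumes "t \<in> I" "x \<in> overlap" shows "K'.defect (t, \<phi> x) = K.defect (t, x)"
  unfolding K'.defect_scalar[OF in_W(2)[OF assms]] K.defect_scalar[OF in_W(1)[OF assms]]
    dir_T_\<phi>[OF assms] T_\<phi>[OF assms] ..

proposition null_direction_\<phi>:
  assumes "t \<in> I" "x \<in> overlap"
  shows "- K'.B (t, \<phi> x) *\<^sub>R K'.E Leg_u (t, \<phi> x) = dir (- K.B (t, x) *\<^sub>R K.E Leg_u (t, x)) \<phi> x"
  using linear_scale[OF dir_linear[OF smooth_on_differentiable[OF smooth_\<phi> assms(2)]]]
  by (simp only: E_\<phi>[OF assms] B_\<phi>[OF assms])

end

section \<open>Local solutions of ordinary differential equations\<close>

lemma smooth_on_lipschitz_cball: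
  fixes F :: "real \<times> 'b::euclidean_space \<Rightarrow> 'b"
  assumes W: "open W" and sm: "smooth_on W F" and sub: "cball t0 r \<times> cball x0 r \<subseteq> W"
  obtains L where "L > 0" "\<And>s x y. s \<in> cball t0 r \<Longrightarrow> x \<in> cball x0 r \<Longrightarrow> y \<in> cball x0 r \<Longrightarrow>
    norm (F (s, x) - F (s, y)) \<le> L * norm (x - y)"
proof -
  let ?K = "cball t0 r \<times> cball x0 r"
  have K: "compact ?K" by (intro compact_Times compact_cball)
  have "\<exists>M. \<forall>p\<in>?K. norm (dir (0, b) F p) \<le> M" for b
  proof -
    have "continuous_on ?K (dir (0, b) F)"
      using smooth_on_continuous_on[OF smooth_on_dir[OF sm]] sub continuous_on_subset by blast
    from compact_continuous_image[OF this K] show ?thesis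
      by (meson bounded_iff compact_imp_bounded imageI)
  qed
  then obtain M where M: "\<And>b p. p \<in> ?K \<Longrightarrow> norm (dir (0, b) F p) \<le> M b" by metis
  define L where "L = (\<Sum>b\<in>Basis. \<bar>M b\<bar>) + 1"
  show ?thesis
  proof (rule that)
    show "L > 0" unfolding L_def by (simp add: sum_nonneg add_nonneg_pos)
    fix s x y assume s: "s \<in> cball t0 r" and xy: "x \<in> cball x0 r" "y \<in> cball x0 r"
    show "norm (F (s, x) - F (s, y)) \<le> L * norm (x - y)"
    proof (rule differentiable_bound[OF convex_cball _ _ xy])
      fix z assume z: "z \<in> cball x0 r"
      then have p: "(s, z) \<in> ?K" "(s, z) \<in> W" using s sub by auto
      note d = smooth_on_differentiable[OF sm p(2)]
      have "((\<lambda>y. (s, y)) has_derivative (\<lambda>v. (0, v))) (at z)"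
        by (intro has_derivative_Pair has_derivative_ident has_derivative_const)
      from has_derivative_compose[OF this has_derivative_dir[OF d]]
      show "((\<lambda>x. F (s, x)) has_derivative (\<lambda>v. dir (0, v) F (s, z))) (at z within cball x0 r)"
        by (rule has_derivative_at_withinI)
      show "onorm (\<lambda>v. dir (0, v) F (s, z)) \<le> L"
      proof (rule onorm_le)
        fix v :: 'b
        note lin = dir_linear[OF d]
        have "(0 :: real, v) = (\<Sum>b\<in>Basis. (v \<bullet> b) *\<^sub>R (0, b))"
          by (simp add: sum_prod euclidean_representation)
        then have "dir (0, v) F (s, z) = (\<Sum>b\<in>Basis. (v \<bullet> b) *\<^sub>R dir (0, b) F (s, z))"
          by (simp only: linear_sum[OF lin] linear_scale[OF lin])
        also have "norm \<dots> \<le> (\<Sum>b\<in>Basis. norm ((v \<bullet> b) *\<^sub>R dir (0, b) F (s, z)))" by (rule norm_sum)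
        also have "\<dots> \<le> (\<Sum>b\<in>Basis. norm v * \<bar>M b\<bar>)"
          using M[OF p(1)] by (intro sum_mono) (auto intro!: mult_mono simp: Basis_le_norm order_trans[OF _ abs_ge_self])
        also have "\<dots> \<le> L * norm v" by (simp add: L_def sum_distrib_left[symmetric] algebra_simps)
        finally show "norm (dir (0, v) F (s, z)) \<le> L * norm v" .
      qed
    qed
  qed
qed

text \<open>Picard iteration. Clamping the time and projecting to a ball make the right-hand side bounded and
  Lipschitz everywhere, so that the integral operator acts on the Banach space of all bounded
  continuous functions. For short times its fixed point stays inside the ball, where the truncation
  has no effect.\<close>

lemma local_solution:
  fixes F :: "real \<times> 'b::euclidean_space \<Rightarrow> 'b"
  assumes W: "open W" and sm: "smooth_on W F" and init: "(t0, x0) \<in> W"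
  obtains \<epsilon> y where "\<epsilon> > 0" "y t0 = x0"
    "\<And>s. s \<in> ball t0 \<epsilon> \<Longrightarrow> (s, y s) \<in> W \<and> (y has_vector_derivative F (s, y s)) (at s)"
proof -
  obtain r where r: "r > 0" "cball t0 r \<times> cball x0 r \<subseteq> W"
  proof -
    obtain \<epsilon> where \<epsilon>: "\<epsilon> > 0" "ball (t0, x0) \<epsilon> \<subseteq> W" using W init open_contains_ball by blast
    have "cball t0 (\<epsilon>/3) \<times> cball x0 (\<epsilon>/3) \<subseteq> ball (t0, x0) \<epsilon>"
    proof clarify
      fix s x assume "s \<in> cball t0 (\<epsilon>/3)" "x \<in> cball x0 (\<epsilon>/3)"
      then have "dist (t0, x0) (s, x) \<le> \<epsilon>/3 + \<epsilon>/3"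
        using sqrt_sum_squares_le_sum[of "dist t0 s" "dist x0 x"] by (simp add: dist_Pair_Pair)
      then show "(s, x) \<in> ball (t0, x0) \<epsilon>" using \<epsilon>(1) by simp
    qed
    with \<epsilon> that[of "\<epsilon>/3"] show ?thesis by auto
  qed
  obtain L where L: "L > 0" "\<And>s x y. s \<in> cball t0 r \<Longrightarrow> x \<in> cball x0 r \<Longrightarrow> y \<in> cball x0 r \<Longrightarrow>
    norm (F (s, x) - F (s, y)) \<le> L * norm (x - y)"
    using smooth_on_lipschitz_cball[OF W sm r(2)] by blast
  have cF: "continuous_on (cball t0 r \<times> cball x0 r) F"
    using smooth_on_continuous_on[OF sm] r(2) continuous_on_subset by blast
  obtain M where M: "M > 0" "\<And>p. p \<in> cball t0 r \<times> cball x0 r \<Longrightarrow> norm (F p) \<le> M"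
    using compact_imp_bounded[OF compact_continuous_image[OF cF compact_Times[OF compact_cball compact_cball]]]
    unfolding bounded_pos by auto
  \<comment> \<open>The operator is a difference of integrals over intervals of length at most \<open>2 \<delta>\<close> and \<open>\<delta>\<close>,
    whence the factor three in both bounds.\<close>
  define \<delta> where "\<delta> = min r (min (r / (3 * M)) (1 / (6 * L)))"
  have \<delta>: "\<delta> > 0" "\<delta> \<le> r" "3 * \<delta> * M \<le> r" "3 * \<delta> * L \<le> 1/2"
  proof -
    show "\<delta> > 0" "\<delta> \<le> r" using r(1) M(1) L(1) by (auto simp: \<delta>_def)
    have "\<delta> \<le> r / (3 * M)" "\<delta> \<le> 1 / (6 * L)" by (auto simp: \<delta>_def)
    then show "3 * \<delta> * M \<le> r" "3 * \<delta> * L \<le> 1/2" using M(1) L(1) by (auto simp: field_simps)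
  qed
  define cl where "cl s = max (t0 - \<delta>) (min s (t0 + \<delta>))" for s
  define G where "G s x = F (cl s, closest_point (cball x0 r) x)" for s x
  have cl: "cl s \<in> {t0 - \<delta>..t0 + \<delta>}" "cl s \<in> cball t0 r" for s
    using \<delta> by (auto simp: cl_def dist_real_def)
  have proj: "closest_point (cball x0 r) x \<in> cball x0 r" for x
    using r(1) by (intro closest_point_in_set) auto
  have GM: "norm (G s x) \<le> M" for s x unfolding G_def using cl proj by (intro M(2)) auto
  have GL: "norm (G s x - G s y) \<le> L * norm (x - y)" for s x y
  proof -
    have "norm (G s x - G s y) \<le> L * norm (closest_point (cball x0 r) x - closest_point (cball x0 r) y)"
      unfolding G_def using cl proj by (intro L(2)) auto
    also have "\<dots> \<le> L * norm (x - y)"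
      using closest_point_lipschitz[of "cball x0 r" x y] L(1) r(1) by (auto simp: dist_norm)
    finally show ?thesis .
  qed
  have ccl: "continuous_on S cl" for S unfolding cl_def by (intro continuous_intros)
  have cG: "continuous_on S (\<lambda>s. G s (y s))" if "continuous_on S y" for S y
    unfolding G_def
  proof (rule continuous_on_compose2[OF cF])
    have "continuous_on UNIV (closest_point (cball x0 r))"
      using r(1) by (intro continuous_on_closest_point) auto
    then show "continuous_on S (\<lambda>s. (cl s, closest_point (cball x0 r) (y s)))"
      by (intro continuous_on_Pair ccl continuous_on_compose2[OF _ that]) auto
  qed (use cl proj in auto)
  define a where "a = t0 - \<delta>"
  define P where "P y s = x0 + integral {a..cl s} (\<lambda>s. G s (y s)) - integral {a..t0} (\<lambda>s. G s (y s))" for y s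
  have int: "(\<lambda>s. G s (y s)) integrable_on {c..d}" if "continuous_on UNIV y" for y c d
    by (intro integrable_continuous_interval cG continuous_on_subset[OF that]) auto
  have clen: "a \<le> cl s" "cl s - a \<le> 2 * \<delta>" "a \<le> t0" "t0 - a \<le> \<delta>" for s
    using cl(1)[of s] \<delta>(1) by (auto simp: a_def)
  have ib: "norm (integral {a..cl s} f - integral {a..t0} f) \<le> 3 * \<delta> * C"
    if f: "continuous_on UNIV f" "\<And>s. norm (f s) \<le> C" for f :: "real \<Rightarrow> 'b" and C s
  proof -
    have C: "C \<ge> 0" using f(2)[of 0] norm_ge_zero order_trans by blast
    have bound: "norm (integral {a..d} f) \<le> C * (d - a)" if "a \<le> d" for d
      using that f by (intro integral_bound continuous_on_subset[OF f(1)]) auto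
    have "norm (integral {a..cl s} f) \<le> C * (2 * \<delta>)" "norm (integral {a..t0} f) \<le> C * \<delta>"
      using order_trans[OF bound[OF clen(1)] mult_left_mono[OF clen(2) C]]
        order_trans[OF bound[OF clen(3)] mult_left_mono[OF clen(4) C]] by blast+
    then show ?thesis using norm_triangle_ineq4[of "integral {a..cl s} f" "integral {a..t0} f"]
      by (simp add: algebra_simps)
  qed
  have Pdist: "norm (P y s - x0) \<le> 3 * \<delta> * M" if "continuous_on UNIV y" for y s
    using ib[OF cG[OF that] GM, of s] by (simp add: P_def algebra_simps)
  have cP: "continuous_on UNIV (P y)" if "continuous_on UNIV y" for y
  proof -
    have "continuous_on {a..t0 + \<delta>} (\<lambda>d. integral {a..d} (\<lambda>s. G s (y s)))"
      by (rule indefinite_integral_continuous_1[OF int[OF that]])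
    then have "continuous_on UNIV (\<lambda>s. integral {a..cl s} (\<lambda>s. G s (y s)))"
      by (rule continuous_on_compose2[OF _ ccl]) (use cl(1) in \<open>auto simp: a_def\<close>)
    then show ?thesis unfolding P_def by (intro continuous_intros)
  qed
  have bP: "P y \<in> bcontfun" if "continuous_on UNIV y" for y
  proof (rule bcontfun_normI[OF cP[OF that]])
    show "norm (P y s) \<le> norm x0 + 3 * \<delta> * M" for s
      using Pdist[OF that, of s] norm_triangle_ineq[of "P y s - x0" x0] by simp
  qed
  define Q where "Q y = Bcontfun (P (apply_bcontfun y))" for y :: "real \<Rightarrow>\<^sub>C 'b"
  have Q: "apply_bcontfun (Q y) = P (apply_bcontfun y)" for y
    unfolding Q_def by (intro Bcontfun_inverse bP) simp
  have "dist (Q y) (Q z) \<le> 1/2 * dist y z" for y z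
  proof (rule dist_bound)
    fix s
    have cy: "continuous_on UNIV (apply_bcontfun y)" "continuous_on UNIV (apply_bcontfun z)" by simp_all
    let ?f = "\<lambda>s. G s (apply_bcontfun y s) - G s (apply_bcontfun z s)"
    have fC: "norm (?f s) \<le> L * dist y z" for s
    proof (rule order_trans[OF GL])
      show "L * norm (apply_bcontfun y s - apply_bcontfun z s) \<le> L * dist y z"
        using L(1) dist_bounded[of y s z] by (simp add: dist_norm)
    qed
    have "apply_bcontfun (Q y) s - apply_bcontfun (Q z) s = integral {a..cl s} ?f - integral {a..t0} ?f"
      by (simp add: Q P_def integral_diff int cy)
    then have "dist (apply_bcontfun (Q y) s) (apply_bcontfun (Q z) s) \<le> 3 * \<delta> * (L * dist y z)"
      using ib[of ?f, OF continuous_on_diff[OF cG[OF cy(1)] cG[OF cy(2)]] fC, of s] by (simp add: dist_norm)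
    also have "\<dots> \<le> 1/2 * dist y z"
      using mult_right_mono[OF \<delta>(4), of "dist y z"] by (simp add: mult.assoc)
    finally show "dist (apply_bcontfun (Q y) s) (apply_bcontfun (Q z) s) \<le> 1/2 * dist y z" .
  qed
  then have "\<exists>!y. Q y = y" by (intro banach_fix_type[where c="1/2"]) auto
  then obtain Y where "Q Y = Y" by blast
  define y where "y = apply_bcontfun Y"
  have cy: "continuous_on UNIV y" by (simp add: y_def)
  have y: "y s = P y s" for s using Q[of Y] \<open>Q Y = Y\<close> by (simp add: y_def)
  show ?thesis
  proof (rule that)
    show "\<delta> > 0" by (rule \<delta>(1))
    have "cl t0 = t0" using \<delta>(1) by (simp add: cl_def)
    then show "y t0 = x0" using y[of t0] by (simp add: P_def)
    fix s assume s: "s \<in> ball t0 \<delta>"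
    have "norm (y s - x0) \<le> r" using Pdist[OF cy, of s] \<delta>(3) y[of s] by simp
    then have ys: "y s \<in> cball x0 r" by (simp add: dist_norm norm_minus_commute)
    have cls: "cl u = u" if "u \<in> ball t0 \<delta>" for u using that by (auto simp: cl_def dist_real_def)
    have "((\<lambda>u. integral {a..u} (\<lambda>s. G s (y s))) has_vector_derivative G s (y s)) (at s within {a..t0 + \<delta>})"
      by (rule integral_has_vector_derivative[OF cG[OF continuous_on_subset[OF cy]]])
        (use s in \<open>auto simp: a_def dist_real_def\<close>)
    moreover have "at s within {a..t0 + \<delta>} = at s"
      by (rule at_within_interior) (use s in \<open>auto simp: a_def dist_real_def\<close>)
    ultimately have "((\<lambda>u. x0 + integral {a..u} (\<lambda>s. G s (y s)) - integral {a..t0} (\<lambda>s. G s (y s)))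
        has_vector_derivative G s (y s)) (at s)"
      by (auto intro!: derivative_eq_intros)
    then have "(y has_vector_derivative G s (y s)) (at s)"
    proof (rule has_vector_derivative_transform_within_open[OF _ open_ball s])
      show "x0 + integral {a..u} (\<lambda>s. G s (y s)) - integral {a..t0} (\<lambda>s. G s (y s)) = y u"
        if "u \<in> ball t0 \<delta>" for u
        unfolding y[of u] P_def cls[OF that] ..
    qed
    moreover have "G s (y s) = F (s, y s)" using ys by (simp add: G_def cls[OF s] closest_point_self)
    moreover have "(s, y s) \<in> W" using r(2) ys s \<delta>(2) by auto
    ultimately show "(s, y s) \<in> W \<and> (y has_vector_derivative F (s, y s)) (at s)" by simp
  qed
qed

section \<open>Maximal integral curves on a manifold\<close>

text \<open>This allows to join two solutions of a differential equation at a common end point.\<close>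

lemma has_vector_derivative_removable:
  fixes z g :: "real \<Rightarrow> 'b::banach"
  assumes "\<epsilon> > 0" and cz: "continuous_on (ball T \<epsilon>) z" and cg: "continuous_on (ball T \<epsilon>) g"
    and der: "\<And>s. s \<in> ball T \<epsilon> \<Longrightarrow> s \<noteq> T \<Longrightarrow> (z has_vector_derivative g s) (at s)"
  shows "(z has_vector_derivative g T) (at T)"
proof -
  define a b where "a = T - \<epsilon>/2" and "b = T + \<epsilon>/2"
  have ab: "{a..b} \<subseteq> ball T \<epsilon>" "a < T" "T < b"
    using assms(1) by (auto simp: a_def b_def dist_real_def field_simps)
  have "integral {a..u} g = z u - z a" if "u \<in> {a..b}" for u
  proof (rule integral_unique, rule fundamental_theorem_of_calculus_strong[of "{T}"])
    show "continuous_on {a..u} z"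
      using that ab(1) by (intro continuous_on_subset[OF cz]) auto
    show "(z has_vector_derivative g s) (at s)" if "s \<in> {a..u} - {T}" for s
      using that \<open>u \<in> {a..b}\<close> by (intro der subsetD[OF ab(1)]) auto
  qed (use that in auto)
  then have eq: "z a + integral {a..u} g = z u" if "u \<in> {a<..<b}" for u using that by simp
  have "((\<lambda>u. z a + integral {a..u} g) has_vector_derivative g T) (at T within {a..b})"
    using integral_has_vector_derivative[OF continuous_on_subset[OF cg ab(1)], of T] ab(2,3)
    by (auto intro!: derivative_eq_intros)
  then have "((\<lambda>u. z a + integral {a..u} g) has_vector_derivative g T) (at T)"
    using at_within_interior[of T "{a..b}"] ab(2,3) by simp
  then show ?thesis
    by (rule has_vector_derivative_transform_within_open[where S="{a<..<b}"]) (use ab eq in auto)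
qed

text \<open>The components of a smooth vector field on the manifold that depends on time. Integral curves are
  parametrised by time.\<close>

locale time_dependent_field =
  fixes A :: "'a::{t2_space,second_countable_topology} chart set" and I :: "real set"
    and V :: "'a chart \<Rightarrow> real \<times> (real^3) \<Rightarrow> real^3"
  assumes atlas: "smooth_atlas A" and I: "open I"
    and smooth_V: "\<kappa> \<in> A \<Longrightarrow> smooth_on (I \<times> chart_image \<kappa>) (V \<kappa>)"
    and V_transition: "\<kappa> \<in> A \<Longrightarrow> \<kappa>' \<in> A \<Longrightarrow> t \<in> I \<Longrightarrow> x \<in> snd \<kappa> ` (fst \<kappa> \<inter> fst \<kappa>') \<Longrightarrow>
      V \<kappa>' (t, transition \<kappa> \<kappa>' x) = dir (V \<kappa> (t, x)) (transition \<kappa> \<kappa>') x"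
begin

lemma is_chart: "\<kappa> \<in> A \<Longrightarrow> is_chart \<kappa>"
  using atlas by (simp add: smooth_atlas_def)

lemma chart_at: obtains \<kappa> where "\<kappa> \<in> A" "q \<in> fst \<kappa>"
proof -
  have "q \<in> (\<Union>\<kappa>\<in>A. fst \<kappa>)" using atlas unfolding smooth_atlas_def by simp
  then show ?thesis using that by blast
qed

definition integral_curve :: "real set \<Rightarrow> (real \<Rightarrow> 'a) \<Rightarrow> bool" where
  "integral_curve J \<gamma> \<longleftrightarrow> open J \<and> is_interval J \<and> J \<subseteq> I \<and> continuous_on J \<gamma> \<and>
     (\<forall>s\<in>J. \<forall>\<kappa>\<in>A. \<gamma> s \<in> fst \<kappa> \<longrightarrow>
        ((\<lambda>r. snd \<kappa> (\<gamma> r)) has_vector_derivative V \<kappa> (s, snd \<kappa> (\<gamma> s))) (at s))"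

lemma integral_curveD:
  assumes "integral_curve J \<gamma>"
  shows "open J" "is_interval J" "connected J" "J \<subseteq> I" "continuous_on J \<gamma>"
    and "s \<in> J \<Longrightarrow> \<kappa> \<in> A \<Longrightarrow> \<gamma> s \<in> fst \<kappa> \<Longrightarrow>
      ((\<lambda>r. snd \<kappa> (\<gamma> r)) has_vector_derivative V \<kappa> (s, snd \<kappa> (\<gamma> s))) (at s)"
  using assms is_interval_connected unfolding integral_curve_def by blast+

lemma open_curve_preimage:
  assumes "open J" "continuous_on J \<gamma>" "open S" shows "open {r \<in> J. \<gamma> r \<in> S}"
  using continuous_open_preimage[OF assms(2,1,3)] by (simp add: vimage_def Int_def)

lemma derivative_change_chart:
  assumes J: "open J" "continuous_on J \<gamma>" "J \<subseteq> I" "s \<in> J"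
    and \<kappa>: "\<kappa> \<in> A" "\<gamma> s \<in> fst \<kappa>" and \<kappa>': "\<kappa>' \<in> A" "\<gamma> s \<in> fst \<kappa>'"
    and der: "((\<lambda>r. snd \<kappa> (\<gamma> r)) has_vector_derivative V \<kappa> (s, snd \<kappa> (\<gamma> s))) (at s)"
  shows "((\<lambda>r. snd \<kappa>' (\<gamma> r)) has_vector_derivative V \<kappa>' (s, snd \<kappa>' (\<gamma> s))) (at s)"
proof -
  let ?\<phi> = "transition \<kappa> \<kappa>'" and ?x = "snd \<kappa> (\<gamma> s)" and ?N = "{r \<in> J. \<gamma> r \<in> fst \<kappa> \<inter> fst \<kappa>'}"
  have \<phi>: "?\<phi> (snd \<kappa> p) = snd \<kappa>' p" if "p \<in> fst \<kappa>" for p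
    using chart_facts(3)[OF is_chart[OF \<kappa>(1)] that] by (simp add: transition_def)
  have x: "?x \<in> snd \<kappa> ` (fst \<kappa> \<inter> fst \<kappa>')" using \<kappa>(2) \<kappa>'(2) by blast
  have "smooth_on (snd \<kappa> ` (fst \<kappa> \<inter> fst \<kappa>')) ?\<phi>"
    using atlas \<kappa>(1) \<kappa>'(1) by (simp add: smooth_atlas_def)
  from smooth_on_has_derivative[OF this x]
  have "((?\<phi> \<circ> (\<lambda>r. snd \<kappa> (\<gamma> r))) has_vector_derivative dir (V \<kappa> (s, ?x)) ?\<phi> ?x) (at s)"
    by (rule vector_derivative_diff_chain_within[OF der has_derivative_at_withinI])
  moreover have "dir (V \<kappa> (s, ?x)) ?\<phi> ?x = V \<kappa>' (s, snd \<kappa>' (\<gamma> s))"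
    using V_transition[OF \<kappa>(1) \<kappa>'(1) _ x, of s] J(3,4) \<phi>[OF \<kappa>(2)] by auto
  ultimately have "((?\<phi> \<circ> (\<lambda>r. snd \<kappa> (\<gamma> r))) has_vector_derivative V \<kappa>' (s, snd \<kappa>' (\<gamma> s))) (at s)"
    by simp
  moreover have "open ?N"
    by (intro open_curve_preimage J(1,2) open_Int chart_facts(1) is_chart \<kappa>(1) \<kappa>'(1))
  ultimately show ?thesis
    by (rule has_vector_derivative_transform_within_open) (use \<phi> \<kappa> \<kappa>' J(4) in auto)
qed

lemma integral_curve_chartI:
  assumes N: "open N" "is_interval N" "N \<subseteq> I" and \<kappa>: "\<kappa> \<in> A"
    and z: "\<And>s. s \<in> N \<Longrightarrow> z s \<in> chart_image \<kappa>"
      "\<And>s. s \<in> N \<Longrightarrow> (z has_vector_derivative V \<kappa> (s, z s)) (at s)"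
    and \<gamma>: "\<And>s. s \<in> N \<Longrightarrow> \<gamma> s = chart_inv \<kappa> (z s)"
  shows "integral_curve N \<gamma>"
proof -
  note c = chart_facts[OF is_chart[OF \<kappa>]]
  have "continuous_on N z"
    using z(2) by (intro continuous_at_imp_continuous_on ballI has_vector_derivative_continuous)
  then have "continuous_on N (\<lambda>s. chart_inv \<kappa> (z s))"
    using z(1) by (intro continuous_on_compose2[OF c(8)]) auto
  then have cont: "continuous_on N \<gamma>" using \<gamma> by (simp cong: continuous_on_cong)
  have y: "snd \<kappa> (\<gamma> s) = z s" "\<gamma> s \<in> fst \<kappa>" if "s \<in> N" for s
    using c(5,6)[OF z(1)[OF that]] \<gamma>[OF that] by auto
  have "((\<lambda>r. snd \<kappa> (\<gamma> r)) has_vector_derivative V \<kappa> (s, snd \<kappa> (\<gamma> s))) (at s)" if "s \<in> N" for s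
    unfolding y(1)[OF that]
    by (rule has_vector_derivative_transform_within_open[OF z(2)[OF that] N(1) that]) (simp add: y)
  then have "((\<lambda>r. snd \<kappa>' (\<gamma> r)) has_vector_derivative V \<kappa>' (s, snd \<kappa>' (\<gamma> s))) (at s)"
    if "s \<in> N" "\<kappa>' \<in> A" "\<gamma> s \<in> fst \<kappa>'" for s \<kappa>'
    using derivative_change_chart[OF N(1) cont N(3) that(1) \<kappa> y(2)[OF that(1)] that(2,3)] that(1) by blast
  then show ?thesis unfolding integral_curve_def using N cont by blast
qed

lemma integral_curve_cong:
  assumes "integral_curve J \<gamma>" "\<And>s. s \<in> J \<Longrightarrow> \<gamma>' s = \<gamma> s"
  shows "integral_curve J \<gamma>'"
proof -
  note J = integral_curveD[OF assms(1)]
  have "((\<lambda>r. snd \<kappa> (\<gamma>' r)) has_vector_derivative V \<kappa> (s, snd \<kappa> (\<gamma>' s))) (at s)"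
    if s: "s \<in> J" and \<kappa>: "\<kappa> \<in> A" "\<gamma>' s \<in> fst \<kappa>" for s \<kappa>
    unfolding assms(2)[OF s]
    by (rule has_vector_derivative_transform_within_open[OF J(6)[OF s \<kappa>[unfolded assms(2)[OF s]]] J(1) s])
      (simp add: assms(2))
  moreover have "continuous_on J \<gamma>'"
    using J(5) assms(2) by (metis continuous_on_cong)
  ultimately show ?thesis using J(1,2,4) unfolding integral_curve_def by blast
qed

lemma integral_curve_Union:
  assumes "\<And>J. J \<in> \<J> \<Longrightarrow> integral_curve J \<gamma>" "\<And>J. J \<in> \<J> \<Longrightarrow> m \<in> J"
  shows "integral_curve (\<Union>\<J>) \<gamma>"
proof -
  note D = integral_curveD[OF assms(1)]
  have "connected (\<Union>\<J>)" by (rule connected_Union) (use D(3) assms(2) in blast)+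
  moreover have "continuous_on (\<Union>\<J>) \<gamma>" by (rule continuous_on_open_Union) (use D(1,5) in blast)+
  moreover have "open (\<Union>\<J>)" "\<Union>\<J> \<subseteq> I" using D(1,4) by blast+
  ultimately show ?thesis using D(6) unfolding integral_curve_def is_interval_connected_1 by blast
qed

lemma local_curve:
  assumes "t \<in> I" "\<kappa> \<in> A" "q \<in> fst \<kappa>"
  obtains \<epsilon> d where "\<epsilon> > 0" "d t = snd \<kappa> q" "ball t \<epsilon> \<subseteq> I"
    "\<And>s. s \<in> ball t \<epsilon> \<Longrightarrow> d s \<in> chart_image \<kappa>"
    "\<And>s. s \<in> ball t \<epsilon> \<Longrightarrow> (d has_vector_derivative V \<kappa> (s, d s)) (at s)"
proof -
  note c = chart_facts[OF is_chart[OF assms(2)]]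
  have "open (I \<times> chart_image \<kappa>)" "(t, snd \<kappa> q) \<in> I \<times> chart_image \<kappa>"
    using assms c(2,4) I by (auto intro: open_Times)
  from local_solution[OF this(1) smooth_V[OF assms(2)] this(2)]
  obtain \<epsilon> d where "\<epsilon> > 0" "d t = snd \<kappa> q"
    "\<And>s. s \<in> ball t \<epsilon> \<Longrightarrow> (s, d s) \<in> I \<times> chart_image \<kappa> \<and> (d has_vector_derivative V \<kappa> (s, d s)) (at s)"
    by blast
  then show ?thesis by (intro that[of \<epsilon> d]) auto
qed

definition maximal_curve :: "real set \<Rightarrow> (real \<Rightarrow> 'a) \<Rightarrow> bool" where
  "maximal_curve J \<gamma> \<longleftrightarrow> integral_curve J \<gamma> \<and>
     (\<forall>J' \<gamma>'. integral_curve J' \<gamma>' \<and> J \<subseteq> J' \<and> (\<forall>s\<in>J. \<gamma>' s = \<gamma> s) \<longrightarrow> J' = J)"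

text \<open>Zorn's lemma, applied to the graphs of the integral curves through \<open>p\<close> at time \<open>t\<close>.\<close>

lemma maximal_curve_exists:
  assumes "t \<in> I"
  obtains J \<gamma> where "t \<in> J" "\<gamma> t = p" "maximal_curve J \<gamma>"
proof -
  define graph where "graph J \<gamma> = (\<lambda>s. (s, \<gamma> s)) ` J" for J :: "real set" and \<gamma> :: "real \<Rightarrow> 'a"
  define \<G> where "\<G> = {graph J \<gamma> | J \<gamma>. integral_curve J \<gamma> \<and> t \<in> J \<and> \<gamma> t = p}"
  have fst_graph: "fst ` graph J \<gamma> = J" for J \<gamma> by (auto simp: graph_def image_image)
  have \<G>I: "graph J \<gamma> \<in> \<G>" if "integral_curve J \<gamma>" "t \<in> J" "\<gamma> t = p" for J \<gamma>
    unfolding \<G>_def using that by blast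
  have "\<exists>M\<in>\<G>. \<forall>X\<in>\<G>. M \<subseteq> X \<longrightarrow> X = M"
  proof (rule subset_Zorn_nonempty)
    obtain \<kappa> where \<kappa>: "\<kappa> \<in> A" "p \<in> fst \<kappa>" by (rule chart_at)
    obtain \<epsilon> d where d: "\<epsilon> > 0" "d t = snd \<kappa> p" "ball t \<epsilon> \<subseteq> I"
      "\<And>s. s \<in> ball t \<epsilon> \<Longrightarrow> d s \<in> chart_image \<kappa>"
      "\<And>s. s \<in> ball t \<epsilon> \<Longrightarrow> (d has_vector_derivative V \<kappa> (s, d s)) (at s)"
      by (rule local_curve[OF assms \<kappa>]) blast
    have "integral_curve (ball t \<epsilon>) (\<lambda>s. chart_inv \<kappa> (d s))"
      by (rule integral_curve_chartI[OF _ _ d(3) \<kappa>(1) d(4,5)]) (auto simp: is_interval_ball_real)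
    moreover have "chart_inv \<kappa> (d t) = p"
      using chart_facts(3)[OF is_chart[OF \<kappa>(1)] \<kappa>(2)] d(2) by simp
    moreover have "t \<in> ball t \<epsilon>" using d(1) by simp
    ultimately have "graph (ball t \<epsilon>) (\<lambda>s. chart_inv \<kappa> (d s)) \<in> \<G>" by (intro \<G>I)
    then show "\<G> \<noteq> {}" by blast
  next
    fix \<C> assume C: "\<C> \<noteq> {}" "subset.chain \<G> \<C>"
    have "\<forall>X\<in>\<C>. \<exists>J \<gamma>. X = graph J \<gamma> \<and> integral_curve J \<gamma> \<and> t \<in> J \<and> \<gamma> t = p"
      using C(2) unfolding subset.chain_def \<G>_def by blast
    then obtain J \<gamma> where J: "\<And>X. X \<in> \<C> \<Longrightarrow> X = graph (J X) (\<gamma> X) \<and> integral_curve (J X) (\<gamma> X) \<and> t \<in> J X \<and> \<gamma> X t = p"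
      by metis
    have J_curve: "integral_curve (J X) (\<gamma> X)" "t \<in> J X" "\<gamma> X t = p" if "X \<in> \<C>" for X
      using J[OF that] by blast+
    define g where "g s = (THE q. (s, q) \<in> \<Union>\<C>)" for s
    have unique: "q = q'" if u: "(s, q) \<in> \<Union>\<C>" "(s, q') \<in> \<Union>\<C>" for s q q'
    proof -
      obtain X X' where X: "X \<in> \<C>" "X' \<in> \<C>" "(s, q) \<in> X" "(s, q') \<in> X'" using u by blast
      then have "X \<subseteq> X' \<or> X' \<subseteq> X" using C(2) unfolding subset.chain_def by blast
      then obtain Y where Y: "Y \<in> \<C>" "(s, q) \<in> Y" "(s, q') \<in> Y" using X by blast
      have "Y = graph (J Y) (\<gamma> Y)" using J[OF Y(1)] by blast
      then have "(s, q) \<in> graph (J Y) (\<gamma> Y)" "(s, q') \<in> graph (J Y) (\<gamma> Y)" using Y(2,3) by blast+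
      then show ?thesis by (auto simp: graph_def)
    qed
    have g: "g s = \<gamma> X s" if "X \<in> \<C>" "s \<in> J X" for X s
    proof -
      have "(s, \<gamma> X s) \<in> graph (J X) (\<gamma> X)" using that(2) by (simp add: graph_def)
      then have m: "(s, \<gamma> X s) \<in> \<Union>\<C>" using J[OF that(1)] that(1) by blast
      show ?thesis unfolding g_def using m unique by (intro the_equality) blast+
    qed
    have "integral_curve (J X) g" if "X \<in> \<C>" for X
      by (rule integral_curve_cong[OF J_curve(1)[OF that] g[OF that]])
    then have "integral_curve (\<Union>(J ` \<C>)) g"
      using J_curve(2) by (intro integral_curve_Union[of _ _ t]) blast+
    moreover have union: "\<Union>\<C> = graph (\<Union>(J ` \<C>)) g"
    proof -
      have "X = graph (J X) g" if "X \<in> \<C>" for X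
      proof -
        have "graph (J X) g = graph (J X) (\<gamma> X)"
          unfolding graph_def by (rule image_cong) (simp_all add: g[OF that])
        moreover have "X = graph (J X) (\<gamma> X)" using J[OF that] by blast
        ultimately show ?thesis by metis
      qed
      then have "(\<Union>X\<in>\<C>. X) = (\<Union>X\<in>\<C>. graph (J X) g)" by (rule SUP_cong[OF refl])
      then show ?thesis by (auto simp: graph_def)
    qed
    moreover obtain X0 where X0: "X0 \<in> \<C>" using C(1) by blast
    then have "t \<in> \<Union>(J ` \<C>)" using X0 J_curve(2) by blast
    moreover have "g t = p" using g[OF X0 J_curve(2)[OF X0]] J_curve(3)[OF X0] by simp
    ultimately show "\<Union>\<C> \<in> \<G>" unfolding union by (intro \<G>I)
  qed
  then obtain M where M: "M \<in> \<G>" "\<And>X. X \<in> \<G> \<Longrightarrow> M \<subseteq> X \<Longrightarrow> X = M" by blast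
  from M(1) obtain J \<gamma> where J: "integral_curve J \<gamma>" "t \<in> J" "\<gamma> t = p" and M_eq: "M = graph J \<gamma>"
    unfolding \<G>_def by blast
  have J_max: "J' = J" if J': "integral_curve J' \<gamma>'" "J \<subseteq> J'" "\<forall>s\<in>J. \<gamma>' s = \<gamma> s" for J' \<gamma>'
  proof -
    have "graph J' \<gamma>' \<in> \<G>" by (rule \<G>I) (use J J' in auto)
    moreover have "graph J \<gamma> \<subseteq> graph J' \<gamma>'" using J' by (auto simp: graph_def image_iff)
    ultimately have "graph J' \<gamma>' = graph J \<gamma>" by (rule M(2)[unfolded M_eq])
    then show ?thesis by (metis fst_graph)
  qed
  have "maximal_curve J \<gamma>" unfolding maximal_curve_def using J(1) J_max by blast
  with J(2,3) show ?thesis by (rule that[of J \<gamma>])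
qed

text \<open>A curve that converges to \<open>q\<close> as time approaches an end \<open>T\<close> of its interval can be followed by a
  solution through \<open>q\<close> beyond \<open>T\<close>. The set \<open>H\<close> below is the side of \<open>T\<close> on which the given curve lives; the
  argument is the same for both sides.\<close>

lemma extend_across:
  assumes J: "integral_curve J \<gamma>" and T: "T \<in> I" "T \<notin> J" and \<kappa>: "\<kappa> \<in> A" "q \<in> fst \<kappa>" and \<epsilon>: "\<epsilon> > 0"
    and half: "J \<inter> ball T \<epsilon> = {T-\<epsilon><..<T} \<or> J \<inter> ball T \<epsilon> = {T<..<T+\<epsilon>}"
    and in_chart: "\<And>s. s \<in> J \<inter> ball T \<epsilon> \<Longrightarrow> \<gamma> s \<in> fst \<kappa>"
    and lim: "\<And>S. open S \<Longrightarrow> q \<in> S \<Longrightarrow> eventually (\<lambda>s. \<gamma> s \<in> S) (at T within J)"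
  shows "\<not> maximal_curve J \<gamma>"
proof -
  note c = chart_facts[OF is_chart[OF \<kappa>(1)]]
  have oJ: "open J" and J_der: "\<And>s. s \<in> J \<Longrightarrow> \<gamma> s \<in> fst \<kappa> \<Longrightarrow>
      ((\<lambda>r. snd \<kappa> (\<gamma> r)) has_vector_derivative V \<kappa> (s, snd \<kappa> (\<gamma> s))) (at s)"
    using integral_curveD(1,6)[OF J] \<kappa>(1) by blast+
  obtain \<delta>0 d where d: "\<delta>0 > 0" "d T = snd \<kappa> q" "ball T \<delta>0 \<subseteq> I"
    "\<And>s. s \<in> ball T \<delta>0 \<Longrightarrow> d s \<in> chart_image \<kappa>"
    "\<And>s. s \<in> ball T \<delta>0 \<Longrightarrow> (d has_vector_derivative V \<kappa> (s, d s)) (at s)"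
    by (rule local_curve[OF T(1) \<kappa>]) blast
  define \<delta> where "\<delta> = min \<epsilon> \<delta>0"
  define N where "N = ball T \<delta>"
  define H H' where "H = J \<inter> N" and "H' = N - J - {T}"
  have \<delta>: "\<delta> > 0" "\<delta> \<le> \<epsilon>" "\<delta> \<le> \<delta>0" using d(1) \<epsilon> by (auto simp: \<delta>_def)
  have N: "N \<subseteq> ball T \<epsilon>" "N \<subseteq> ball T \<delta>0" "T \<in> N" "open N" using \<delta> by (auto simp: N_def)
  have "H = (J \<inter> ball T \<epsilon>) \<inter> N" using N(1) by (auto simp: H_def)
  then have H: "(H = {T-\<delta><..<T} \<and> H' = {T<..<T+\<delta>}) \<or> (H = {T<..<T+\<delta>} \<and> H' = {T-\<delta><..<T})"
  proof -
    have "H = {T-\<epsilon><..<T} \<inter> N \<or> H = {T<..<T+\<epsilon>} \<inter> N"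
      using half \<open>H = (J \<inter> ball T \<epsilon>) \<inter> N\<close> by auto
    then have "H = {T-\<delta><..<T} \<or> H = {T<..<T+\<delta>}"
      using \<delta> by (auto simp: N_def dist_real_def)
    moreover have "H' = N - H - {T}" by (auto simp: H'_def H_def)
    moreover have "N = {T-\<delta><..<T+\<delta>}" by (auto simp: N_def dist_real_def)
    ultimately show ?thesis by auto
  qed
  then have oH: "open H" "open H'" "H \<noteq> {}" using \<delta>(1) by auto
  have NH: "N = H \<union> H' \<union> {T}" "H \<inter> H' = {}" "T \<notin> H" "T \<notin> H'" using N(3) T(2) by (auto simp: H_def H'_def)
  have H_chart: "\<gamma> s \<in> fst \<kappa>" if "s \<in> H" for s using that N(1) by (intro in_chart) (auto simp: H_def)
  define z where "z s = (if s \<in> H then snd \<kappa> (\<gamma> s) else d s)" for s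
  have z_in: "z s \<in> chart_image \<kappa>" if "s \<in> N" for s
    using that c(4)[OF H_chart[of s]] d(4)[of s] N(2) by (auto simp: z_def)
  have z_der: "(z has_vector_derivative V \<kappa> (s, z s)) (at s)" if "s \<in> N" "s \<noteq> T" for s
  proof (cases "s \<in> H")
    case True
    then have "((\<lambda>r. snd \<kappa> (\<gamma> r)) has_vector_derivative V \<kappa> (s, snd \<kappa> (\<gamma> s))) (at s)"
      using H_chart by (intro J_der) (auto simp: H_def)
    moreover have "snd \<kappa> (\<gamma> r) = z r" if "r \<in> H" for r using that by (simp add: z_def)
    ultimately have "(z has_vector_derivative V \<kappa> (s, snd \<kappa> (\<gamma> s))) (at s)"
      by (rule has_vector_derivative_transform_within_open[OF _ oH(1) True])
    then show ?thesis using True by (simp add: z_def)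
  next
    case False
    then have s: "s \<in> H'" using that NH by auto
    have "(d has_vector_derivative V \<kappa> (s, d s)) (at s)" using that N(2) by (intro d(5)) auto
    moreover have "d r = z r" if "r \<in> H'" for r using that NH(2) by (auto simp: z_def)
    ultimately have "(z has_vector_derivative V \<kappa> (s, d s)) (at s)"
      by (rule has_vector_derivative_transform_within_open[OF _ oH(2) s])
    then show ?thesis using False by (simp add: z_def)
  qed
  have z_cont_T: "isCont z T"
  proof -
    have "eventually (\<lambda>s. z s \<in> S) (at T)" if S: "open S" "z T \<in> S" for S
    proof -
      have zT: "z T = snd \<kappa> q" using NH(3) d(2) by (simp add: z_def)
      have "open {p \<in> fst \<kappa>. snd \<kappa> p \<in> S}"
        using continuous_open_preimage[OF c(7,1) S(1)] by (simp add: vimage_def Int_def)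
      from lim[OF this] have "eventually (\<lambda>s. \<gamma> s \<in> fst \<kappa> \<and> snd \<kappa> (\<gamma> s) \<in> S) (at T within J)"
        using \<kappa>(2) S(2) zT by simp
      then have "eventually (\<lambda>s. s \<in> J \<longrightarrow> snd \<kappa> (\<gamma> s) \<in> S) (at T)"
        by (auto simp: eventually_at_filter elim: eventually_mono)
      moreover have "isCont d T" using d(5)[of T] d(1) by (auto intro: has_vector_derivative_continuous)
      then have "eventually (\<lambda>s. d s \<in> S) (at T)"
        using S zT d(2) by (auto simp: isCont_def intro: topological_tendstoD)
      ultimately show ?thesis by eventually_elim (auto simp: z_def H_def)
    qed
    then show ?thesis by (simp add: isCont_def tendsto_def)
  qed
  have z_cont: "continuous_on N z"
    using z_der z_cont_T has_vector_derivative_continuous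
    by (intro continuous_at_imp_continuous_on) blast
  have "continuous_on N (\<lambda>s. V \<kappa> (s, z s))"
    using z_in N(2) d(3)
    by (intro continuous_on_compose2[OF smooth_on_continuous_on[OF smooth_V[OF \<kappa>(1)]]] continuous_intros z_cont) auto
  with z_cont have "(z has_vector_derivative V \<kappa> (T, z T)) (at T)"
    unfolding N_def by (rule has_vector_derivative_removable[OF \<delta>(1)]) (rule z_der[unfolded N_def])
  then have z_der': "(z has_vector_derivative V \<kappa> (s, z s)) (at s)" if "s \<in> N" for s
    using z_der that by (cases "s = T") auto
  define \<gamma>' where "\<gamma>' s = (if s \<in> J then \<gamma> s else chart_inv \<kappa> (d s))" for s
  have "integral_curve N \<gamma>'"
  proof (rule integral_curve_chartI[OF N(4) _ _ \<kappa>(1) z_in z_der'])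
    show "is_interval N" "N \<subseteq> I" using N(2) d(3) by (auto simp: N_def is_interval_ball_real)
    show "\<gamma>' s = chart_inv \<kappa> (z s)" if "s \<in> N" for s
      using that c(3)[OF H_chart[of s]] by (auto simp: z_def \<gamma>'_def H_def)
  qed
  moreover have "integral_curve J \<gamma>'" by (rule integral_curve_cong[OF J]) (simp add: \<gamma>'_def)
  moreover obtain m where "m \<in> H" using oH(3) by blast
  ultimately have "integral_curve (\<Union>{J, N}) \<gamma>'"
    by (intro integral_curve_Union[of _ _ m]) (auto simp: H_def)
  moreover have "\<forall>s\<in>J. \<gamma>' s = \<gamma> s" by (simp add: \<gamma>'_def)
  ultimately show ?thesis using T(2) N(3) unfolding maximal_curve_def by blast
qed

text \<open>Time is the first component of the curve in spacetime. Hence an endpoint \<open>(T, q)\<close> can only be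
  approached as the time tends to the end \<open>T\<close> of \<open>J\<close>, and then \<open>extend_across\<close> applies.\<close>

proposition maximal_curve_inextendible:
  assumes max: "maximal_curve J \<gamma>"
  shows "inextendible I J (\<lambda>s. (s, \<gamma> s))"
proof -
  have J: "integral_curve J \<gamma>" using max by (simp add: maximal_curve_def)
  have oJ: "open J" and iJ: "is_interval J" by (rule integral_curveD[OF J])+
  have between: "s \<in> J" if "s0 \<in> J" "s1 \<in> J" "s0 \<le> s" "s \<le> s1" for s s0 s1
    using iJ that unfolding is_interval_1 by blast
  \<comment> \<open>The order \<open>le\<close> points towards the end of \<open>J\<close> under consideration.\<close>
  have no_end: False
    if T: "T \<in> I" and le: "le = (\<le>) \<or> le = (\<ge>)"
      and limit: "\<And>W. open W \<Longrightarrow> (T, q) \<in> W \<Longrightarrow> \<exists>s0\<in>J. \<forall>s\<in>J. le s0 s \<longrightarrow> (s, \<gamma> s) \<in> W"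
    for T q and le :: "real \<Rightarrow> real \<Rightarrow> bool"
  proof -
    have R: "\<exists>s0\<in>J. \<forall>s\<in>J. le s0 s \<longrightarrow> s \<in> X \<and> \<gamma> s \<in> S" if "open X" "open S" "T \<in> X" "q \<in> S" for X S
      using limit[of "X \<times> S"] that by (auto intro: open_Times)
    have refl: "le s s" and total: "le s r \<or> le r s" for s r using le by auto
    have before_open: "open {s. \<not> le r s}" for r
      using le open_lessThan[of r] open_greaterThan[of r]
      by (auto simp: not_le lessThan_def greaterThan_def)
    have after_open: "open {s. \<not> le s r}" for r
      using le open_lessThan[of r] open_greaterThan[of r]
      by (auto simp: not_le lessThan_def greaterThan_def)
    have before_T: "\<not> le T s" if s: "s \<in> J" for s
    proof
      assume "le T s"
      obtain r where r: "r > 0" "ball s r \<subseteq> J" using oJ s open_contains_ball by blast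
      have "s + r/2 \<in> J" "s - r/2 \<in> J" using r by (auto simp: dist_real_def)
      then obtain s' where s': "s' \<in> J" "\<not> le s' s" using le r(1) by fastforce
      then have "T \<in> {s. \<not> le s' s}" using \<open>le T s\<close> le by auto
      then obtain s0 where s0: "s0 \<in> J" "\<forall>s\<in>J. le s0 s \<longrightarrow> \<not> le s' s"
        using R[OF before_open open_UNIV, of s'] by auto
      then show False using s'(1) refl total by blast
    qed
    obtain \<kappa> where \<kappa>: "\<kappa> \<in> A" "q \<in> fst \<kappa>" by (rule chart_at)
    have "open (fst \<kappa>)" using chart_facts(1)[OF is_chart[OF \<kappa>(1)]] .
    from R[OF open_UNIV this] \<kappa>(2) obtain s0 where s0: "s0 \<in> J" "\<And>s. s \<in> J \<Longrightarrow> le s0 s \<Longrightarrow> \<gamma> s \<in> fst \<kappa>"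
      by auto
    define \<epsilon> where "\<epsilon> = \<bar>T - s0\<bar>"
    have side: "s \<in> J \<inter> ball T \<epsilon> \<longleftrightarrow> \<not> le s s0 \<and> \<not> le T s" for s
    proof
      assume "s \<in> J \<inter> ball T \<epsilon>"
      then show "\<not> le s s0 \<and> \<not> le T s"
        using before_T[of s] before_T[OF s0(1)] le by (auto simp: \<epsilon>_def dist_real_def)
    next
      assume s: "\<not> le s s0 \<and> \<not> le T s"
      obtain s1 where "s1 \<in> J" "\<forall>s'\<in>J. le s1 s' \<longrightarrow> \<not> le s' s"
        using R[OF after_open open_UNIV, of s] s by auto
      then have "s1 \<in> J" "\<not> le s1 s" using refl by auto
      then have "s \<in> J" using between[OF s0(1), of s1 s] between[OF _ s0(1), of s1 s] s le by auto
      then show "s \<in> J \<inter> ball T \<epsilon>" using s le by (auto simp: \<epsilon>_def dist_real_def)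
    qed
    have "\<not> maximal_curve J \<gamma>"
    proof (rule extend_across[OF J T _ \<kappa>, of \<epsilon>])
      show "T \<notin> J" using before_T refl by blast
      show "\<epsilon> > 0" using before_T[OF s0(1)] refl by (auto simp: \<epsilon>_def)
      show "J \<inter> ball T \<epsilon> = {T-\<epsilon><..<T} \<or> J \<inter> ball T \<epsilon> = {T<..<T+\<epsilon>}"
        unfolding set_eq_iff side using before_T[OF s0(1)] le by (auto simp: \<epsilon>_def)
      show "\<gamma> s \<in> fst \<kappa>" if "s \<in> J \<inter> ball T \<epsilon>" for s
        using that side[of s] total by (intro s0(2)) auto
      show "eventually (\<lambda>s. \<gamma> s \<in> S) (at T within J)" if S: "open S" "q \<in> S" for S
      proof -
        obtain s1 where s1: "s1 \<in> J" "\<forall>s\<in>J. le s1 s \<longrightarrow> \<gamma> s \<in> S" using R[OF open_UNIV S(1)] S(2) by auto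
        have "eventually (\<lambda>s. s \<in> {s. \<not> le s s1}) (at T)"
          using before_T[OF s1(1)] by (intro eventually_at_in_open' after_open) auto
        then have "eventually (\<lambda>s. s \<in> {s. \<not> le s s1}) (at T within J)"
          using filter_leD[OF at_le[of J UNIV]] by blast
        moreover have "eventually (\<lambda>s. s \<in> J) (at T within J)" by (simp add: eventually_at_filter)
        ultimately show ?thesis by eventually_elim (use s1 total in auto)
      qed
    qed
    with max show False by simp
  qed
  have "\<not> right_endpoint J (\<lambda>s. (s, \<gamma> s)) (T, q)" "\<not> left_endpoint J (\<lambda>s. (s, \<gamma> s)) (T, q)" if "T \<in> I" for T q
    unfolding right_endpoint_def left_endpoint_def
    using no_end[OF that disjI1[OF refl], of q] no_end[OF that disjI2[OF refl], of q] by blast+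
  then show ?thesis unfolding inextendible_def by auto
qed

text \<open>The right-hand side of the differential equation is as often differentiable as the curve, so
  the curve is differentiable once more.\<close>

lemma integral_curve_smooth:
  assumes J: "integral_curve J \<gamma>" and \<kappa>: "\<kappa> \<in> A"
  shows "smooth_on {s \<in> J. \<gamma> s \<in> fst \<kappa>} (\<lambda>s. (s, snd \<kappa> (\<gamma> s)))"
proof -
  let ?Q = "{s \<in> J. \<gamma> s \<in> fst \<kappa>}" and ?y = "\<lambda>s. snd \<kappa> (\<gamma> s)"
  note c = chart_facts[OF is_chart[OF \<kappa>]]
  have Q: "open ?Q" by (rule open_curve_preimage[OF integral_curveD(1,5)[OF J] c(1)])
  have der: "(?y has_derivative (\<lambda>v. v *\<^sub>R V \<kappa> (s, ?y s))) (at s)" if "s \<in> ?Q" for s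
    using integral_curveD(6)[OF J _ \<kappa>] that by (simp add: has_vector_derivative_def)
  have "C_k_on k ?Q ?y" for k
  proof (induction k)
    case 0
    have "continuous_on ?Q ?y"
      using der by (intro continuous_at_imp_continuous_on) (blast intro: has_derivative_continuous)
    then show ?case by simp
  next
    case (Suc k)
    show ?case
    proof (rule C_k_on_SucI[OF Q der])
      fix v
      have L: "bounded_linear (\<lambda>s::real. (s, 0 :: real^3))" "bounded_linear (\<lambda>y::real^3. (0 :: real, y))"
        by (intro bounded_linear_Pair bounded_linear_ident bounded_linear_zero)+
      have id: "C_k_on k ?Q (\<lambda>s. s)"
        using smooth_on_bounded_linear_ident[OF bounded_linear_ident] by (auto simp: smooth_on_def)
      have "C_k_on k ?Q (\<lambda>s. (s, 0) + (0, ?y s))"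
        by (intro C_k_on_add Q C_k_on_bounded_linear[OF Q L(1) id] C_k_on_bounded_linear[OF Q L(2) Suc])
      then have "C_k_on k ?Q (\<lambda>s. (s, ?y s))" by simp
      then have "C_k_on k ?Q (\<lambda>s. V \<kappa> (s, ?y s))"
      proof (rule C_k_on_compose[OF Q, rotated 2])
        show "(\<lambda>s. (s, ?y s)) ` ?Q \<subseteq> I \<times> chart_image \<kappa>"
          using integral_curveD(4)[OF J] c(4) by auto
        show "C_k_on k (I \<times> chart_image \<kappa>) (V \<kappa>)" using smooth_V[OF \<kappa>] by (simp add: smooth_on_def)
      qed
      then show "C_k_on k ?Q (\<lambda>s. v *\<^sub>R V \<kappa> (s, ?y s))"
        by (intro C_k_on_bounded_linear[OF Q bounded_linear_scaleR_right])
    qed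
  qed
  then have "smooth_on ?Q ?y" by (simp add: smooth_on_def)
  then show ?thesis
    by (rule smooth_on_Pair[OF Q smooth_on_bounded_linear_ident[OF bounded_linear_ident]])
qed

end

section \<open>Propagation of the constraints\<close>

text \<open>The product with the integrating factor \<open>exp (- \<integral> g)\<close> is constant.\<close>

lemma linear_ode_zero:
  fixes f g :: "real \<Rightarrow> real"
  assumes N: "is_interval N" "open N" and g: "continuous_on N g"
    and der: "\<And>s. s \<in> N \<Longrightarrow> (f has_vector_derivative g s * f s) (at s)"
    and zero: "s0 \<in> N" "f s0 = 0" and s: "s \<in> N"
  shows "f s = 0"
proof -
  define a b where "a = min s0 s" and "b = max s0 s"
  have sub: "{a..b} \<subseteq> N"
  proof
    fix u assume "u \<in> {a..b}"
    moreover have "a \<in> N" "b \<in> N" using zero(1) s by (simp_all add: a_def b_def min_def max_def)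
    ultimately show "u \<in> N" using N(1) unfolding is_interval_1 by (metis atLeastAtMost_iff)
  qed
  have cg: "continuous_on {a..b} g" by (rule continuous_on_subset[OF g sub])
  let ?G = "\<lambda>u. integral {a..u} g"
  have "((\<lambda>u. f u * exp (- ?G u)) has_vector_derivative 0) (at u within {a..b})" if u: "u \<in> {a..b}" for u
  proof -
    have f: "(f has_real_derivative g u * f u) (at u within {a..b})"
      unfolding has_real_derivative_iff_has_vector_derivative
      using has_vector_derivative_at_within[OF der[OF subsetD[OF sub u]]] .
    have G: "(?G has_real_derivative g u) (at u within {a..b})"
      using integral_has_vector_derivative[OF cg u] by (simp add: has_real_derivative_iff_has_vector_derivative)
    have "((\<lambda>u. exp (- ?G u)) has_real_derivative exp (- ?G u) * - g u) (at u within {a..b})"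
      by (rule DERIV_chain2[OF DERIV_exp DERIV_minus[OF G]])
    from DERIV_mult[OF f this]
    have "((\<lambda>u. f u * exp (- ?G u)) has_real_derivative 0) (at u within {a..b})"
      by (simp add: algebra_simps)
    then show ?thesis by (simp add: has_real_derivative_iff_has_vector_derivative)
  qed
  from has_vector_derivative_zero_constant[OF convex_real_interval(5) this]
  obtain c where c: "\<And>u. u \<in> {a..b} \<Longrightarrow> f u * exp (- ?G u) = c" by blast
  have "s0 \<in> {a..b}" "s \<in> {a..b}" by (auto simp: a_def b_def)
  then have "f s * exp (- ?G s) = 0" using c[of s] c[of s0] zero(2) by simp
  then show ?thesis by simp
qed

locale global_flow =
  fixes A :: "'a::{t2_space,second_countable_topology} chart set" and I :: "real set"
    and \<beta> :: "real \<Rightarrow> 'a \<Rightarrow> real" and e :: "'a coframes"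
  assumes atlas: "smooth_atlas A" and I: "open I"
    and flow: "parallel_spinor_flow A I \<beta> e"
begin

lemma chart_flow: "\<kappa> \<in> A \<Longrightarrow> chart_flow A I \<beta> e \<kappa>"
  using atlas I flow by (simp add: chart_flow_def smooth_atlas_def)

lemma two_charts: "\<kappa> \<in> A \<Longrightarrow> \<kappa>' \<in> A \<Longrightarrow> two_charts A I \<beta> e \<kappa> \<kappa>'"
  using atlas chart_flow by (simp add: two_charts_def two_charts_axioms_def)

text \<open>The spatial part of \<open>\<beta> k = \<partial>\<^sub>t - \<beta> E\<^sub>u\<close>, whose integral curves carry the defect.\<close>

definition null_direction :: "'a chart \<Rightarrow> real \<times> (real^3) \<Rightarrow> real^3" where
  "null_direction \<kappa> p = - chart_flow.B \<beta> \<kappa> p *\<^sub>R chart_flow.E e \<kappa> Leg_u p"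

abbreviation chart_defect :: "'a chart \<Rightarrow> real \<times> (real^3) \<Rightarrow> real" where
  "chart_defect \<kappa> \<equiv> chart_flow.defect \<beta> e \<kappa>"

sublocale time_dependent_field A I null_direction
proof
  show "smooth_atlas A" "open I" by (fact atlas I)+
  show "smooth_on (I \<times> chart_image \<kappa>) (null_direction \<kappa>)" if "\<kappa> \<in> A" for \<kappa>
  proof -
    interpret chart_flow A I \<beta> e \<kappa> by (rule chart_flow[OF that])
    show ?thesis unfolding null_direction_def[abs_def]
      by (intro smooth_on_scaleR smooth_on_minus smooth_B smooth_E W)
  qed
  show "null_direction \<kappa>' (t, transition \<kappa> \<kappa>' x) = dir (null_direction \<kappa> (t, x)) (transition \<kappa> \<kappa>') x"
    if "\<kappa> \<in> A" "\<kappa>' \<in> A" "t \<in> I" "x \<in> snd \<kappa> ` (fst \<kappa> \<inter> fst \<kappa>')" for \<kappa> \<kappa>' t x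
  proof -
    interpret two_charts A I \<beta> e \<kappa> \<kappa>' by (rule two_charts[OF that(1,2)])
    show ?thesis using null_direction_\<phi>[OF that(3), of x] that(4)
      by (simp add: null_direction_def \<phi>_def overlap_def)
  qed
qed

text \<open>The velocity \<open>\<partial>\<^sub>t - \<beta> E\<^sub>u\<close> is null, because \<open>E\<^sub>u\<close> has length one.\<close>

lemma integral_curve_causal:
  assumes J: "integral_curve J \<gamma>" "J \<noteq> {}"
  shows "causal_curve A I (spacetime_metric \<beta> e) J (\<lambda>s. (s, \<gamma> s))"
proof -
  note D = integral_curveD[OF J(1)]
  have curve: "curve_in_chart \<kappa> (\<lambda>s. (s, \<gamma> s)) = (\<lambda>s. (s, snd \<kappa> (\<gamma> s)))" for \<kappa>
    by (simp add: fun_eq_iff curve_in_chart_def)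
  have "smooth_curve A I J (\<lambda>s. (s, \<gamma> s))"
    unfolding smooth_curve_def curve
    using D(1,2,4,5) J(2) integral_curve_smooth[OF J(1)] by (auto intro: continuous_on_Pair continuous_on_id)
  moreover have "vector_derivative (\<lambda>s. (s, snd \<kappa> (\<gamma> s))) (at s) \<noteq> 0 \<and>
      spacetime_metric \<beta> e \<kappa> (s, snd \<kappa> (\<gamma> s)) (vector_derivative (\<lambda>s. (s, snd \<kappa> (\<gamma> s))) (at s))
        (vector_derivative (\<lambda>s. (s, snd \<kappa> (\<gamma> s))) (at s)) \<le> 0"
    if ch: "\<kappa> \<in> A" and s: "s \<in> J" "\<gamma> s \<in> fst \<kappa>" for \<kappa> s
  proof -
    interpret chart_flow A I \<beta> e \<kappa> by (rule chart_flow[OF ch])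
    let ?p = "(s, snd \<kappa> (\<gamma> s))"
    have p: "?p \<in> W" using s D(4) chart_facts(4)[OF is_chart[OF ch]] by auto
    have "((\<lambda>s. (s, snd \<kappa> (\<gamma> s))) has_vector_derivative (1, null_direction \<kappa> ?p)) (at s)"
      by (intro has_vector_derivative_Pair has_vector_derivative_id D(6)[OF s(1) ch s(2)])
    then have v: "vector_derivative (\<lambda>s. (s, snd \<kappa> (\<gamma> s))) (at s) = (1, null_direction \<kappa> ?p)"
      by (rule vector_derivative_at)
    have "h ?p *v E Leg_u ?p = leg Leg_u ?p"
      unfolding h_def E_def by (rule gram_frame[OF coframe_leg[OF p]])
    then have "E Leg_u ?p \<bullet> (h ?p *v E Leg_u ?p) = 1" using leg_E[OF p, of Leg_u Leg_u] by (simp add: inner_commute)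
    then have "(c *\<^sub>R E Leg_u ?p) \<bullet> (h ?p *v (c *\<^sub>R E Leg_u ?p)) = c\<^sup>2" for c
      by (simp add: linear_scale[OF matrix_vector_mul_linear] power2_eq_square)
    from this[of "- B ?p"]
    have "null_direction \<kappa> ?p \<bullet> (h ?p *v null_direction \<kappa> ?p) = (B ?p)\<^sup>2"
      unfolding null_direction_def by (simp only: power2_minus)
    then show ?thesis
      unfolding v by (simp add: spacetime_metric_def coframe_metric_h B_def zero_prod_def)
  qed
  ultimately show ?thesis unfolding causal_curve_def curve by (simp add: Let_def)
qed

text \<open>Near each of its points the curve stays in one chart, where \<open>linear_ode_zero\<close> shows that the
  defect vanishes identically or nowhere. So the times at which it vanishes form an open and closed
  subset of the interval \<open>J\<close>.\<close>

lemma defect_along_curve: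
  assumes J: "integral_curve J \<gamma>" and s: "s0 \<in> J" "s1 \<in> J" and zero: "\<And>\<kappa>. \<kappa> \<in> A \<Longrightarrow> \<gamma> s0 \<in> fst \<kappa> \<Longrightarrow> chart_defect \<kappa> (s0, snd \<kappa> (\<gamma> s0)) = 0"
    and ch: "\<kappa> \<in> A" "\<gamma> s1 \<in> fst \<kappa>"
  shows "chart_defect \<kappa> (s1, snd \<kappa> (\<gamma> s1)) = 0"
proof -
  note D = integral_curveD[OF J]
  define Z where "Z = {s \<in> J. \<forall>\<kappa>\<in>A. \<gamma> s \<in> fst \<kappa> \<longrightarrow> chart_defect \<kappa> (s, snd \<kappa> (\<gamma> s)) = 0}"
  have change: "chart_defect \<kappa>' (s, snd \<kappa>' (\<gamma> s)) = chart_defect \<kappa> (s, snd \<kappa> (\<gamma> s))"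
    if s: "s \<in> J" and ch: "\<kappa> \<in> A" "\<gamma> s \<in> fst \<kappa>" and ch': "\<kappa>' \<in> A" "\<gamma> s \<in> fst \<kappa>'" for s \<kappa> \<kappa>'
  proof -
    interpret two_charts A I \<beta> e \<kappa> \<kappa>' by (rule two_charts[OF ch(1) ch'(1)])
    have "\<phi> (snd \<kappa> (\<gamma> s)) = snd \<kappa>' (\<gamma> s)"
      using chart_facts(3)[OF is_chart[OF ch(1)] ch(2)] by (simp add: \<phi>_def transition_def)
    moreover have "snd \<kappa> (\<gamma> s) \<in> overlap" using ch(2) ch'(2) by (auto simp: overlap_def)
    ultimately show ?thesis using defect_\<phi>[of s "snd \<kappa> (\<gamma> s)"] s D(4) by auto
  qed
  have "\<exists>N. open N \<and> s \<in> N \<and> N \<subseteq> J \<and> (N \<subseteq> Z \<or> N \<inter> Z = {})" if s: "s \<in> J" for s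
  proof -
    obtain \<kappa> where ch: "\<kappa> \<in> A" "\<gamma> s \<in> fst \<kappa>" by (rule chart_at)
    interpret chart_flow A I \<beta> e \<kappa> by (rule chart_flow[OF ch(1)])
    note c = chart_facts[OF is_chart[OF ch(1)]]
    let ?p = "\<lambda>r. (r, snd \<kappa> (\<gamma> r))"
    have "open {r \<in> J. \<gamma> r \<in> fst \<kappa>}" by (rule open_curve_preimage[OF D(1,5) c(1)])
    then obtain \<delta> where \<delta>: "\<delta> > 0" "ball s \<delta> \<subseteq> {r \<in> J. \<gamma> r \<in> fst \<kappa>}"
      using s ch(2) open_contains_ball by (metis (mono_tags, lifting) mem_Collect_eq)
    let ?N = "ball s \<delta>"
    have N: "r \<in> J" "\<gamma> r \<in> fst \<kappa>" "?p r \<in> W" if "r \<in> ?N" for r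
      using \<delta>(2) that D(4) c(4) by auto
    have pder: "(?p has_vector_derivative (1, null_direction \<kappa> (?p r))) (at r)" if "r \<in> ?N" for r
      by (intro has_vector_derivative_Pair has_vector_derivative_id D(6) N[OF that] ch(1))
    have der: "((\<lambda>r. chart_defect \<kappa> (?p r)) has_vector_derivative growth (?p r) * chart_defect \<kappa> (?p r)) (at r)" if r: "r \<in> ?N" for r
    proof -
      have "(chart_defect \<kappa> \<circ> ?p has_vector_derivative dir (1, null_direction \<kappa> (?p r)) (chart_defect \<kappa>) (?p r)) (at r)"
        by (rule vector_derivative_diff_chain_within[OF pder[OF r] has_derivative_at_withinI[OF
              smooth_on_has_derivative[OF smooth_defect N(3)[OF r]]]])
      then show ?thesis
        using defect_transport[OF N(3)[OF r]] by (simp add: comp_def null_direction_def)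
    qed
    have "continuous_on ?N ?p"
      using pder by (intro continuous_at_imp_continuous_on ballI has_vector_derivative_continuous)
    then have g: "continuous_on ?N (\<lambda>r. growth (?p r))"
      by (intro continuous_on_compose2[OF smooth_on_continuous_on[OF smooth_growth]]) (use N(3) in auto)
    have Z: "r \<in> Z \<longleftrightarrow> chart_defect \<kappa> (?p r) = 0" if "r \<in> ?N" for r
    proof
      show "chart_defect \<kappa> (?p r) = 0" if "r \<in> Z"
        using that N(2)[OF \<open>r \<in> ?N\<close>] ch(1) unfolding Z_def by blast
      assume zero: "chart_defect \<kappa> (?p r) = 0"
      have "chart_defect \<kappa>' (r, snd \<kappa>' (\<gamma> r)) = 0" if "\<kappa>' \<in> A" "\<gamma> r \<in> fst \<kappa>'" for \<kappa>'
        unfolding change[OF N(1)[OF \<open>r \<in> ?N\<close>] ch(1) N(2)[OF \<open>r \<in> ?N\<close>] that] by (rule zero)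
      then show "r \<in> Z" unfolding Z_def using N(1)[OF \<open>r \<in> ?N\<close>] by blast
    qed
    have "?N \<subseteq> Z" if "r \<in> ?N" "r \<in> Z" for r
      using linear_ode_zero[OF is_interval_ball_real open_ball g der, of r] that Z by blast
    then have "?N \<subseteq> Z \<or> ?N \<inter> Z = {}" by blast
    moreover have "?N \<subseteq> J" using N(1) by blast
    ultimately show ?thesis using \<delta>(1) by (intro exI[of _ ?N]) simp
  qed
  then have nbhd: "\<And>s. s \<in> J \<Longrightarrow> \<exists>N. open N \<and> s \<in> N \<and> N \<subseteq> J \<and> (N \<subseteq> Z \<or> N \<inter> Z = {})" .
  have "open Z" unfolding open_subopen[of Z]
  proof
    fix s assume "s \<in> Z"
    moreover from this have "s \<in> J" by (simp add: Z_def)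
    then obtain N where "open N" "s \<in> N" "N \<subseteq> J" "N \<subseteq> Z \<or> N \<inter> Z = {}" using nbhd by blast
    ultimately show "\<exists>T. open T \<and> s \<in> T \<and> T \<subseteq> Z" by blast
  qed
  moreover have "open (J - Z)" unfolding open_subopen[of "J - Z"]
  proof
    fix s assume "s \<in> J - Z"
    then obtain N where "open N" "s \<in> N" "N \<subseteq> J" "N \<subseteq> Z \<or> N \<inter> Z = {}" using nbhd by blast
    with \<open>s \<in> J - Z\<close> show "\<exists>T. open T \<and> s \<in> T \<and> T \<subseteq> J - Z" by blast
  qed
  moreover have "Z \<subseteq> J" by (auto simp: Z_def)
  moreover have "s0 \<in> Z" using s(1) zero unfolding Z_def by blast
  ultimately have "J - Z = {}"
    using connectedD[OF D(3), of Z "J - Z"] by blast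
  then have "s1 \<in> Z" using s(2) by blast
  then show ?thesis using ch unfolding Z_def by blast
qed

lemma defect_vanishes:
  assumes t: "t \<in> I" and cauchy: "cauchy_hypersurface A I (spacetime_metric \<beta> e) ({0} \<times> UNIV)"
    and ham: "hamiltonian_constraint A \<beta> e 0" and I0: "0 \<in> I"
    and ch: "\<kappa> \<in> A" and x: "x \<in> chart_image \<kappa>"
  shows "chart_defect \<kappa> (t, x) = 0"
proof -
  note c = chart_facts[OF is_chart[OF ch]]
  obtain J \<gamma> where J: "t \<in> J" "\<gamma> t = chart_inv \<kappa> x" "maximal_curve J \<gamma>"
    by (rule maximal_curve_exists[OF t])
  have int: "integral_curve J \<gamma>" using J(3) by (simp add: maximal_curve_def)
  have "\<exists>!s. s \<in> J \<and> (s, \<gamma> s) \<in> {0} \<times> UNIV"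
    using cauchy integral_curve_causal[OF int] maximal_curve_inextendible[OF J(3)] J(1)
    unfolding cauchy_hypersurface_def by blast
  then have J0: "0 \<in> J" by auto
  have zero: "chart_defect \<kappa>' (0, snd \<kappa>' (\<gamma> 0)) = 0" if "\<kappa>' \<in> A" "\<gamma> 0 \<in> fst \<kappa>'" for \<kappa>'
  proof -
    interpret chart_flow A I \<beta> e \<kappa>' by (rule chart_flow[OF that(1)])
    have "snd \<kappa>' (\<gamma> 0) \<in> chart_image \<kappa>'" using chart_facts(4)[OF is_chart[OF that(1)] that(2)] .
    then show ?thesis
      using ham that(1) slice_constraints(1)[of 0 "snd \<kappa>' (\<gamma> 0)"] I0
      unfolding hamiltonian_constraint_def by blast
  qed
  have "chart_defect \<kappa> (t, snd \<kappa> (\<gamma> t)) = 0"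
    by (rule defect_along_curve[OF int J0 J(1) zero ch]) (use J(2) c(6)[OF x] in auto)
  then show ?thesis using J(2) c(5)[OF x] by simp
qed

end

theorem theorem3p9:
  fixes A :: "'a::{t2_space,second_countable_topology} chart set"
    and I :: "real set"
    and \<beta> :: "real \<Rightarrow> 'a \<Rightarrow> real"
    and e :: "'a coframes"
  assumes "connected_oriented_3manifold A"
    and "open I" and "is_interval I" and "0 \<in> I"
    and "parallel_spinor_flow A I \<beta> e"
    and "globally_hyperbolic A I (spacetime_metric \<beta> e)"
    and "\<forall>t\<in>I. cauchy_hypersurface A I (spacetime_metric \<beta> e) ({t} \<times> UNIV)"
    and "hamiltonian_constraint A \<beta> e 0"
    and "momentum_constraint A \<beta> e 0"
  shows "\<forall>t\<in>I. hamiltonian_constraint A \<beta> e t \<and> momentum_constraint A \<beta> e t"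
proof
  fix t assume t: "t \<in> I"
  interpret global_flow A I \<beta> e
    using assms by (simp add: global_flow_def connected_oriented_3manifold_def)
  have defect: "chart_defect \<kappa> (t, x) = 0" if "\<kappa> \<in> A" "x \<in> chart_image \<kappa>" for \<kappa> x
    using assms(4,7,8) t that by (intro defect_vanishes) auto
  show "hamiltonian_constraint A \<beta> e t \<and> momentum_constraint A \<beta> e t"
    unfolding hamiltonian_constraint_def momentum_constraint_def
  proof (intro conjI ballI)
    fix \<kappa> x assume ch: "\<kappa> \<in> A" and x: "x \<in> chart_image \<kappa>"
    interpret chart_flow A I \<beta> e \<kappa> by (rule chart_flow[OF ch])
    show "scalar_curvature (coframe_metric e t \<kappa>) x =
          metric_norm_sq (coframe_metric e t \<kappa> x) (Theta \<beta> e t \<kappa> x)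
          - (metric_trace (coframe_metric e t \<kappa> x) (Theta \<beta> e t \<kappa> x))\<^sup>2"
      using slice_constraints(1)[of t x] defect[OF ch x] t x by blast
    show "differential (\<lambda>y. metric_trace (coframe_metric e t \<kappa> y) (Theta \<beta> e t \<kappa> y)) x =
          divergence2 (coframe_metric e t \<kappa>) (Theta \<beta> e t \<kappa>) x"
      using slice_constraints(2)[of t x] defect[OF ch x] t x by blast
  qed
qed

end
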